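(* Let $p\ge 3$ and $n\ge 8p^5$ be integers. Let $\mathcal{G}$ be the family consisting of all $n$-vertex $K_{p+1}$-free graphs with exactly $\mathrm{ex}(n,K_p)$ edges. Then $$\min_{G\in \mathcal{G}\setminus\{T_{p-1}(n)\}} f_{p+1}(G)=\frac{2(p-2)^2}{p(4p^2-11p+8)}n^2-\frac{(p-2)(2p-3)}{4p^2-11p+8}n+O_p(1).$$ In addition, if $n$ is divisible by $p(p-1)(4p^2-11p+8)$, then $$\min_{G\in \mathcal{G}\setminus\{T_{p-1}(n)\}} f_{p+1}(G)=\frac{2(p-2)^2}{p(4p^2-11p+8)}n^2-\frac{(p-2)(2p-3)}{4p^2-11p+8}n.$$
   Context: All graphs are finite and simple. $\mathrm{ex}(n,K_p)$ denotes the maximum number of edges in an $n$-vertex graph containing no copy of $K_p$ as a subgraph. $T_{p-1}(n)$ is the $(p-1)$-partite Turán graph, i.e. the $n$-vertex complete $(p-1)$-partite graph whose part sizes differ by at most one; the set $\mathcal{G}\setminus\{T_{p-1}(n)\}$ means the graphs in $\mathcal{G}$ not isomorphic to $T_{p-1}(n)$. For a $K_{p+1}$-free graph $G$, a non-edge $e$ of $G$ (a pair of distinct non-adjacent vertices) is a $K_{p+1}$-saturating edge of $G$ if $G+e$ contains a copy of $K_{p+1}$; $f_{p+1}(G)$ denotes the number of $K_{p+1}$-saturating edges of $G$. $O_p(1)$ denotes a quantity bounded in absolute value by a constant depending only on $p$. *)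

theory Defs
  imports Complex_Main "HOL-Library.Ramsey"
begin

text \<open>A graph is given by a vertex set and a set of 2-element subsets of it.\<close>

definition simple_graph :: "'a set \<Rightarrow> 'a set set \<Rightarrow> bool" where
  "simple_graph V E \<longleftrightarrow> finite V \<and> E \<subseteq> nsets V 2"

definition contains_K :: "nat \<Rightarrow> 'a set \<Rightarrow> 'a set set \<Rightarrow> bool" where
  "contains_K q V E \<longleftrightarrow> (\<exists>S \<in> nsets V q. clique S E)"

definition graph_iso :: "'a set \<Rightarrow> 'a set set \<Rightarrow> 'b set \<Rightarrow> 'b set set \<Rightarrow> bool" where
  "graph_iso V E V' E' \<longleftrightarrow> (\<exists>h. bij_betw h V V' \<and> (\<lambda>e. h ` e) ` E = E')"

text \<open>All \<open>n\<close>-vertex graphs are represented, up to isomorphism, on the vertex set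
  \<open>{..<n}\<close>.\<close>

definition ex_K :: "nat \<Rightarrow> nat \<Rightarrow> nat" where
  "ex_K n q = Max {card E | E. simple_graph {..<n} E \<and> \<not> contains_K q {..<n} E}"

text \<open>Edge set, on the vertices \<open>{..<n}\<close>, of the complete \<open>r\<close>-partite graph whose parts
  are the residue classes modulo \<open>r\<close>; \<open>turan_parts_balanced\<close> below shows that the sizes
  of these parts differ by at most one.\<close>

definition turan_edges :: "nat \<Rightarrow> nat \<Rightarrow> nat set set" where
  "turan_edges r n = {{u, v} | u v. u < n \<and> v < n \<and> u mod r \<noteq> v mod r}"

lemma turan_parts_balanced:
  fixes i j r n :: nat
  assumes "i < r" "j < r"
  shows "card {u::nat. u < n \<and> u mod r = i} \<le> card {u::nat. u < n \<and> u mod r = j} + 1"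
proof -
  let ?A = "{u::nat. u < n \<and> u mod r = i}" and ?B = "{u::nat. u < n \<and> u mod r = j}"
  have decomp: "u = u div r * r + i" if "u \<in> ?A" for u
    using that div_mult_mod_eq[of u r] by simp
  have "inj_on (\<lambda>u. u div r) ?A"
  proof (rule inj_onI)
    fix x y assume xy: "x \<in> ?A" "y \<in> ?A" and "x div r = y div r"
    thus "x = y" using decomp[OF xy(1)] decomp[OF xy(2)] by argo
  qed
  hence cA: "card ?A = card ((\<lambda>u. u div r) ` ?A)"
    by (simp add: card_image)
  have "(\<lambda>u. u div r) ` ?A \<subseteq> insert 0 (Suc ` (\<lambda>u. u div r) ` ?B)"
  proof
    fix k assume "k \<in> (\<lambda>u. u div r) ` ?A"
    then obtain u where u: "u \<in> ?A" "k = u div r" by auto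
    show "k \<in> insert 0 (Suc ` (\<lambda>u. u div r) ` ?B)"
    proof (cases k)
      case 0
      then show ?thesis by simp
    next
      case (Suc l)
      have "u = k * r + i" using decomp[OF u(1)] u(2) by simp
      hence "l * r + j < n" using u(1) Suc assms by simp
      hence B: "l * r + j \<in> ?B" using assms by simp
      have "l = (l * r + j) div r" using assms by simp
      with B have "l \<in> (\<lambda>u. u div r) ` ?B" by (rule rev_image_eqI)
      thus ?thesis using Suc by simp
    qed
  qed
  hence "card ?A \<le> card (insert 0 (Suc ` (\<lambda>u. u div r) ` ?B))"
    unfolding cA by (intro card_mono) auto
  also have "\<dots> \<le> Suc (card (Suc ` (\<lambda>u. u div r) ` ?B))"
    by (simp add: card_insert_if)
  also have "\<dots> \<le> Suc (card ?B)"
    by (simp add: image_image card_image_le)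
  finally show ?thesis by simp
qed

definition saturating_edges :: "nat \<Rightarrow> 'a set \<Rightarrow> 'a set set \<Rightarrow> 'a set set" where
  "saturating_edges q V E = {e \<in> nsets V 2. e \<notin> E \<and> contains_K q V (insert e E)}"

definition sat_count :: "nat \<Rightarrow> 'a set \<Rightarrow> 'a set set \<Rightarrow> nat" where
  "sat_count q V E = card (saturating_edges q V E)"

definition extremal_family :: "nat \<Rightarrow> nat \<Rightarrow> nat set set set" where
  "extremal_family p n =
     {E. simple_graph {..<n} E \<and> \<not> contains_K (p + 1) {..<n} E \<and> card E = ex_K n p}"

definition non_turan_family :: "nat \<Rightarrow> nat \<Rightarrow> nat set set set" where
  "non_turan_family p n =
     {E \<in> extremal_family p n. \<not> graph_iso {..<n} E {..<n} (turan_edges (p - 1) n)}"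

text \<open>\<open>Min\<close> is unspecified on the empty set, so statements about \<open>min_sat\<close> should also
  assert \<open>non_turan_family p n \<noteq> {}\<close>.\<close>

definition min_sat :: "nat \<Rightarrow> nat \<Rightarrow> nat" where
  "min_sat p n = Min (sat_count (p + 1) {..<n} ` non_turan_family p n)"

end

theory Submission
  imports Defs "HOL-Analysis.Convex"
begin

text \<open>
  Put \<open>m = p - 1\<close> and let \<open>G\<close> be a \<open>K\<^bsub>p+1\<^esub>\<close>-free graph with \<open>n\<close> vertices and as many edges as
  the Turan graph. If \<open>G\<close> is not the Turan graph, it contains a \<open>K\<^bsub>p\<^esub>\<close> (\<open>turan_unique\<close>). The lower
  bound comes from a fractional packing \<open>z\<close> of the copies of \<open>K\<^bsub>p\<^esub>\<close> in \<open>G\<close>, of total weight \<open>r\<close>,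
  and a fractional vertex cover \<open>y\<close> of the same total, tied together by complementary
  slackness (\<open>fractional_packing_duality\<close>).

  For a copy \<open>T\<close> of \<open>K\<^bsub>p\<^esub>\<close> and \<open>x \<in> T\<close>, let the cell of \<open>x\<close> be the set of vertices whose only
  non-neighbour in \<open>T\<close> is \<open>x\<close>. All pairs inside a cell are saturating edges, because both ends
  are joined to the \<open>K\<^bsub>p-1\<^esub>\<close> on \<open>T - x\<close>. With cells of sizes \<open>N\<^sub>x\<close> this gives at least
  \<open>\<Sum>\<^sub>x N\<^sub>x (N\<^sub>x - 1) / 2\<close> saturating edges, so the task is to find a \<open>T\<close> whose cells are large in
  total although one of them is small. Four observations achieve this on average over \<open>T\<close>,
  chosen with probability proportional to \<open>z\<close>.

  \<^item> Give each vertex the weight 1 minus the weight of the packed cliques through it. The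
    vertices of positive weight are not covered by \<open>y\<close>, so they span no \<open>K\<^bsub>p\<^esub>\<close>, and the
    weighted Turan theorem bounds the weight of the edges that remain. Since \<open>G\<close> has as many
    edges as the Turan graph, the packed cliques must have large degree sums, and hence large
    cells: up to an error, \<open>\<Sum>\<^sub>x N\<^sub>x \<ge> (m-1)n/m + p r/(2m)\<close> on average (\<open>turan_remainder\<close>).
  \<^item> Apart from a rounding term, which vanishes if \<open>m\<close> divides \<open>n\<close>, the error is half the packing
    weight at the vertices far from \<open>T\<close>, those in no cell of \<open>T\<close>.
  \<^item> Replacing \<open>x\<close> by a vertex of its cell gives another \<open>K\<^bsub>p\<^esub>\<close>, so \<open>y\<close> is at least \<open>y x\<close> on the cell
    of \<open>x\<close>. Therefore \<open>\<Sum>\<^sub>x y x N\<^sub>x \<le> r\<close>: cells of covered vertices are small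
    (\<open>cover_cells\<close>).
  \<^item> A vertex \<open>v\<close> far from \<open>T\<close> lies in other packed cliques \<open>T'\<close>, and its saturating edges inside the
    cell of \<open>v\<close> with respect to \<open>T'\<close> have not been counted for \<open>T\<close>. They compensate for the
    error (\<open>sat_lower_bound\<close>).

  Bounding \<open>N (N - 1) / 2\<close> below by tangents whose slope is \<open>A\<close> at uncovered and \<open>C\<close> at fully
  covered vertices turns this into a linear estimate; the squares lost in passing to the
  tangents are what makes the compensation work for cells of any size. The result is
  \<open>saturation_bound\<close>, an explicit bound in terms of \<open>r\<close>, \<open>A\<close> and \<open>C\<close>, and choosing \<open>A\<close> and \<open>C\<close>
  optimally gives the claimed value up to an error depending only on \<open>p\<close>
  (\<open>saturation_optimum\<close>). If \<open>m\<close> divides \<open>n\<close>, the error is less than 1, so the bound is sharp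
  where the claimed value is an integer.

  For the upper bound, take the \<open>m\<close>-partite Turan graph on \<open>n - c\<close> vertices and join \<open>c\<close>
  further, pairwise non-adjacent vertices to \<open>S\<close> of its vertices, spread evenly over the
  \<open>m\<close> parts, where \<open>S = (m-1)(2n-c)/(2m)\<close> makes the number of edges exactly right.
  Saturating edges then only join two of the \<open>c\<close> new vertices, or two of the \<open>S\<close> vertices in the
  same part (\<open>joined_saturating\<close>). Their number is a quadratic polynomial in \<open>c\<close>, up to rounding, and
  it agrees with the lower bound when \<open>c\<close> is close to its minimiser.
\<close>

section \<open>A weighted form of Turan's theorem\<close>

text \<open>
  The Motzkin--Straus inequality. Edge weight is a quadratic form that is linear along the
  direction moving weight between two non-adjacent vertices, so weight can be moved to the one
  of larger weighted degree until the support is a clique; there it is the Cauchy--Schwarz inequality.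
\<close>

lemma weighted_turan:
  fixes w :: "'a \<Rightarrow> real" and adj :: "'a \<Rightarrow> 'a \<Rightarrow> bool"
  assumes fin: "finite V"
    and sym: "\<And>u v. adj u v \<Longrightarrow> adj v u" and irr: "\<And>u. \<not> adj u u"
    and k: "k \<ge> 1"
    and nonneg: "\<And>v. v \<in> V \<Longrightarrow> w v \<ge> 0"
    and free: "\<And>S. S \<subseteq> {v\<in>V. w v > 0} \<Longrightarrow> (\<forall>u\<in>S. \<forall>v\<in>S. u \<noteq> v \<longrightarrow> adj u v) \<Longrightarrow> card S \<le> k"
  shows "real k * (\<Sum>u\<in>V. \<Sum>v\<in>V. of_bool (adj u v) * w u * w v) \<le> (real k - 1) * (\<Sum>v\<in>V. w v)^2"
  using nonneg free
proof (induction "card {v\<in>V. w v > 0}" arbitrary: w rule: less_induct)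
  case (less w)
  let ?S = "\<lambda>w::'a\<Rightarrow>real. {v\<in>V. w v > 0}"
  let ?Q = "\<lambda>w::'a\<Rightarrow>real. \<Sum>u\<in>V. \<Sum>v\<in>V. of_bool (adj u v) * w u * w v"
  define D where "D x = (\<Sum>y\<in>V. of_bool (adj x y) * w y)" for x
  note nonneg = less.prems(1) and free = less.prems(2)
  have sym_iff: "adj u v \<longleftrightarrow> adj v u" for u v using sym by blast
  show ?case
  proof (cases "\<forall>u\<in>?S w. \<forall>v\<in>?S w. u \<noteq> v \<longrightarrow> adj u v")
    case True
    have cardS: "card (?S w) \<le> k" using free True by blast
    have sumS: "(\<Sum>v\<in>?S w. w v) = (\<Sum>v\<in>V. w v)"
      by (rule sum.mono_neutral_left) (use fin nonneg in \<open>auto simp: order_le_less\<close>)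
    have sumS2: "(\<Sum>v\<in>?S w. (w v)^2) = (\<Sum>v\<in>V. (w v)^2)"
      by (rule sum.mono_neutral_left) (use fin nonneg in \<open>auto simp: order_le_less\<close>)
    have "?Q w \<le> (\<Sum>u\<in>V. \<Sum>v\<in>V. w u * w v - of_bool (u = v) * (w u * w v))"
      using irr nonneg by (intro sum_mono) (auto)
    also have "\<dots> = (\<Sum>v\<in>V. w v)^2 - (\<Sum>u\<in>V. \<Sum>v\<in>V. of_bool (u = v) * (w u * w v))"
      by (simp only: sum_subtractf power2_eq_square sum_product)
    also have "(\<Sum>u\<in>V. \<Sum>v\<in>V. of_bool (u = v) * (w u * w v)) = (\<Sum>v\<in>V. (w v)^2)"
    proof -
      have "(\<Sum>u\<in>V. \<Sum>v\<in>V. of_bool (u = v) * (w u * w v)) = (\<Sum>u\<in>V. \<Sum>v\<in>V. if u = v then w u * w v else 0)"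
        by (intro sum.cong) auto
      then show ?thesis using fin by (simp add: power2_eq_square)
    qed
    finally have 1: "?Q w \<le> (\<Sum>v\<in>V. w v)^2 - (\<Sum>v\<in>V. (w v)^2)" .
    have "(\<Sum>v\<in>?S w. w v)^2 \<le> (\<Sum>v\<in>?S w. (w v)^2) * real (card (?S w))"
      by (rule sum_squared_le_sum_of_squares)
    also have "\<dots> \<le> (\<Sum>v\<in>?S w. (w v)^2) * real k"
      using cardS by (intro mult_left_mono) (auto intro: sum_nonneg)
    finally have 2: "(\<Sum>v\<in>V. w v)^2 \<le> real k * (\<Sum>v\<in>V. (w v)^2)"
      by (simp add: sumS sumS2 mult.commute)
    have "real k * ?Q w \<le> real k * ((\<Sum>v\<in>V. w v)^2 - (\<Sum>v\<in>V. (w v)^2))"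
      using 1 by (intro mult_left_mono) auto
    with 2 show ?thesis by (simp add: algebra_simps)
  next
    case False
    obtain u v where uv: "u \<in> ?S w" "v \<in> ?S w" "u \<noteq> v" "\<not> adj u v" "D u \<ge> D v"
    proof -
      obtain u v where "u \<in> ?S w" "v \<in> ?S w" "u \<noteq> v" "\<not> adj u v" using False by blast
      with that[of u v] that[of v u] show ?thesis using sym_iff by (cases "D u \<ge> D v") auto
    qed
    (* All the weight of v moves to u; d is the direction of the move. *)
    define t where "t = w v"
    define d :: "'a \<Rightarrow> real" where "d x = of_bool (x = u) - of_bool (x = v)" for x
    define w' where "w' x = w x + t * d x" for x
    have tpos: "t > 0" using uv t_def by auto
    have w'_simps: "w' u = w u + w v" "w' v = 0" "\<And>x. x \<noteq> u \<Longrightarrow> x \<noteq> v \<Longrightarrow> w' x = w x"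
      using uv by (auto simp: w'_def d_def t_def)
    have sub: "?S w' \<subseteq> ?S w - {v}"
    proof
      fix x assume x: "x \<in> ?S w'"
      then show "x \<in> ?S w - {v}" using uv w'_simps by (cases "x = u"; cases "x = v") auto
    qed
    have card_less: "card (?S w') < card (?S w)"
      by (rule psubset_card_mono) (use fin uv sub in auto)
    have nn: "w' x \<ge> 0" if "x \<in> V" for x
      using that nonneg[OF that] uv w'_simps nonneg[of v] by (cases "x = u"; cases "x = v") auto
    have IH: "real k * ?Q w' \<le> (real k - 1) * (\<Sum>v\<in>V. w' v)^2"
    proof (rule less.hyps[OF card_less])
      show "0 \<le> w' x" if "x \<in> V" for x by (rule nn[OF that])
      show "card S \<le> k" if "S \<subseteq> ?S w'" "\<forall>u\<in>S. \<forall>v\<in>S. u \<noteq> v \<longrightarrow> adj u v" for S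
      proof (rule free)
        show "S \<subseteq> ?S w" using that(1) sub by blast
      qed (rule that(2))
    qed
    have d_sum: "(\<Sum>x\<in>V. d x * F x) = F u - F v" for F
    proof -
      have "(\<Sum>x\<in>V. d x * F x) = (\<Sum>x\<in>V. of_bool (x = u) * F x) - (\<Sum>x\<in>V. of_bool (x = v) * F x)"
        by (simp add: d_def left_diff_distrib sum_subtractf)
      also have "\<dots> = F u - F v" using uv fin
        by (simp add: of_bool_def if_distrib if_distribR cong: if_cong)
      finally show ?thesis .
    qed
    have tot: "(\<Sum>x\<in>V. w' x) = (\<Sum>x\<in>V. w x)"
      using d_sum[of "\<lambda>_. t"] by (simp add: w'_def sum.distrib mult.commute)
    have Dd: "(\<Sum>y\<in>V. of_bool (adj x y) * d y) = of_bool (adj x u) - of_bool (adj x v)" for x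
      using d_sum[of "\<lambda>y. of_bool (adj x y)"] by (simp add: mult.commute)
    have D': "(\<Sum>y\<in>V. of_bool (adj x y) * w' y) = D x + t * (of_bool (adj x u) - of_bool (adj x v))" for x
    proof -
      have "(\<Sum>y\<in>V. of_bool (adj x y) * w' y) = D x + t * (\<Sum>y\<in>V. of_bool (adj x y) * d y)"
        by (simp add: w'_def D_def algebra_simps sum.distrib sum_distrib_left)
      then show ?thesis by (simp add: Dd)
    qed
    have Qform: "?Q g = (\<Sum>x\<in>V. g x * (\<Sum>y\<in>V. of_bool (adj x y) * g y))" for g
      by (simp add: sum_distrib_left mult_ac)
    have "?Q w' = (\<Sum>x\<in>V. w' x * (D x + t * (of_bool (adj x u) - of_bool (adj x v))))"
      by (simp add: Qform D')
    also have "\<dots> = (\<Sum>x\<in>V. w' x * D x) + t * (\<Sum>x\<in>V. w' x * (of_bool (adj x u) - of_bool (adj x v)))"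
      by (simp add: distrib_left sum.distrib sum_distrib_left mult.left_commute)
    also have "(\<Sum>x\<in>V. w' x * D x) = ?Q w + t * (D u - D v)"
    proof -
      have "(\<Sum>x\<in>V. w' x * D x) = (\<Sum>x\<in>V. w x * D x) + t * (\<Sum>x\<in>V. d x * D x)"
        by (simp add: w'_def distrib_right sum.distrib sum_distrib_left mult.assoc)
      then show ?thesis using d_sum[of D] Qform[of w] by (simp add: D_def)
    qed
    also have "(\<Sum>x\<in>V. w' x * (of_bool (adj x u) - of_bool (adj x v)))
        = (\<Sum>x\<in>V. of_bool (adj u x) * w' x) - (\<Sum>x\<in>V. of_bool (adj v x) * w' x)"
    proof -
      have "of_bool (adj x a) = (of_bool (adj a x) :: real)" for x a
        using sym by (intro arg_cong[where f = of_bool]) blast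
      then have "(\<Sum>x\<in>V. w' x * (of_bool (adj x u) - of_bool (adj x v)))
        = (\<Sum>x\<in>V. of_bool (adj u x) * w' x - of_bool (adj v x) * w' x)"
        by (intro sum.cong refl) (metis right_diff_distrib mult.commute)
      then show ?thesis by (simp only: sum_subtractf)
    qed
    also have "\<dots> = D u - D v"
    proof -
      have "\<not> adj v u" using uv(4) sym by blast
      then show ?thesis using uv(4) irr by (simp add: D')
    qed
    finally have "?Q w' = ?Q w + 2 * t * (D u - D v)" by (simp add: algebra_simps)
    moreover have "2 * t * (D u - D v) \<ge> 0" using tpos uv(5) by simp
    ultimately have "?Q w \<le> ?Q w'" by linarith
    then have "real k * ?Q w \<le> real k * ?Q w'" by (intro mult_left_mono) auto
    with IH tot show ?thesis by simp
  qed
qed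

section \<open>Fractional packings and covers\<close>

lemma finite_family_convergent_subseq:
  fixes f :: "nat \<Rightarrow> 'i \<Rightarrow> real"
  assumes "finite I" and "\<And>i k. i \<in> I \<Longrightarrow> \<bar>f k i\<bar> \<le> B"
  shows "\<exists>s l. strict_mono s \<and> (\<forall>i\<in>I. (\<lambda>k. f (s k) i) \<longlonglongrightarrow> l i)"
  using assms
proof (induction I rule: finite_induct)
  case empty
  have "strict_mono (id :: nat \<Rightarrow> nat)" by (simp add: strict_mono_def)
  then show ?case by blast
next
  case (insert j I)
  then obtain s l where s: "strict_mono s" "\<forall>i\<in>I. (\<lambda>k. f (s k) i) \<longlonglongrightarrow> l i" by auto
  obtain q where q: "strict_mono q" "monoseq (\<lambda>n. f (s (q n)) j)"
    using seq_monosub[of "\<lambda>n. f (s n) j"] by auto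
  have "Bseq (\<lambda>n. f (s (q n)) j)"
    using insert.prems[of j] by (intro BseqI'[where K = B]) auto
  then obtain L where L: "(\<lambda>n. f (s (q n)) j) \<longlonglongrightarrow> L"
    using q Bseq_monoseq_convergent convergent_def by blast
  have "(\<lambda>k. f ((s \<circ> q) k) i) \<longlonglongrightarrow> (l(j := L)) i" if "i \<in> insert j I" for i
  proof (cases "i = j")
    case True then show ?thesis using L by simp
  next
    case False
    then have "(\<lambda>k. f (s k) i) \<longlonglongrightarrow> l i" using that s by auto
    from LIMSEQ_subseq_LIMSEQ[OF this q(1)] show ?thesis using False by (simp add: o_def)
  qed
  moreover have "strict_mono (s \<circ> q)" using s q by (simp add: strict_mono_o)
  ultimately show ?case by blast
qed

lemma sq_pos_part_shift: "(max 0 (t - s))^2 \<le> (max 0 t)^2 - 2 * s * max 0 t + (s::real)^2"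
proof -
  have "\<bar>max 0 (t - s)\<bar> \<le> \<bar>max 0 t - s\<bar>" by (auto simp: max_def abs_if)
  then have "(max 0 (t - s))^2 \<le> (max 0 t - s)^2" by (simp only: abs_le_square_iff)
  then show ?thesis by (simp add: power2_eq_square algebra_simps)
qed

lemma first_order_nonneg:
  fixes a c d :: real
  assumes "d > 0" "c \<ge> 0" and "\<And>s. 0 < s \<Longrightarrow> s \<le> d \<Longrightarrow> 0 \<le> a * s + c * s^2"
  shows "a \<ge> 0"
proof (rule ccontr)
  assume "\<not> a \<ge> 0"
  define s where "s = min d (- a / (2 * (c + 1)))"
  have s: "0 < s" "s \<le> d" using assms \<open>\<not> a \<ge> 0\<close> by (auto simp: s_def divide_neg_pos)
  have "s \<le> - a / (2 * (c + 1))" by (simp add: s_def)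
  moreover have "0 < 2 * (c + 1)" using assms(2) by simp
  ultimately have "s * (2 * (c + 1)) \<le> - a" by (simp only: pos_le_divide_eq)
  then have "s * c \<le> - a / 2" using s assms(2) by (simp add: algebra_simps)
  then have "a + c * s < 0" using \<open>\<not> a \<ge> 0\<close> by (simp add: mult.commute)
  then have "s * (a + c * s) < 0" using s by (simp add: mult_pos_neg)
  then show False using assms(3)[OF s] by (simp add: power2_eq_square algebra_simps)
qed

text \<open>
  A smooth substitute for the linear program: instead of forcing \<open>y\<close> to cover every \<open>T\<close>, a
  quadratic penalty is paid for the uncovered part. At a minimiser the derivative of the penalty
  with respect to the sum over \<open>T\<close>, up to sign, plays the role of the dual variable \<open>z T\<close>, and the first-order
  conditions are exactly the capacity and slackness conditions at the vertices. The only defect is that \<open>T\<close> may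
  be uncovered by \<open>z T / k\<close>, which vanishes as \<open>k\<close> grows.
\<close>

lemma penalised_cover:
  fixes \<T> :: "'a set set"
  assumes fV: "finite V" and fT: "finite \<T>" and TV: "\<And>T. T \<in> \<T> \<Longrightarrow> T \<subseteq> V" and k: "(k::real) > 0"
  shows "\<exists>y z. (\<forall>v\<in>V. 0 \<le> y v \<and> y v \<le> 1) \<and> (\<forall>T\<in>\<T>. z T = k * max 0 (1 - sum y T)) \<and>
     (\<forall>v\<in>V. (\<Sum>T\<in>{T\<in>\<T>. v \<in> T}. z T) \<le> 1) \<and>
     (\<forall>v\<in>V. y v > 0 \<longrightarrow> (\<Sum>T\<in>{T\<in>\<T>. v \<in> T}. z T) = 1)"
proof -
  define \<Phi> where "\<Phi> y = sum y V + k / 2 * (\<Sum>T\<in>\<T>. (max 0 (1 - sum y T))^2)" for y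
  define Box where "Box = {y. \<forall>v\<in>V. 0 \<le> y v \<and> y v \<le> (1::real)}"
  have pos: "0 \<le> \<Phi> y" if "y \<in> Box" for y
    using that k unfolding \<Phi>_def Box_def by (intro add_nonneg_nonneg mult_nonneg_nonneg sum_nonneg) auto
  have bdd: "bdd_below (\<Phi> ` Box)" using pos by (intro bdd_belowI[of _ 0]) auto
  have ne: "Box \<noteq> {}" unfolding Box_def by (auto intro!: exI[of _ "\<lambda>_. 0"])
  define M where "M = Inf (\<Phi> ` Box)"
  (* Phi attains its minimum on the box, as the limit of a minimising sequence. *)
  have "\<exists>y\<in>Box. \<Phi> y < M + 1 / Suc j" for j
    using cInf_lessD[of "\<Phi> ` Box" "M + 1 / Suc j"] ne by (auto simp: M_def)
  then obtain Y where Y: "\<And>j. Y j \<in> Box" "\<And>j. \<Phi> (Y j) < M + 1 / Suc j" by metis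
  have "\<exists>s l. strict_mono s \<and> (\<forall>v\<in>V. (\<lambda>j. Y (s j) v) \<longlonglongrightarrow> l v)"
    by (rule finite_family_convergent_subseq[OF fV, of _ 1]) (use Y(1) in \<open>auto simp: Box_def\<close>)
  then obtain s y where s: "strict_mono s" and lim: "\<And>v. v \<in> V \<Longrightarrow> (\<lambda>j. Y (s j) v) \<longlonglongrightarrow> y v"
    by blast
  have yB: "y \<in> Box"
  proof -
    have "0 \<le> y v" "y v \<le> 1" if "v \<in> V" for v
      using LIMSEQ_le_const[OF lim[OF that], of 0] LIMSEQ_le_const2[OF lim[OF that], of 1] Y(1) that
      by (auto simp: Box_def)
    then show ?thesis by (auto simp: Box_def)
  qed
  have limsum: "(\<lambda>j. sum (Y (s j)) T) \<longlonglongrightarrow> sum y T" if "T \<subseteq> V" for T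
    using lim that by (intro tendsto_sum) auto
  have lim\<Phi>: "(\<lambda>j. \<Phi> (Y (s j))) \<longlonglongrightarrow> \<Phi> y"
    unfolding \<Phi>_def using TV by (intro tendsto_intros limsum) auto
  have "(\<lambda>j. M + 1 / Suc (s j)) \<longlonglongrightarrow> M + 0"
    using LIMSEQ_subseq_LIMSEQ[OF LIMSEQ_inverse_real_of_nat s]
    by (intro tendsto_intros) (simp add: o_def field_simps)
  then have "\<Phi> y \<le> M + 0"
    by (rule LIMSEQ_le[OF lim\<Phi>]) (use Y(2) in \<open>auto intro: less_imp_le\<close>)
  then have min: "\<Phi> y \<le> \<Phi> y'" if "y' \<in> Box" for y'
    using cInf_lower[OF _ bdd, of "\<Phi> y'"] that unfolding M_def by fastforce
  define z where "z T = k * max 0 (1 - sum y T)" for T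
  define \<rho> where "\<rho> v = (\<Sum>T\<in>{T\<in>\<T>. v \<in> T}. z T)" for v
  define c where "c = k / 2 * real (card \<T>)"
  have c0: "c \<ge> 0" using k by (simp add: c_def)
  have step: "0 \<le> s * (1 - \<rho> v) + c * s^2" if v: "v \<in> V" and s: "0 \<le> y v + s" "y v + s \<le> 1" for v s
  proof -
    define y' where "y' = y(v := y v + s)"
    have "y' \<in> Box" using yB s by (auto simp: Box_def y'_def)
    have sum': "sum y' T = sum y T + (if v \<in> T then s else 0)" if "finite T" for T
    proof -
      have "sum y' T = (\<Sum>x\<in>T. y x + (if x = v then s else 0))"
        by (rule sum.cong) (auto simp: y'_def)
      then show ?thesis using that by (simp add: sum.distrib)
    qed
    have finT: "finite T" if "T \<in> \<T>" for T using TV[OF that] fV finite_subset by auto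
    have "(max 0 (1 - sum y' T))^2 \<le> (max 0 (1 - sum y T))^2
         - 2 * (if v \<in> T then s else 0) * max 0 (1 - sum y T) + s^2" if "T \<in> \<T>" for T
      using sq_pos_part_shift[of "1 - sum y T" "if v \<in> T then s else 0"] sum'[OF finT[OF that]]
        zero_le_power2[of s]
      by (auto simp: diff_diff_eq)
    then have "(\<Sum>T\<in>\<T>. (max 0 (1 - sum y' T))^2) \<le> (\<Sum>T\<in>\<T>. (max 0 (1 - sum y T))^2
         - 2 * (if v \<in> T then s else 0) * max 0 (1 - sum y T) + s^2)"
      by (rule sum_mono)
    also have "\<dots> = (\<Sum>T\<in>\<T>. (max 0 (1 - sum y T))^2) 
         - 2 * s * (\<Sum>T\<in>{T\<in>\<T>. v \<in> T}. max 0 (1 - sum y T)) + card \<T> * s^2"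
    proof -
      have "(\<Sum>T\<in>\<T>. 2 * (if v \<in> T then s else 0) * max 0 (1 - sum y T))
          = (\<Sum>T\<in>\<T>. if v \<in> T then 2 * s * max 0 (1 - sum y T) else 0)"
        by (rule sum.cong) auto
      also have "\<dots> = (\<Sum>T\<in>{T\<in>\<T>. v \<in> T}. 2 * s * max 0 (1 - sum y T))"
        using fT by (simp add: sum.inter_filter)
      finally show ?thesis by (simp add: sum.distrib sum_subtractf sum_distrib_left)
    qed
    finally have "k / 2 * (\<Sum>T\<in>\<T>. (max 0 (1 - sum y' T))^2) \<le> k / 2 * ((\<Sum>T\<in>\<T>. (max 0 (1 - sum y T))^2) 
         - 2 * s * (\<Sum>T\<in>{T\<in>\<T>. v \<in> T}. max 0 (1 - sum y T)) + card \<T> * s^2)"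
      using k by (intro mult_left_mono) auto
    also have "\<dots> = k / 2 * (\<Sum>T\<in>\<T>. (max 0 (1 - sum y T))^2) - s * \<rho> v + c * s^2"
      by (simp add: \<rho>_def z_def c_def algebra_simps sum_distrib_left)
    finally have "\<Phi> y' \<le> \<Phi> y + s - s * \<rho> v + c * s^2"
      using sum'[OF fV] v by (simp add: \<Phi>_def)
    with min[OF \<open>y' \<in> Box\<close>] show ?thesis by (simp add: algebra_simps)
  qed
  have y01: "0 \<le> y v" "y v \<le> 1" if "v \<in> V" for v using yB that by (auto simp: Box_def)
  (* A vertex of value 1 covers all its sets by itself, so it carries no dual weight; hence
     the upper bound of the box never obstructs a move. *)
  have lt1: "\<rho> v = 0" if v: "v \<in> V" and "y v = 1" for v
  proof -
    have "z T = 0" if "T \<in> \<T>" "v \<in> T" for T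
    proof -
      have "y v \<le> sum y T"
        by (rule member_le_sum) (use that TV[OF that(1)] y01 fV finite_subset in auto)
      then show ?thesis using \<open>y v = 1\<close> by (simp add: z_def)
    qed
    then show ?thesis by (simp add: \<rho>_def)
  qed
  have up: "\<rho> v \<le> 1" if v: "v \<in> V" for v
  proof (cases "y v = 1")
    case True then show ?thesis using lt1[OF v] by simp
  next
    case False
    then have "1 - y v > 0" using y01[OF v] by simp
    then have "0 \<le> 1 - \<rho> v"
      by (rule first_order_nonneg[OF _ c0]) (use step[OF v] y01[OF v] in \<open>auto simp: mult.commute\<close>)
    then show ?thesis by simp
  qed
  have down: "\<rho> v \<ge> 1" if v: "v \<in> V" and yp: "y v > 0" for v
  proof -
    have "0 \<le> \<rho> v - 1"
    proof (rule first_order_nonneg[OF yp c0])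
      fix s assume "0 < s" "s \<le> y v"
      then show "0 \<le> (\<rho> v - 1) * s + c * s^2"
        using step[OF v, of "-s"] y01[OF v] by (simp add: algebra_simps)
    qed
    then show ?thesis by simp
  qed
  show ?thesis
  proof (intro exI conjI ballI impI)
    show "z T = k * max 0 (1 - sum y T)" if "T \<in> \<T>" for T by (simp add: z_def)
    show "0 \<le> y v" "y v \<le> 1" "(\<Sum>T\<in>{T\<in>\<T>. v \<in> T}. z T) \<le> 1" if "v \<in> V" for v
      using y01[OF that] up[OF that] by (simp_all add: \<rho>_def)
    show "(\<Sum>T\<in>{T\<in>\<T>. v \<in> T}. z T) = 1" if "v \<in> V" "y v > 0" for v
      using up[OF that(1)] down[OF that] by (simp add: \<rho>_def)
  qed
qed

text \<open>
  Strong duality of the fractional packing and covering programs of a finite hypergraph, with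
  complementary slackness, as the limit of the penalised problems. The dual weights stay in
  \<open>[0, 1]\<close> because they respect the capacities, so a convergent subsequence exists.
\<close>

theorem fractional_packing_duality:
  fixes \<T> :: "'a set set"
  assumes fV: "finite V" and fT: "finite \<T>" and sub: "\<Union>\<T> \<subseteq> V" and ne: "{} \<notin> \<T>"
  shows "\<exists>y z. (\<forall>v\<in>V. y v \<ge> (0::real)) \<and> (\<forall>T\<in>\<T>. z T \<ge> (0::real)) \<and>
     (\<forall>T\<in>\<T>. sum y T \<ge> 1) \<and> (\<forall>v\<in>V. (\<Sum>T\<in>{T\<in>\<T>. v \<in> T}. z T) \<le> 1) \<and>
     (\<forall>T\<in>\<T>. z T > 0 \<longrightarrow> sum y T = 1) \<and>
     (\<forall>v\<in>V. y v > 0 \<longrightarrow> (\<Sum>T\<in>{T\<in>\<T>. v \<in> T}. z T) = 1)"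
proof -
  have TV: "T \<subseteq> V" if "T \<in> \<T>" for T using sub that by blast
  define P where "P k y z \<longleftrightarrow> (\<forall>v\<in>V. 0 \<le> y v \<and> y v \<le> (1::real)) \<and>
      (\<forall>T\<in>\<T>. z T = real (Suc k) * max 0 (1 - sum y T)) \<and>
      (\<forall>v\<in>V. (\<Sum>T\<in>{T\<in>\<T>. v \<in> T}. z T) \<le> 1) \<and>
      (\<forall>v\<in>V. y v > 0 \<longrightarrow> (\<Sum>T\<in>{T\<in>\<T>. v \<in> T}. z T) = 1)" for k y z
  have "\<exists>y z. P k y z" for k
    unfolding P_def by (rule penalised_cover[OF fV fT TV]) auto
  then obtain Y Z where "\<And>k. P k (Y k) (Z k)" by metis
  note YZ = this[unfolded P_def]
  have Y01: "0 \<le> Y k v" "\<bar>Y k v\<bar> \<le> 1" if "v \<in> V" for k v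
    using conjunct1[OF YZ[of k], rule_format, OF that] by simp_all
  have cap: "(\<Sum>T\<in>{T\<in>\<T>. v \<in> T}. Z k T) \<le> 1" if "v \<in> V" for k v
    using YZ[of k] that by blast
  have Z0: "Z k T \<ge> 0" if "T \<in> \<T>" for k T using YZ[of k] that by simp
  have Z1: "Z k T \<le> 1" if T: "T \<in> \<T>" for k T
  proof -
    obtain v where v: "v \<in> T" using ne T by (cases "T = {}") auto
    have "Z k T \<le> (\<Sum>T\<in>{T\<in>\<T>. v \<in> T}. Z k T)"
      by (rule member_le_sum) (use T v fT Z0 in auto)
    also have "\<dots> \<le> 1" using YZ[of k] v TV[OF T] by auto
    finally show ?thesis .
  qed
  have "\<exists>s l. strict_mono s \<and> (\<forall>v\<in>V. (\<lambda>j. Y (s j) v) \<longlonglongrightarrow> l v)"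
    by (rule finite_family_convergent_subseq[OF fV, of _ 1]) (rule Y01)
  then obtain s y where s: "strict_mono s" and limy: "\<And>v. v \<in> V \<Longrightarrow> (\<lambda>j. Y (s j) v) \<longlonglongrightarrow> y v"
    by blast
  have "\<exists>s' l. strict_mono s' \<and> (\<forall>T\<in>\<T>. (\<lambda>j. Z (s (s' j)) T) \<longlonglongrightarrow> l T)"
    by (rule finite_family_convergent_subseq[OF fT, of _ 1]) (use Z0 Z1 in auto)
  then obtain s' z where s': "strict_mono s'" and limz: "\<And>T. T \<in> \<T> \<Longrightarrow> (\<lambda>j. Z (s (s' j)) T) \<longlonglongrightarrow> z T"
    by blast
  define q where "q j = s (s' j)" for j
  have q: "strict_mono q" using s s' by (auto simp: q_def strict_mono_def)
  have ly: "(\<lambda>j. Y (q j) v) \<longlonglongrightarrow> y v" if "v \<in> V" for v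
    using LIMSEQ_subseq_LIMSEQ[OF limy[OF that] s'] by (simp add: q_def o_def)
  have lz: "(\<lambda>j. Z (q j) T) \<longlonglongrightarrow> z T" if "T \<in> \<T>" for T
    using limz[OF that] by (simp add: q_def)
  have lsum: "(\<lambda>j. sum (Y (q j)) T) \<longlonglongrightarrow> sum y T" if "T \<in> \<T>" for T
    using ly TV[OF that] by (intro tendsto_sum) auto
  have l\<rho>: "(\<lambda>j. \<Sum>T\<in>{T\<in>\<T>. v \<in> T}. Z (q j) T) \<longlonglongrightarrow> (\<Sum>T\<in>{T\<in>\<T>. v \<in> T}. z T)" for v
    using lz by (intro tendsto_sum) auto
  have l1: "(\<lambda>j. 1 - 1 / real (Suc (q j))) \<longlonglongrightarrow> 1 - 0"
    using LIMSEQ_subseq_LIMSEQ[OF LIMSEQ_inverse_real_of_nat q]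
    by (intro tendsto_intros) (simp add: o_def field_simps)
  have lower: "sum (Y k) T \<ge> 1 - 1 / real (Suc k)" if T: "T \<in> \<T>" for k T
  proof -
    have "real (Suc k) * (1 - sum (Y k) T) \<le> real (Suc k) * max 0 (1 - sum (Y k) T)"
      by (intro mult_left_mono) auto
    also have "\<dots> \<le> 1" using YZ[of k] Z1[OF T, of k] T by simp
    finally show ?thesis by (simp add: field_simps)
  qed
  have cover: "sum y T \<ge> 1" if "T \<in> \<T>" for T
    using LIMSEQ_le[OF l1 lsum[OF that]] lower[OF that] by auto
  have tight: "sum y T = 1" if T: "T \<in> \<T>" and pos: "z T > 0" for T
  proof -
    have "eventually (\<lambda>j. Z (q j) T > 0) sequentially"
      using order_tendstoD(1)[OF lz[OF T] pos] .
    then have "eventually (\<lambda>j. sum (Y (q j)) T \<le> 1) sequentially"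
    proof eventually_elim
      case (elim j)
      then have "max 0 (1 - sum (Y (q j)) T) > 0"
        using YZ[of "q j"] T by (simp add: zero_less_mult_iff)
      then show ?case by (simp add: max_def split: if_splits)
    qed
    then have "sum y T \<le> 1"
      by (intro tendsto_upperbound[OF lsum[OF T]]) auto
    with cover[OF T] show ?thesis by simp
  qed
  have full: "(\<Sum>T\<in>{T\<in>\<T>. v \<in> T}. z T) = 1" if v: "v \<in> V" and pos: "y v > 0" for v
  proof -
    have "eventually (\<lambda>j. Y (q j) v > 0) sequentially"
      using order_tendstoD(1)[OF ly[OF v] pos] .
    then have "eventually (\<lambda>j. (\<Sum>T\<in>{T\<in>\<T>. v \<in> T}. Z (q j) T) = 1) sequentially"
      by eventually_elim (use YZ v in blast)
    then have "(\<lambda>j. \<Sum>T\<in>{T\<in>\<T>. v \<in> T}. Z (q j) T) \<longlonglongrightarrow> 1"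
      by (rule tendsto_eventually)
    with l\<rho> show ?thesis using LIMSEQ_unique by blast
  qed
  have caps: "(\<Sum>T\<in>{T\<in>\<T>. v \<in> T}. z T) \<le> 1" if v: "v \<in> V" for v
    by (rule LIMSEQ_le_const2[OF l\<rho>]) (simp add: cap v)
  have y0: "y v \<ge> 0" if v: "v \<in> V" for v
    by (rule LIMSEQ_le_const[OF ly[OF v]]) (simp add: Y01 v)
  have z0: "z T \<ge> 0" if T: "T \<in> \<T>" for T
    by (rule LIMSEQ_le_const[OF lz[OF T]]) (simp add: Z0 T)
  show ?thesis
  proof (intro exI conjI ballI impI)
    show "0 \<le> y v" if "v \<in> V" for v by (rule y0[OF that])
    show "0 \<le> z T" if "T \<in> \<T>" for T by (rule z0[OF that])
    show "1 \<le> sum y T" if "T \<in> \<T>" for T by (rule cover[OF that])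
    show "(\<Sum>T\<in>{T\<in>\<T>. v \<in> T}. z T) \<le> 1" if "v \<in> V" for v by (rule caps[OF that])
    show "sum y T = 1" if "T \<in> \<T>" "0 < z T" for T by (rule tight[OF that])
    show "(\<Sum>T\<in>{T\<in>\<T>. v \<in> T}. z T) = 1" if "v \<in> V" "0 < y v" for v by (rule full[OF that])
  qed
qed

section \<open>The cliques of a packing and their cells\<close>

lemma sum_ordered_pairs:
  assumes "finite V" "F \<subseteq> nsets V 2"
  shows "(\<Sum>u\<in>V. \<Sum>v\<in>V. of_bool ({u, v} \<in> F)) = 2 * real (card F)"
proof -
  have finF: "finite F" using assms finite_subset finite_imp_finite_nsets by blast
  have one: "(\<Sum>u\<in>V. \<Sum>v\<in>V. of_bool ({u, v} = e)) = (2::real)" if e: "e \<in> F" for e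
  proof -
    obtain a b where ab: "e = {a, b}" "a \<in> V" "b \<in> V" "a \<noteq> b"
      using nsets2_E[OF subsetD[OF assms(2) e]] by metis
    have "of_bool ({u, v} = e) = (of_bool (u = a) * of_bool (v = b) + of_bool (u = b) * of_bool (v = a) :: real)" for u v
      using ab by (auto simp: doubleton_eq_iff)
    then have "(\<Sum>u\<in>V. \<Sum>v\<in>V. of_bool ({u, v} = e)) =
        (\<Sum>u\<in>V. of_bool (u = a) * (\<Sum>v\<in>V. of_bool (v = b)) + of_bool (u = b) * (\<Sum>v\<in>V. of_bool (v = a)) :: real)"
      by (simp only: sum.distrib sum_distrib_left)
    also have "\<dots> = 2" using ab assms(1) by (simp add: sum.distrib of_bool_def)
    finally show ?thesis .
  qed
  have "of_bool ({u, v} \<in> F) = (\<Sum>e\<in>F. of_bool ({u, v} = e) :: real)" for u v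
    using finF by (auto simp: of_bool_def)
  then have "(\<Sum>u\<in>V. \<Sum>v\<in>V. of_bool ({u, v} \<in> F)) = (\<Sum>u\<in>V. \<Sum>v\<in>V. \<Sum>e\<in>F. of_bool ({u, v} = e) :: real)"
    by (simp only:)
  also have "\<dots> = (\<Sum>u\<in>V. \<Sum>e\<in>F. \<Sum>v\<in>V. of_bool ({u, v} = e))"
    by (intro sum.cong refl) (rule sum.swap)
  also have "\<dots> = (\<Sum>e\<in>F. \<Sum>u\<in>V. \<Sum>v\<in>V. of_bool ({u, v} = e))" by (rule sum.swap)
  also have "\<dots> = (\<Sum>e\<in>F. 2)" using one by (rule sum.cong[OF refl])
  finally show ?thesis by simp
qed

text \<open>
  A \<open>K\<^bsub>p+1\<^esub>\<close>-free graph with a fractional packing \<open>z\<close> of its \<open>K\<^bsub>p\<^esub>\<close>'s and a fractional cover \<open>y\<close> that are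
  optimal for each other. Adjacency is irreflexive, so a vertex of a clique counts among its
  own non-neighbours there.
\<close>

locale clique_packing =
  fixes V :: "'a set" and E :: "'a set set" and p :: nat and y :: "'a \<Rightarrow> real" and z :: "'a set \<Rightarrow> real"
  fixes \<K>
  defines "\<K> \<equiv> {T \<in> nsets V p. clique T E}"
  assumes graph: "simple_graph V E" and p: "p \<ge> 2" and free: "\<not> contains_K (p + 1) V E"
    and y0: "\<And>v. v \<in> V \<Longrightarrow> y v \<ge> 0" and z0: "\<And>T. T \<in> \<K> \<Longrightarrow> z T \<ge> 0"
    and cover: "\<And>T. T \<in> \<K> \<Longrightarrow> sum y T \<ge> 1"
    and capacity: "\<And>v. v \<in> V \<Longrightarrow> (\<Sum>T\<in>{T\<in>\<K>. v \<in> T}. z T) \<le> 1"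
    and tight: "\<And>T. T \<in> \<K> \<Longrightarrow> z T > 0 \<Longrightarrow> sum y T = 1"
    and full: "\<And>v. v \<in> V \<Longrightarrow> y v > 0 \<Longrightarrow> (\<Sum>T\<in>{T\<in>\<K>. v \<in> T}. z T) = 1"
begin

text \<open>
  In a \<open>K\<^bsub>p+1\<^esub>\<close>-free graph every vertex has at least one non-neighbour in a clique \<open>T\<close>
  of size \<open>p\<close>. The vertices with exactly one are sorted into the cells of \<open>T\<close>; the others are far from \<open>T\<close>.
\<close>

definition miss :: "'a set \<Rightarrow> 'a \<Rightarrow> 'a set" where "miss T v = {x \<in> T. {x, v} \<notin> E}"
definition cell :: "'a set \<Rightarrow> 'a \<Rightarrow> 'a set" where "cell T x = {v \<in> V. miss T v = {x}}"
definition far :: "'a set \<Rightarrow> 'a set" where "far T = {v \<in> V. card (miss T v) \<ge> 2}"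
definition load :: "'a \<Rightarrow> real" where "load v = (\<Sum>T\<in>{T\<in>\<K>. v \<in> T}. z T)"
text \<open>
  The common value of the two programs. In the estimates it takes the place of the size of
  the smallest cell.
\<close>

definition r :: real where "r = sum z \<K>"
definition far_weight :: "'a \<Rightarrow> real" where "far_weight v = (\<Sum>T\<in>{T\<in>\<K>. v \<in> far T}. z T)"
text \<open>
  The weight of the packed cliques through \<open>v\<close> in which \<open>u\<close> can take the place of \<open>v\<close>. It is the
  share of the saturating edge \<open>uv\<close> that is credited to \<open>v\<close>.
\<close>

definition swap_weight :: "'a \<Rightarrow> 'a \<Rightarrow> real" where "swap_weight v u = (\<Sum>T\<in>{T\<in>\<K>. v \<in> T \<and> u \<in> cell T v}. z T)"
definition sat :: "'a \<Rightarrow> 'a \<Rightarrow> bool" where "sat u v \<longleftrightarrow> {u, v} \<in> saturating_edges (p + 1) V E"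

lemma finV: "finite V" using graph by (simp add: simple_graph_def)
lemma EV: "E \<subseteq> nsets V 2" using graph by (simp add: simple_graph_def)
lemma finK: "finite \<K>" using finV by (auto simp: \<K>_def finite_imp_finite_nsets)
lemma irrefl: "{x} \<notin> E" using EV by (auto simp: nsets_def)
lemma KD: assumes "T \<in> \<K>" shows "T \<subseteq> V" "finite T" "card T = p" "clique T E"
  using assms by (auto simp: \<K>_def nsets_def)
lemma edge_sym: "{x, v} \<in> E \<longleftrightarrow> {v, x} \<in> E" by (simp add: insert_commute)

lemma miss_self: assumes "T \<in> \<K>" "x \<in> T" shows "miss T x = {x}"
  using KD(4)[OF assms(1)] assms(2) irrefl by (auto simp: miss_def clique_def)

lemma finite_miss: "T \<in> \<K> \<Longrightarrow> finite (miss T v)" using KD(2) by (auto simp: miss_def)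

lemma miss_nonempty: assumes T: "T \<in> \<K>" and v: "v \<in> V" shows "miss T v \<noteq> {}"
proof
  assume e: "miss T v = {}"
  then have vT: "v \<notin> T" using miss_self[OF T] by force
  have "clique (insert v T) E"
    using KD(4)[OF T] e edge_sym by (auto simp: clique_def miss_def)
  moreover have "insert v T \<in> nsets V (p + 1)"
    using KD[OF T] v vT by (auto simp: nsets_def)
  ultimately show False using free by (auto simp: contains_K_def)
qed

lemma self_cell: assumes "T \<in> \<K>" "x \<in> T" shows "x \<in> cell T x"
  using miss_self[OF assms] KD(1)[OF assms(1)] assms(2) by (auto simp: cell_def)

lemma cell_sub: "cell T x \<subseteq> V" by (auto simp: cell_def)
lemma far_sub: "far T \<subseteq> V" by (auto simp: far_def)
lemma finite_cell: "finite (cell T x)" using finV cell_sub finite_subset by blast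

lemma cell_disj: "v \<in> cell T x \<Longrightarrow> v \<in> cell T x' \<Longrightarrow> x = x'" by (auto simp: cell_def)
lemma cell_mem: "v \<in> cell T x \<Longrightarrow> x \<in> T" by (auto simp: cell_def miss_def)
lemma cell_not_far: "v \<in> cell T x \<Longrightarrow> v \<notin> far T" by (auto simp: cell_def far_def)

lemma Union_cell: assumes T: "T \<in> \<K>" shows "(\<Union>x\<in>T. cell T x) = V - far T"
proof
  show "(\<Union>x\<in>T. cell T x) \<subseteq> V - far T" using cell_sub cell_not_far by blast
  show "V - far T \<subseteq> (\<Union>x\<in>T. cell T x)"
  proof
    fix v assume v: "v \<in> V - far T"
    then have "card (miss T v) < 2" by (auto simp: far_def)
    moreover have "card (miss T v) \<noteq> 0" using miss_nonempty[OF T] v finite_miss[OF T] by auto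
    ultimately have "card (miss T v) = 1" by linarith
    then obtain x where "miss T v = {x}" by (auto simp: card_1_singleton_iff)
    then show "v \<in> (\<Union>x\<in>T. cell T x)" using v by (auto simp: cell_def miss_def)
  qed
qed

lemma sum_cells: fixes g :: "'a \<Rightarrow> real" assumes T: "T \<in> \<K>"
  shows "(\<Sum>x\<in>T. sum g (cell T x)) = sum g (V - far T)"
  unfolding Union_cell[OF T, symmetric]
  by (rule sum.UNION_disjoint[symmetric]) (use KD(2)[OF T] finite_cell cell_disj in blast)+

lemma exchange: assumes T: "T \<in> \<K>" and u: "u \<in> cell T x" shows "insert u (T - {x}) \<in> \<K>"
proof -
  have x: "x \<in> T" using cell_mem[OF u] .
  have m: "miss T u = {x}" and uV: "u \<in> V" using u by (auto simp: cell_def)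
  have un: "u \<notin> T - {x}" using m miss_self[OF T, of u] by auto
  have "clique (insert u (T - {x})) E"
    using KD(4)[OF T] m edge_sym unfolding clique_def miss_def by auto
  moreover have "card (insert u (T - {x})) = p"
    using KD[OF T] x un by (simp add: card_Diff_singleton) (metis card_gt_0_iff empty_iff Suc_pred)
  ultimately show ?thesis using KD[OF T] uV by (auto simp: \<K>_def nsets_def)
qed

text \<open>
  Both \<open>u\<close> and \<open>v\<close> are joined to all of \<open>T - x\<close>, so adding the edge \<open>uv\<close> completes a \<open>K\<^bsub>p+1\<^esub>\<close>. For the
  same reason \<open>uv\<close> is not yet an edge.
\<close>

lemma cell_sat: assumes T: "T \<in> \<K>" and u: "u \<in> cell T x" and v: "v \<in> cell T x" and ne: "u \<noteq> v"
  shows "sat u v"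
proof -
  define S where "S = insert u (insert v (T - {x}))"
  have x: "x \<in> T" using cell_mem[OF u] .
  have K: "insert v (T - {x}) \<in> \<K>" "insert u (T - {x}) \<in> \<K>" using exchange[OF T] u v by auto
  have mu: "miss T u = {x}" "miss T v = {x}" using u v by (auto simp: cell_def)
  have un: "u \<notin> insert v (T - {x})" using mu miss_self[OF T, of u] ne by auto
  have S: "S \<in> nsets V (p + 1)"
    using KD[OF K(1)] u un cell_sub by (auto simp: S_def nsets_def)
  have "clique S (insert {u, v} E)"
    using KD(4)[OF K(1)] KD(4)[OF K(2)] by (auto simp: clique_def S_def insert_commute)
  then have c: "contains_K (p + 1) V (insert {u, v} E)" using S by (auto simp: contains_K_def)
  moreover have "{u, v} \<notin> E"
  proof
    assume "{u, v} \<in> E"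
    then have "insert {u, v} E = E" by auto
    with c free show False by simp
  qed
  moreover have "{u, v} \<in> nsets V 2" using u v ne cell_sub by auto
  ultimately show ?thesis by (auto simp: sat_def saturating_edges_def)
qed

lemma load_swap: "(\<Sum>v\<in>V. \<Sum>T\<in>{T\<in>\<K>. v \<in> T}. G T v) = (\<Sum>T\<in>\<K>. \<Sum>v\<in>T. G T v)" for G :: "'a set \<Rightarrow> 'a \<Rightarrow> real"
proof -
  have "(\<Sum>v\<in>V. \<Sum>T\<in>{T\<in>\<K>. v \<in> T}. G T v) = (\<Sum>T\<in>\<K>. \<Sum>v\<in>{v\<in>V. v \<in> T}. G T v)"
    by (rule sum.swap_restrict[OF finV finK])
  also have "\<dots> = (\<Sum>T\<in>\<K>. \<Sum>v\<in>T. G T v)"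
  proof (rule sum.cong[OF refl])
    fix T assume "T \<in> \<K>"
    then have "{v\<in>V. v \<in> T} = T" using KD(1) by blast
    then show "(\<Sum>v\<in>{v\<in>V. v \<in> T}. G T v) = (\<Sum>v\<in>T. G T v)" by simp
  qed
  finally show ?thesis .
qed

lemma sum_load: "(\<Sum>v\<in>V. g v * load v) = (\<Sum>T\<in>\<K>. z T * sum g T)"
  using load_swap[of "\<lambda>T v. g v * z T"]
  by (simp add: load_def sum_distrib_left mult.commute)

lemma load_le1: "v \<in> V \<Longrightarrow> load v \<le> 1" unfolding load_def by (rule capacity)

lemma total_load: "sum load V = real p * r"
proof -
  have "sum load V = (\<Sum>T\<in>\<K>. z T * real p)"
    using sum_load[of "\<lambda>_. 1"] KD(3) by simp
  then show ?thesis by (simp add: r_def sum_distrib_left mult.commute)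
qed

text \<open>
  Strong duality, from complementary slackness: covered vertices are filled and packed cliques are
  covered exactly once.
\<close>

lemma total_cover: "sum y V = r"
proof -
  have "sum y V = (\<Sum>v\<in>V. y v * load v)"
  proof (rule sum.cong[OF refl])
    fix v assume v: "v \<in> V"
    show "y v = y v * load v"
      using full[OF v] y0[OF v] by (cases "y v = 0") (auto simp: load_def)
  qed
  also have "\<dots> = (\<Sum>T\<in>\<K>. z T * sum y T)" by (rule sum_load)
  also have "\<dots> = sum z \<K>"
  proof (rule sum.cong[OF refl])
    fix T assume T: "T \<in> \<K>"
    show "z T * sum y T = z T"
      using tight[OF T] z0[OF T] by (cases "z T = 0") auto
  qed
  finally show ?thesis by (simp add: r_def)
qed

lemma r_nonneg: "r \<ge> 0" unfolding r_def using z0 by (rule sum_nonneg)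

lemma r_ge1: assumes "\<K> \<noteq> {}" shows "r \<ge> 1"
proof -
  obtain T where T: "T \<in> \<K>" using assms by auto
  have "1 \<le> sum y T" by (rule cover[OF T])
  also have "\<dots> \<le> sum y V" by (rule sum_mono2[OF finV KD(1)[OF T]]) (use y0 in auto)
  finally show ?thesis by (simp add: total_cover)
qed

lemma r_le: "real p * r \<le> real (card V)"
proof -
  have "sum load V \<le> (\<Sum>v\<in>V. 1)" by (rule sum_mono) (rule load_le1)
  then show ?thesis by (simp add: total_load)
qed

text \<open>
  Exchanging \<open>x\<close> for a vertex \<open>u\<close> of its cell gives another \<open>K\<^bsub>p\<^esub>\<close>, which is covered at least once,
  whereas \<open>T\<close> is covered exactly once; so \<open>y x \<le> y u\<close>.
\<close>

lemma cover_cells: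
  assumes T: "T \<in> \<K>" and zT: "z T > 0"
  shows "(\<Sum>x\<in>T. y x * real (card (cell T x))) \<le> r - sum y (far T)"
proof -
  have "(\<Sum>x\<in>T. y x * real (card (cell T x))) = (\<Sum>x\<in>T. \<Sum>u\<in>cell T x. y x)"
    by (simp add: mult.commute)
  also have "\<dots> \<le> (\<Sum>x\<in>T. sum y (cell T x))"
  proof (intro sum_mono)
    fix x u assume x: "x \<in> T" and u: "u \<in> cell T x"
    have un: "u \<notin> T - {x}"
      using u miss_self[OF T, of u] by (auto simp: cell_def)
    have "1 \<le> sum y (insert u (T - {x}))" by (rule cover[OF exchange[OF T u]])
    also have "\<dots> = y u + (sum y T - y x)" using un x KD(2)[OF T] by (simp add: sum_diff1)
    finally show "y x \<le> y u" using tight[OF T zT] by simp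
  qed
  also have "\<dots> = sum y (V - far T)" by (rule sum_cells[OF T])
  also have "\<dots> = sum y V - sum y (far T)" using finV far_sub by (intro sum_diff) auto
  finally show ?thesis by (simp add: total_cover)
qed

lemma deg_clique: fixes g :: "'a \<Rightarrow> real" assumes T: "T \<in> \<K>"
  shows "(\<Sum>x\<in>T. \<Sum>v\<in>V. of_bool ({x, v} \<in> E) * g v) = (\<Sum>v\<in>V. (real p - real (card (miss T v))) * g v)"
proof -
  have "(\<Sum>x\<in>T. of_bool ({x, v} \<in> E)) = real p - real (card (miss T v))" for v
  proof -
    have "(\<Sum>x\<in>T. of_bool ({x, v} \<in> E)) = (\<Sum>x\<in>T. 1 - of_bool ({x, v} \<notin> E) :: real)"
      by (intro sum.cong) auto
    also have "\<dots> = real p - (\<Sum>x\<in>T. of_bool ({x, v} \<notin> E))"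
      using KD(3)[OF T] by (simp add: sum_subtractf)
    also have "(\<Sum>x\<in>T. of_bool ({x, v} \<notin> E)) = real (card (miss T v))"
      using KD(2)[OF T] by (simp add: of_bool_def miss_def sum.If_cases Int_def)
    finally show ?thesis .
  qed
  then show ?thesis
    by (subst sum.swap) (simp add: sum_distrib_right[symmetric])
qed


text \<open>
  The vertex weights \<open>1 - load v\<close> are positive only where \<open>y\<close> vanishes, and such vertices span no \<open>K\<^bsub>p\<^esub>\<close>.
  So the weighted Turan inequality limits the edge weight left after the packing has been removed, and
  inclusion--exclusion converts this into a lower bound on the degree sums of the packed cliques.
  The degree sum of \<open>T\<close> exceeds \<open>(p-2) n\<close> by at most the number of vertices in cells, since
  far vertices miss at least two vertices of \<open>T\<close>. Their further misses \<open>R T\<close> raise the number of vertices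
  in cells that a given degree sum requires by \<open>R T\<close>, and lower the degree sum obtained from the
  edges inside the packing by at most half of that, so they can be dropped.
\<close>

lemma turan_remainder:
  defines "m \<equiv> real p - 1" and "n \<equiv> real (card V)"
  shows "2 * (\<Sum>T\<in>\<K>. z T * real (card (V - far T)))
    \<ge> 2 * real (card E) - 2 * (m - 1) * n * r + real p * m * r^2
      - (\<Sum>T\<in>\<K>. z T * sum load (far T)) - (m - 1) / m * (n - real p * r)^2"
proof -
  define w where "w v = 1 - load v" for v
  define adj where "adj u v \<longleftrightarrow> {u, v} \<in> E" for u v
  have m: "m > 0" "m = real (p - 1)" using p by (auto simp: m_def)
  have free_supp: "card S \<le> p - 1" if S: "S \<subseteq> {v\<in>V. w v > 0}"
      and cl: "\<forall>u\<in>S. \<forall>v\<in>S. u \<noteq> v \<longrightarrow> adj u v" for S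
  proof (rule ccontr)
    assume "\<not> card S \<le> p - 1"
    then have "p \<le> card S" by simp
    then obtain T where T: "T \<subseteq> S" "card T = p" "finite T" using obtain_subset_with_card_n by metis
    have TK: "T \<in> \<K>" using T S cl by (auto simp: \<K>_def nsets_def clique_def adj_def)
    have "\<exists>v\<in>T. y v > 0"
    proof (rule ccontr)
      assume "\<not> (\<exists>v\<in>T. y v > 0)"
      then have "sum y T \<le> 0" by (intro sum_nonpos) auto
      with cover[OF TK] show False by simp
    qed
    then obtain v where v: "v \<in> T" "y v > 0" by blast
    then have "load v = 1" using full[of v] KD(1)[OF TK] by (auto simp: load_def)
    then show False using v T S by (auto simp: w_def)
  qed
  define MS where "MS = (\<Sum>u\<in>V. \<Sum>v\<in>V. of_bool (adj u v) * w u * w v)"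
  have ms: "m * MS \<le> (m - 1) * (\<Sum>v\<in>V. w v)^2"
    unfolding MS_def m(2)
  proof (rule weighted_turan[OF finV])
    show "adj v u" if "adj u v" for u v using that by (simp add: adj_def insert_commute)
    show "\<not> adj u u" for u using irrefl by (simp add: adj_def)
    show "1 \<le> p - 1" using p by simp
    show "0 \<le> w v" if "v \<in> V" for v using load_le1[OF that] by (simp add: w_def)
  qed (rule free_supp)
  have wsum: "(\<Sum>v\<in>V. w v) = n - real p * r"
    by (simp add: w_def sum_subtractf total_load n_def)
  have MS_eq: "MS = 2 * real (card E) - 2 * (\<Sum>T\<in>\<K>. z T * (\<Sum>v\<in>V. real p - card (miss T v)))
      + (\<Sum>T\<in>\<K>. z T * (\<Sum>v\<in>V. (real p - card (miss T v)) * load v))"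
  proof -
    have "MS = (\<Sum>u\<in>V. \<Sum>v\<in>V. of_bool (adj u v) - load u * of_bool (adj u v) - of_bool (adj u v) * load v
        + load u * (of_bool (adj u v) * load v))"
      unfolding MS_def w_def by (intro sum.cong refl) (simp add: algebra_simps)
    also have "\<dots> = (\<Sum>u\<in>V. \<Sum>v\<in>V. of_bool (adj u v)) - (\<Sum>u\<in>V. \<Sum>v\<in>V. load u * of_bool (adj u v))
        - (\<Sum>u\<in>V. \<Sum>v\<in>V. of_bool (adj u v) * load v) + (\<Sum>u\<in>V. \<Sum>v\<in>V. load u * (of_bool (adj u v) * load v))"
      by (simp only: sum.distrib sum_subtractf)
    also have "(\<Sum>u\<in>V. \<Sum>v\<in>V. of_bool (adj u v)) = 2 * real (card E)"
      unfolding adj_def by (rule sum_ordered_pairs[OF finV EV])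
    also have "(\<Sum>u\<in>V. \<Sum>v\<in>V. of_bool (adj u v) * load v) = (\<Sum>u\<in>V. \<Sum>v\<in>V. load u * of_bool (adj u v))"
      by (subst sum.swap) (simp add: adj_def insert_commute mult.commute)
    also have "(\<Sum>u\<in>V. \<Sum>v\<in>V. load u * of_bool (adj u v)) = (\<Sum>u\<in>V. (\<Sum>v\<in>V. of_bool (adj u v) * 1) * load u)"
      by (intro sum.cong refl) (simp only: mult_1_right sum_distrib_left mult.commute[of _ "load _"])
    also have "\<dots> = (\<Sum>T\<in>\<K>. z T * (\<Sum>v\<in>V. (real p - card (miss T v)) * 1))"
      unfolding sum_load adj_def by (intro sum.cong refl) (simp only: deg_clique)
    also have "(\<Sum>u\<in>V. \<Sum>v\<in>V. load u * (of_bool (adj u v) * load v))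
        = (\<Sum>u\<in>V. (\<Sum>v\<in>V. of_bool (adj u v) * load v) * load u)"
      by (simp only: sum_distrib_left[symmetric] mult.commute)
    also have "\<dots> = (\<Sum>T\<in>\<K>. z T * (\<Sum>v\<in>V. (real p - card (miss T v)) * load v))"
      unfolding adj_def sum_load[of "\<lambda>u. \<Sum>v\<in>V. of_bool ({u, v} \<in> E) * load v"]
      by (intro sum.cong refl) (simp only: deg_clique)
    finally show ?thesis by simp
  qed
  define R where "R T = (\<Sum>v\<in>far T. real (card (miss T v)) - 2)" for T
  have miss1: "card (miss T v) = 1" if "T \<in> \<K>" "v \<in> V - far T" for T v
    using that(2) unfolding Union_cell[OF that(1), symmetric] by (auto simp: cell_def)
  have split: "sum g V = sum g (V - far T) + sum g (far T)" for g :: "'a \<Rightarrow> real" and T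
    using sum.subset_diff[OF far_sub finV, of g] by simp
  have cardV: "n = real (card (V - far T)) + real (card (far T))" for T
    using split[of "\<lambda>_. 1"] by (simp add: n_def)
  have deg: "(\<Sum>v\<in>V. real p - card (miss T v)) = (m - 1) * n + real (card (V - far T)) - R T"
    if T: "T \<in> \<K>" for T
  proof -
    have "(\<Sum>v\<in>V. real p - card (miss T v)) = (\<Sum>v\<in>V - far T. m) + (\<Sum>v\<in>far T. (m - 1) - (real (card (miss T v)) - 2))"
      unfolding split[of _ T] using miss1[OF T] by (intro arg_cong2[where f = "(+)"] sum.cong) (auto simp: m_def)
    then show ?thesis using cardV[of T] by (simp add: R_def sum_subtractf algebra_simps)
  qed
  have deg2: "(\<Sum>v\<in>V. (real p - card (miss T v)) * load v) \<ge> real p * m * r - sum load (far T) - R T"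
    if T: "T \<in> \<K>" for T
  proof -
    have "real p * m * r - sum load (far T) - R T = m * sum load V - sum load (far T) - R T"
      by (simp add: total_load)
    also have "\<dots> = (\<Sum>v\<in>V - far T. m * load v) + (\<Sum>v\<in>far T. (m - 1) * load v - (real (card (miss T v)) - 2))"
      unfolding split[of load T] by (simp add: R_def sum_subtractf sum.distrib algebra_simps sum_distrib_left)
    also have "\<dots> \<le> (\<Sum>v\<in>V - far T. (real p - card (miss T v)) * load v) + (\<Sum>v\<in>far T. (real p - card (miss T v)) * load v)"
    proof (intro add_mono sum_mono)
      show "m * load v \<le> (real p - card (miss T v)) * load v" if "v \<in> V - far T" for v
        using miss1[OF T that] by (simp add: m_def)
      fix v assume v: "v \<in> far T"
      then have "2 \<le> card (miss T v)" "v \<in> V" by (auto simp: far_def)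
      then have "(real (card (miss T v)) - 2) * load v \<le> (real (card (miss T v)) - 2) * 1"
        using load_le1 by (intro mult_left_mono) auto
      then show "(m - 1) * load v - (real (card (miss T v)) - 2) \<le> (real p - card (miss T v)) * load v"
        by (simp add: m_def algebra_simps)
    qed
    finally show ?thesis by (simp add: split[of _ T])
  qed
  have R0: "R T \<ge> 0" for T unfolding R_def far_def by (intro sum_nonneg) auto
  have "(\<Sum>T\<in>\<K>. z T * (2 * ((m - 1) * n + real (card (V - far T)) - R T)) - z T * (real p * m * r - sum load (far T) - R T))
      \<ge> 2 * real (card E) - MS"
  proof -
    have "2 * real (card E) - MS = (\<Sum>T\<in>\<K>. z T * (2 * (\<Sum>v\<in>V. real p - card (miss T v)))
         - z T * (\<Sum>v\<in>V. (real p - card (miss T v)) * load v))"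
      unfolding MS_eq by (simp add: sum_subtractf sum_distrib_left mult.left_commute)
    also have "\<dots> \<le> (\<Sum>T\<in>\<K>. z T * (2 * ((m - 1) * n + real (card (V - far T)) - R T)) - z T * (real p * m * r - sum load (far T) - R T))"
      using deg deg2 z0 by (intro sum_mono diff_mono) (auto intro: mult_left_mono)
    finally show ?thesis .
  qed
  also have "(\<Sum>T\<in>\<K>. z T * (2 * ((m - 1) * n + real (card (V - far T)) - R T)) - z T * (real p * m * r - sum load (far T) - R T))
      \<le> (\<Sum>T\<in>\<K>. 2 * (z T * real (card (V - far T))) + z T * (2 * (m - 1) * n - real p * m * r) + z T * sum load (far T))"
  proof (intro sum_mono)
    fix T assume T: "T \<in> \<K>"
    have "z T * R T \<ge> 0" using z0[OF T] R0 by simp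
    then show "z T * (2 * ((m - 1) * n + real (card (V - far T)) - R T)) - z T * (real p * m * r - sum load (far T) - R T)
      \<le> 2 * (z T * real (card (V - far T))) + z T * (2 * (m - 1) * n - real p * m * r) + z T * sum load (far T)"
      by (simp add: algebra_simps)
  qed
  also have "\<dots> = 2 * (\<Sum>T\<in>\<K>. z T * real (card (V - far T))) + r * (2 * (m - 1) * n - real p * m * r)
      + (\<Sum>T\<in>\<K>. z T * sum load (far T))"
    by (simp add: sum.distrib sum_distrib_left[symmetric] sum_distrib_right[symmetric] r_def)
  finally have main: "2 * real (card E) - MS \<le> 2 * (\<Sum>T\<in>\<K>. z T * real (card (V - far T))) + r * (2 * (m - 1) * n - real p * m * r)
      + (\<Sum>T\<in>\<K>. z T * sum load (far T))" .
  have "MS \<le> (m - 1) / m * (n - real p * r)^2"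
    using ms m(1) unfolding wsum by (simp add: field_simps)
  with main show ?thesis by (simp add: algebra_simps power2_eq_square)
qed

end

section \<open>Saturating pairs near and far from a clique\<close>

lemma sum_filter_indicator:
  fixes g :: "'b \<Rightarrow> real"
  assumes "finite S"
  shows "(\<Sum>x\<in>{x\<in>S. P x \<and> Q x}. g x) = (\<Sum>x\<in>{x\<in>S. P x}. of_bool (Q x) * g x)"
  by (rule sum.mono_neutral_cong_left) (use assms in auto)

context clique_packing
begin

lemma swap_weight_nonneg: "swap_weight v u \<ge> 0" unfolding swap_weight_def using z0 by (intro sum_nonneg) auto

lemma swap_weight_le1: assumes "v \<in> V" shows "swap_weight v u \<le> 1"
proof -
  have "swap_weight v u \<le> load v" unfolding swap_weight_def load_def using z0 finK by (intro sum_mono2) auto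
  then show ?thesis using load_le1[OF assms] by simp
qed

lemma swap_weight_zero: assumes "u \<noteq> v" "\<not> sat u v" shows "swap_weight v u = 0"
proof -
  have "{T \<in> \<K>. v \<in> T \<and> u \<in> cell T v} = {}"
    using assms cell_sat self_cell by blast
  then show ?thesis unfolding swap_weight_def by (simp only: sum.empty)
qed

lemma far_weight_bounds: "far_weight v \<ge> 0" "far_weight v \<le> r"
  using z0 finK by (auto simp: far_weight_def r_def intro: sum_nonneg sum_mono2)

text \<open>
  If \<open>u \<in> T\<close> can be replaced by \<open>v\<close>, then \<open>v\<close> is not far from \<open>T\<close>, and \<open>u\<close> is determined by \<open>T\<close>. So every
  clique from which \<open>v\<close> is not far contributes its weight exactly once.
\<close>

lemma swap_weight_incoming: assumes v: "v \<in> V" shows "(\<Sum>u\<in>V. swap_weight u v) = r - far_weight v"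
proof -
  have "(\<Sum>u\<in>V. swap_weight u v) = (\<Sum>u\<in>V. \<Sum>T\<in>{T\<in>\<K>. u \<in> T}. of_bool (v \<in> cell T u) * z T)"
    unfolding swap_weight_def by (rule sum.cong[OF refl]) (rule sum_filter_indicator[OF finK])
  also have "\<dots> = (\<Sum>T\<in>\<K>. \<Sum>u\<in>T. of_bool (v \<in> cell T u) * z T)" by (rule load_swap)
  also have "\<dots> = (\<Sum>T\<in>\<K>. of_bool (v \<notin> far T) * z T)"
  proof (rule sum.cong[OF refl])
    fix T assume T: "T \<in> \<K>"
    have "(\<Sum>u\<in>T. of_bool (v \<in> cell T u)) = (\<Sum>u\<in>T. \<Sum>x\<in>cell T u. of_bool (x = v) :: real)"
      using finite_cell by (intro sum.cong refl) (auto simp: of_bool_def)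
    also have "\<dots> = (\<Sum>x\<in>V - far T. of_bool (x = v))" by (rule sum_cells[OF T])
    also have "\<dots> = of_bool (v \<notin> far T)" using v finV by (auto simp: of_bool_def)
    finally show "(\<Sum>u\<in>T. of_bool (v \<in> cell T u) * z T) = of_bool (v \<notin> far T) * z T"
      by (simp add: sum_distrib_right[symmetric])
  qed
  also have "\<dots> = (\<Sum>T\<in>\<K>. z T - of_bool (v \<in> far T) * z T)"
    by (intro sum.cong refl) auto
  also have "\<dots> = r - (\<Sum>T\<in>\<K>. of_bool (v \<in> far T) * z T)" by (simp only: sum_subtractf r_def)
  also have "(\<Sum>T\<in>\<K>. of_bool (v \<in> far T) * z T) = far_weight v"
    unfolding far_weight_def by (rule sum.mono_neutral_cong_right) (use finK in auto)
  finally show ?thesis .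
qed

lemma swap_weight_outgoing:
  assumes v: "v \<in> V"
  shows "(\<Sum>u\<in>V - {v}. swap_weight v u * g u) = (\<Sum>T\<in>{T\<in>\<K>. v \<in> T}. z T * sum g (cell T v - {v}))"
proof -
  have "(\<Sum>u\<in>V - {v}. swap_weight v u * g u) = (\<Sum>u\<in>V - {v}. \<Sum>T\<in>{T\<in>\<K>. v \<in> T}. of_bool (u \<in> cell T v) * (z T * g u))"
    unfolding swap_weight_def sum_filter_indicator[OF finK] by (simp only: sum_distrib_right mult.assoc)
  also have "\<dots> = (\<Sum>T\<in>{T\<in>\<K>. v \<in> T}. \<Sum>u\<in>V - {v}. of_bool (u \<in> cell T v) * (z T * g u))" by (rule sum.swap)
  also have "\<dots> = (\<Sum>T\<in>{T\<in>\<K>. v \<in> T}. z T * sum g (cell T v - {v}))"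
  proof (rule sum.cong[OF refl])
    fix T
    have "(\<Sum>u\<in>V - {v}. of_bool (u \<in> cell T v) * (z T * g u)) = (\<Sum>u\<in>{u \<in> V - {v}. u \<in> cell T v}. z T * g u)"
      by (rule sum.mono_neutral_cong_right) (use finV in auto)
    also have "{u \<in> V - {v}. u \<in> cell T v} = cell T v - {v}" using cell_sub by blast
    finally show "(\<Sum>u\<in>V - {v}. of_bool (u \<in> cell T v) * (z T * g u)) = z T * sum g (cell T v - {v})"
      by (simp add: sum_distrib_left)
  qed
  finally show ?thesis .
qed

text \<open>
  What \<open>v\<close> may count of the pairs in its cell with respect to \<open>T\<close>: the pair of \<open>v\<close> with itself
  is discarded, and a pair credited from both ends is given up by half at each end. The
  total credited from the other ends is at most \<open>r - far_weight v\<close>.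
\<close>

definition gain :: "'a set \<Rightarrow> 'a \<Rightarrow> real" where
  "gain T v = real (card (cell T v)) - 1 - (r - far_weight v) / 2"

lemma gains_at:
  assumes v: "v \<in> V"
  shows "(\<Sum>T\<in>{T\<in>\<K>. v \<in> T}. z T * gain T v) \<le> (\<Sum>u\<in>V - {v}. swap_weight v u * (1 - swap_weight u v / 2))"
proof -
  have "(\<Sum>T\<in>{T\<in>\<K>. v \<in> T}. z T * gain T v) \<le> (\<Sum>T\<in>{T\<in>\<K>. v \<in> T}. z T * (\<Sum>u\<in>cell T v - {v}. 1 - swap_weight u v / 2))"
  proof (intro sum_mono mult_left_mono)
    fix T assume T: "T \<in> {T\<in>\<K>. v \<in> T}"
    have "(\<Sum>u\<in>cell T v - {v}. swap_weight u v) \<le> (\<Sum>u\<in>V. swap_weight u v)"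
      by (rule sum_mono2[OF finV]) (use cell_sub swap_weight_nonneg in auto)
    also have "\<dots> = r - far_weight v" by (rule swap_weight_incoming[OF v])
    finally have 1: "(\<Sum>u\<in>cell T v - {v}. swap_weight u v) \<le> r - far_weight v" .
    have "card (cell T v - {v}) = card (cell T v) - 1" using self_cell T by (simp add: card_Diff_singleton)
    moreover have "card (cell T v) \<ge> 1" using self_cell[of T v] T finite_cell
      by (metis (no_types, lifting) One_nat_def Suc_leI card_gt_0_iff empty_iff mem_Collect_eq)
    ultimately have 2: "real (card (cell T v - {v})) = real (card (cell T v)) - 1" by simp
    have "(\<Sum>u\<in>cell T v - {v}. 1 - swap_weight u v / 2) = real (card (cell T v - {v})) - (\<Sum>u\<in>cell T v - {v}. swap_weight u v) / 2"
      by (simp add: sum_subtractf sum_divide_distrib)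
    with 1 2 show "gain T v \<le> (\<Sum>u\<in>cell T v - {v}. 1 - swap_weight u v / 2)" by (simp add: gain_def)
  qed (use z0 in auto)
  also have "\<dots> = (\<Sum>u\<in>V - {v}. swap_weight v u * (1 - swap_weight u v / 2))" by (rule swap_weight_outgoing[OF v, symmetric])
  finally show ?thesis .
qed

text \<open>
  A pair meeting the far set of \<open>T\<close> is in no cell of \<open>T\<close>, so it may be counted in addition to
  the pairs inside the cells. If it is credited with shares \<open>a, b \<in> [0, 1]\<close> from its two ends, then
  \<open>a (1 - b/2) + b (1 - a/2) = a + b - a b \<le> 1\<close>, so it is not counted more than once.
\<close>

lemma sat_lower_bound:
  assumes T: "T \<in> \<K>"
  shows "real (sat_count (p + 1) V E) \<ge> (\<Sum>x\<in>T. real (card (cell T x)) * (real (card (cell T x)) - 1) / 2)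
    + (\<Sum>v\<in>far T. \<Sum>T'\<in>{T'\<in>\<K>. v \<in> T'}. z T' * gain T' v)"
proof -
  (* Over ordered pairs, k indicates two distinct vertices of one cell of T, and c is the
     credit given to v for the pair uv when v is far from T. *)
  define k where "k u v = (\<Sum>x\<in>T. of_bool (u \<in> cell T x) * of_bool (v \<in> cell T x) - of_bool (u = v) * of_bool (v \<in> cell T x) :: real)" for u v
  define c where "c v u = of_bool (v \<in> far T \<and> u \<noteq> v) * (swap_weight v u * (1 - swap_weight u v / 2))" for v u
  have symm: "sat u v \<longleftrightarrow> sat v u" for u v by (simp add: sat_def insert_commute)
  have sat_ne: "u \<noteq> v" if "sat u v" for u v using that by (auto simp: sat_def saturating_edges_def)
  have c_le: "c v u + c u v \<le> 1" if uv: "u \<in> V" "v \<in> V" for u v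
  proof -
    have b: "0 \<le> swap_weight u v" "swap_weight u v \<le> 1" "0 \<le> swap_weight v u" "swap_weight v u \<le> 1" using swap_weight_nonneg swap_weight_le1 uv by auto
    have p1: "0 \<le> (1 - swap_weight u v) * (1 - swap_weight v u)" using b by simp
    have "swap_weight v u * (1 - swap_weight u v / 2) \<le> 1 * 1" by (intro mult_mono) (use b in auto)
    moreover have "swap_weight u v * (1 - swap_weight v u / 2) \<le> 1 * 1" by (intro mult_mono) (use b in auto)
    moreover have "swap_weight v u * (1 - swap_weight u v / 2) + swap_weight u v * (1 - swap_weight v u / 2) \<le> 1"
      using p1 by (simp add: algebra_simps)
    ultimately show ?thesis by (auto simp: c_def)
  qed
  have point: "k u v + c v u + c u v \<le> of_bool (sat u v)" if uv: "u \<in> V" "v \<in> V" for u v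
  proof (cases "\<exists>x\<in>T. u \<in> cell T x \<and> v \<in> cell T x")
    case True
    then obtain x where x: "x \<in> T" "u \<in> cell T x" "v \<in> cell T x" by blast
    then have "u \<notin> far T" "v \<notin> far T" using cell_not_far by auto
    then have c0: "c v u = 0" "c u v = 0" by (auto simp: c_def)
    have "k u v = (\<Sum>x'\<in>T. if x' = x then 1 - of_bool (u = v) else 0)"
      unfolding k_def using x cell_disj by (intro sum.cong refl) (auto simp: of_bool_def)
    also have "\<dots> = 1 - of_bool (u = v)" using x KD(2)[OF T] by simp
    finally show ?thesis using c0 cell_sat[OF T x(2,3)] by (auto simp: of_bool_def)
  next
    case False
    then have "k u v = 0" unfolding k_def
      by (intro sum.neutral) (auto simp: of_bool_def)
    moreover have "c v u + c u v \<le> of_bool (sat u v)"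
    proof (cases "sat u v \<or> u = v")
      case True
      then show ?thesis using c_le[OF uv] sat_ne by (auto simp: c_def)
    next
      case nf: False
      then have "swap_weight v u = 0" "swap_weight u v = 0" using swap_weight_zero[of u v] swap_weight_zero[of v u] symm by auto
      then show ?thesis by (simp add: c_def)
    qed
    ultimately show ?thesis by simp
  qed
  have satsub: "saturating_edges (p + 1) V E \<subseteq> nsets V 2" by (auto simp: saturating_edges_def)
  have tot: "(\<Sum>u\<in>V. \<Sum>v\<in>V. of_bool (sat u v)) = 2 * real (sat_count (p + 1) V E)"
    unfolding sat_def sat_count_def by (rule sum_ordered_pairs[OF finV satsub])
  have ksum: "(\<Sum>u\<in>V. \<Sum>v\<in>V. k u v) = (\<Sum>x\<in>T. real (card (cell T x)) * (real (card (cell T x)) - 1))"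
  proof -
    have cardc: "(\<Sum>u\<in>V. of_bool (u \<in> cell T x)) = real (card (cell T x))" for x
      using finV cell_sub[of T x] by (simp add: of_bool_def sum.If_cases Int_absorb1)
    have diag: "(\<Sum>v\<in>V. of_bool (u = v) * of_bool (v \<in> cell T x)) = (of_bool (u \<in> cell T x) :: real)" if "u \<in> V" for u x
    proof -
      have "(\<Sum>v\<in>V. of_bool (u = v) * of_bool (v \<in> cell T x)) = (\<Sum>v\<in>V. if u = v then of_bool (u \<in> cell T x) else (0::real))"
        by (intro sum.cong) auto
      then show ?thesis using finV that by simp
    qed
    have "(\<Sum>u\<in>V. \<Sum>v\<in>V. k u v) = (\<Sum>u\<in>V. \<Sum>x\<in>T. \<Sum>v\<in>V. of_bool (u \<in> cell T x) * of_bool (v \<in> cell T x) - of_bool (u = v) * of_bool (v \<in> cell T x))"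
      unfolding k_def by (rule sum.cong[OF refl]) (rule sum.swap)
    also have "\<dots> = (\<Sum>u\<in>V. \<Sum>x\<in>T. of_bool (u \<in> cell T x) * real (card (cell T x)) - of_bool (u \<in> cell T x))"
      by (intro sum.cong refl) (simp only: sum_subtractf sum_distrib_left[symmetric] cardc diag)
    also have "\<dots> = (\<Sum>x\<in>T. \<Sum>u\<in>V. of_bool (u \<in> cell T x) * real (card (cell T x)) - of_bool (u \<in> cell T x))"
      by (rule sum.swap)
    also have "\<dots> = (\<Sum>x\<in>T. real (card (cell T x)) * (real (card (cell T x)) - 1))"
      by (intro sum.cong refl) (simp add: sum_subtractf sum_distrib_right[symmetric] cardc right_diff_distrib)
    finally show ?thesis .
  qed
  have csum: "(\<Sum>u\<in>V. \<Sum>v\<in>V. c u v) \<ge> (\<Sum>v\<in>far T. \<Sum>T'\<in>{T'\<in>\<K>. v \<in> T'}. z T' * gain T' v)"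
  proof -
    have inner: "(\<Sum>u\<in>V. c v u) = (if v \<in> far T then \<Sum>u\<in>V - {v}. swap_weight v u * (1 - swap_weight u v / 2) else 0)" if "v \<in> V" for v
    proof -
      have "(\<Sum>u\<in>V. c v u) = c v v + (\<Sum>u\<in>V - {v}. c v u)" by (rule sum.remove[OF finV that])
      also have "(\<Sum>u\<in>V - {v}. c v u) = (\<Sum>u\<in>V - {v}. of_bool (v \<in> far T) * (swap_weight v u * (1 - swap_weight u v / 2)))"
        by (intro sum.cong refl) (auto simp: c_def)
      finally show ?thesis by (simp add: c_def)
    qed
    have "(\<Sum>v\<in>V. \<Sum>u\<in>V. c v u) = (\<Sum>v\<in>{v\<in>V. v \<in> far T}. \<Sum>u\<in>V - {v}. swap_weight v u * (1 - swap_weight u v / 2))"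
      using finV inner by (simp add: sum.inter_filter cong: sum.cong)
    also have "{v\<in>V. v \<in> far T} = far T" using far_sub by blast
    finally have "(\<Sum>v\<in>V. \<Sum>u\<in>V. c v u) = (\<Sum>v\<in>far T. \<Sum>u\<in>V - {v}. swap_weight v u * (1 - swap_weight u v / 2))" .
    then show ?thesis using gains_at far_sub by (auto intro!: sum_mono)
  qed
  have "(\<Sum>u\<in>V. \<Sum>v\<in>V. k u v) + (\<Sum>u\<in>V. \<Sum>v\<in>V. c v u) + (\<Sum>u\<in>V. \<Sum>v\<in>V. c u v) \<le> 2 * real (sat_count (p + 1) V E)"
    unfolding tot[symmetric] sum.distrib[symmetric] by (intro sum_mono point)
  moreover have "(\<Sum>u\<in>V. \<Sum>v\<in>V. c v u) = (\<Sum>u\<in>V. \<Sum>v\<in>V. c u v)" by (rule sum.swap)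
  ultimately show ?thesis using csum unfolding ksum by (simp add: sum_divide_distrib[symmetric])
qed

lemma sum_far_swap:
  "(\<Sum>T\<in>\<K>. z T * (\<Sum>v\<in>far T. \<Sum>T'\<in>{T'\<in>\<K>. v \<in> T'}. z T' * g T' v))
     = (\<Sum>T\<in>\<K>. z T * (\<Sum>v\<in>T. far_weight v * g T v))" for g :: "'a set \<Rightarrow> 'a \<Rightarrow> real"
proof -
  define G where "G v = (\<Sum>T'\<in>{T'\<in>\<K>. v \<in> T'}. z T' * g T' v)" for v
  have "(\<Sum>T\<in>\<K>. z T * sum G (far T)) = (\<Sum>T\<in>\<K>. \<Sum>v\<in>{v\<in>V. v \<in> far T}. z T * G v)"
  proof (rule sum.cong[OF refl])
    fix T
    have "{v\<in>V. v \<in> far T} = far T" using far_sub by blast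
    then show "z T * sum G (far T) = (\<Sum>v\<in>{v\<in>V. v \<in> far T}. z T * G v)"
      by (simp add: sum_distrib_left)
  qed
  also have "\<dots> = (\<Sum>v\<in>V. \<Sum>T\<in>{T\<in>\<K>. v \<in> far T}. z T * G v)"
    by (rule sum.swap_restrict[OF finK finV])
  also have "\<dots> = (\<Sum>v\<in>V. far_weight v * G v)" by (simp add: far_weight_def sum_distrib_right)
  also have "\<dots> = (\<Sum>v\<in>V. \<Sum>T\<in>{T\<in>\<K>. v \<in> T}. z T * (far_weight v * g T v))"
    by (simp add: G_def sum_distrib_left mult.left_commute)
  also have "\<dots> = (\<Sum>T\<in>\<K>. \<Sum>v\<in>T. z T * (far_weight v * g T v))" by (rule load_swap)
  finally show ?thesis by (simp add: G_def sum_distrib_left)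
qed

text \<open>
  Average \<open>sat_lower_bound\<close> over the packing. Each cell of size \<open>N\<close> is estimated by
  \<open>N (N - 1) / 2 = s N - (s + 1/2)\<^sup>2 / 2 + (N - s - 1/2)\<^sup>2 / 2\<close> with the slope \<open>s = A - (A - C) y x\<close>. The
  linear terms are controlled by \<open>turan_remainder\<close> and \<open>cover_cells\<close>, and the constant terms are convex
  in \<open>y\<close>, hence largest when a single vertex of \<open>T\<close> carries the whole cover. With
  \<open>o = far_weight v\<close>, what is left at a vertex \<open>v\<close> of \<open>T\<close> is the square \<open>(o - (s + 1/2 - N))\<^sup>2 / 2\<close> plus \<open>o (A - 1 - r) / 2\<close>, which is nonnegative
  as soon as \<open>A \<ge> r + 1\<close>. The parameter \<open>\<epsilon>\<close> measures how far the number of edges stays below \<open>(m-1) n\<^sup>2 / (2m)\<close>.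
\<close>

theorem saturation_bound:
  fixes A C :: real
  defines "m \<equiv> real p - 1" and "n \<equiv> real (card V)"
  defines "\<epsilon> \<equiv> (m - 1) * n^2 / (2 * m) - real (card E)"
  assumes AC: "C \<le> A" and Ar: "r + 1 \<le> A"
  shows "r * real (sat_count (p + 1) V E) \<ge> A * (r * (m - 1) * n / m + real p * r^2 / (2 * m) - \<epsilon>)
    - (A - C) * r^2 - r * (m * (A + 1/2)^2 + (C + 1/2)^2) / 2"
proof -
  define f where "f = real (sat_count (p + 1) V E)"
  define q where "q T = real (card (V - far T))" for T
  define s where "s x = A - (A - C) * y x" for x
  define N where "N T x = real (card (cell T x))" for T x
  define L where "L = (m * (A + 1/2)^2 + (C + 1/2)^2) / 2"
  define B where "B T = (\<Sum>x\<in>T. (N T x - s x - 1/2)^2 / 2)" for T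
  have m0: "m > 0" using p by (auto simp: m_def)
  have A0: "A \<ge> 0" using Ar r_nonneg by simp
  (* The slope s decreases linearly in y, so that the linear term can use cover_cells. *)
  have one: "z T * f \<ge> z T * (A * q T - (A - C) * (r - sum y (far T)) - L + B T
      + (\<Sum>v\<in>far T. \<Sum>T'\<in>{T'\<in>\<K>. v \<in> T'}. z T' * gain T' v))" if T: "T \<in> \<K>" for T
  proof (cases "z T = 0")
    case False
    then have zT: "z T > 0" using z0[OF T] by simp
    have y01: "0 \<le> y x" "y x \<le> 1" if "x \<in> T" for x
    proof -
      show nn: "0 \<le> y x" using y0 that KD(1)[OF T] by auto
      have "y x \<le> sum y T" by (rule member_le_sum) (use that KD[OF T] y0 in auto)
      then show "y x \<le> 1" using tight[OF T zT] by simp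
    qed
    have square: "N T x * (N T x - 1) / 2 = s x * N T x - (s x + 1/2)^2 / 2 + (N T x - s x - 1/2)^2 / 2" for x
      by (simp add: power2_eq_square field_simps)
    have qsum: "(\<Sum>x\<in>T. N T x) = q T"
      using sum_cells[OF T, of "\<lambda>_. 1"] by (simp add: N_def q_def)
    have "(\<Sum>x\<in>T. s x * N T x) = A * q T - (A - C) * (\<Sum>x\<in>T. y x * N T x)"
      by (simp add: s_def qsum[symmetric] left_diff_distrib sum_subtractf sum_distrib_left mult.assoc)
    moreover have "(A - C) * (\<Sum>x\<in>T. y x * N T x) \<le> (A - C) * (r - sum y (far T))"
      using cover_cells[OF T zT] AC by (intro mult_left_mono) (auto simp: N_def)
    ultimately have lin: "(\<Sum>x\<in>T. s x * N T x) \<ge> A * q T - (A - C) * (r - sum y (far T))" by linarith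
    have quad: "(\<Sum>x\<in>T. (s x + 1/2)^2 / 2) \<le> L"
    proof -
      have "(\<Sum>x\<in>T. (s x + 1/2)^2) \<le> (\<Sum>x\<in>T. (A + 1/2)^2 - 2 * (A + 1/2) * (A - C) * y x + (A - C)^2 * y x)"
      proof (rule sum_mono)
        fix x assume x: "x \<in> T"
        have "y x * y x \<le> 1 * y x" using y01[OF x] by (intro mult_right_mono) auto
        then have "(A - C)^2 * (y x * y x) \<le> (A - C)^2 * y x" by (intro mult_left_mono) auto
        then show "(s x + 1/2)^2 \<le> (A + 1/2)^2 - 2 * (A + 1/2) * (A - C) * y x + (A - C)^2 * y x"
          by (simp add: s_def power2_eq_square algebra_simps)
      qed
      also have "\<dots> = real p * (A + 1/2)^2 - 2 * (A + 1/2) * (A - C) * sum y T + (A - C)^2 * sum y T"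
        using KD(3)[OF T] by (simp add: sum.distrib sum_subtractf sum_distrib_left)
      also have "\<dots> = 2 * L"
        unfolding tight[OF T zT] L_def m_def by (simp add: power2_eq_square field_simps)
      finally show ?thesis by (simp add: sum_divide_distrib[symmetric])
    qed
    have "f \<ge> (\<Sum>x\<in>T. N T x * (N T x - 1) / 2) + (\<Sum>v\<in>far T. \<Sum>T'\<in>{T'\<in>\<K>. v \<in> T'}. z T' * gain T' v)"
      using sat_lower_bound[OF T] by (simp add: f_def N_def)
    also have "(\<Sum>x\<in>T. N T x * (N T x - 1) / 2) = (\<Sum>x\<in>T. s x * N T x) - (\<Sum>x\<in>T. (s x + 1/2)^2 / 2) + B T"
      unfolding square by (simp add: sum.distrib sum_subtractf B_def)
    finally have "f \<ge> A * q T - (A - C) * (r - sum y (far T)) - L + B T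
      + (\<Sum>v\<in>far T. \<Sum>T'\<in>{T'\<in>\<K>. v \<in> T'}. z T' * gain T' v)" using lin quad by linarith
    then show ?thesis using zT by (intro mult_left_mono) auto
  qed simp
  have "r * f = (\<Sum>T\<in>\<K>. z T * f)" by (simp add: r_def sum_distrib_right)
  also have "\<dots> \<ge> (\<Sum>T\<in>\<K>. z T * (A * q T - (A - C) * (r - sum y (far T)) - L + B T
      + (\<Sum>v\<in>far T. \<Sum>T'\<in>{T'\<in>\<K>. v \<in> T'}. z T' * gain T' v)))"
    by (intro sum_mono one)
  also have "(\<Sum>T\<in>\<K>. z T * (A * q T - (A - C) * (r - sum y (far T)) - L + B T
      + (\<Sum>v\<in>far T. \<Sum>T'\<in>{T'\<in>\<K>. v \<in> T'}. z T' * gain T' v)))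
    = A * (\<Sum>T\<in>\<K>. z T * q T) - r * ((A - C) * r + L) + (A - C) * (\<Sum>T\<in>\<K>. z T * sum y (far T))
      + (\<Sum>T\<in>\<K>. z T * B T) + (\<Sum>T\<in>\<K>. z T * (\<Sum>v\<in>T. far_weight v * gain T v))"
    unfolding sum_far_swap[symmetric]
    by (simp add: r_def sum.distrib sum_subtractf sum_distrib_left sum_distrib_right algebra_simps)
  finally have total: "r * f \<ge> A * (\<Sum>T\<in>\<K>. z T * q T) - r * ((A - C) * r + L) + (A - C) * (\<Sum>T\<in>\<K>. z T * sum y (far T))
      + (\<Sum>T\<in>\<K>. z T * B T) + (\<Sum>T\<in>\<K>. z T * (\<Sum>v\<in>T. far_weight v * gain T v))" .
  have yout: "(\<Sum>T\<in>\<K>. z T * sum y (far T)) \<ge> (\<Sum>T\<in>\<K>. z T * (\<Sum>v\<in>T. far_weight v * y v))"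
    unfolding sum_far_swap[symmetric]
  proof (intro sum_mono mult_left_mono)
    fix T v assume "v \<in> far T"
    then have v: "v \<in> V" using far_sub by auto
    have "(\<Sum>T'\<in>{T'\<in>\<K>. v \<in> T'}. z T' * y v) = load v * y v" by (simp add: load_def sum_distrib_right)
    also have "\<dots> \<le> 1 * y v" using load_le1[OF v] y0[OF v] by (intro mult_right_mono)
    finally show "(\<Sum>T'\<in>{T'\<in>\<K>. v \<in> T'}. z T' * y v) \<le> y v" by simp
  qed (use z0 in auto)
  have lout: "(\<Sum>T\<in>\<K>. z T * sum load (far T)) = (\<Sum>T\<in>\<K>. z T * (\<Sum>v\<in>T. far_weight v * 1))"
    unfolding sum_far_swap[symmetric] by (simp add: load_def)
  (* The far vertices are paid for: every summand is a square plus a nonnegative term. *)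
  have rest: "(A - C) * (\<Sum>T\<in>\<K>. z T * (\<Sum>v\<in>T. far_weight v * y v)) + (\<Sum>T\<in>\<K>. z T * B T)
      + (\<Sum>T\<in>\<K>. z T * (\<Sum>v\<in>T. far_weight v * gain T v)) - A / 2 * (\<Sum>T\<in>\<K>. z T * (\<Sum>v\<in>T. far_weight v * 1)) \<ge> 0"
  proof -
    have "(A - C) * (\<Sum>T\<in>\<K>. z T * (\<Sum>v\<in>T. far_weight v * y v)) + (\<Sum>T\<in>\<K>. z T * B T)
      + (\<Sum>T\<in>\<K>. z T * (\<Sum>v\<in>T. far_weight v * gain T v)) - A / 2 * (\<Sum>T\<in>\<K>. z T * (\<Sum>v\<in>T. far_weight v * 1))
      = (\<Sum>T\<in>\<K>. z T * (\<Sum>v\<in>T. (A - C) * (far_weight v * y v) + (N T v - s v - 1/2)^2 / 2 + far_weight v * gain T v - A / 2 * far_weight v))"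
      by (simp add: B_def sum.distrib sum_subtractf sum_distrib_left right_diff_distrib distrib_left mult.left_commute)
    also have "\<dots> \<ge> 0"
    proof (intro sum_nonneg mult_nonneg_nonneg)
      fix T v
      let ?b = "s v + 1/2 - N T v"
      have "(A - C) * (far_weight v * y v) + (N T v - s v - 1/2)^2 / 2 + far_weight v * gain T v - A / 2 * far_weight v
        = (far_weight v - ?b)^2 / 2 + far_weight v * (A - 1 - r) / 2"
        by (simp add: gain_def N_def s_def power2_eq_square field_simps)
      also have "\<dots> \<ge> 0" using far_weight_bounds(1)[of v] Ar by (intro add_nonneg_nonneg) auto
      finally show "0 \<le> (A - C) * (far_weight v * y v) + (N T v - s v - 1/2)^2 / 2 + far_weight v * gain T v - A / 2 * far_weight v" .
    qed (use z0 in auto)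
    finally show ?thesis .
  qed
  have "2 * real (card E) - 2 * (m - 1) * n * r + real p * m * r^2 - (m - 1) / m * (n - real p * r)^2
      = 2 * (r * (m - 1) * n / m + real p * r^2 / (2 * m) - \<epsilon>)"
  proof -
    have pm: "real p = m + 1" by (simp add: m_def)
    show ?thesis unfolding \<epsilon>_def pm using m0 by (simp add: field_simps power2_eq_square)
  qed
  then have "2 * (\<Sum>T\<in>\<K>. z T * q T) \<ge> 2 * (r * (m - 1) * n / m + real p * r^2 / (2 * m) - \<epsilon>)
      - (\<Sum>T\<in>\<K>. z T * sum load (far T))"
    using turan_remainder unfolding q_def m_def n_def by linarith
  then have "A * (2 * (\<Sum>T\<in>\<K>. z T * q T)) \<ge> A * (2 * (r * (m - 1) * n / m + real p * r^2 / (2 * m) - \<epsilon>)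
      - (\<Sum>T\<in>\<K>. z T * sum load (far T)))"
    using A0 by (rule mult_left_mono)
  moreover have "A * a \<ge> A * k - A / 2 * x" if "A * (2 * a) \<ge> A * (2 * k - x)" for a k x :: real
    using that by (simp add: algebra_simps)
  ultimately have qb: "A * (\<Sum>T\<in>\<K>. z T * q T) \<ge> A * (r * (m - 1) * n / m + real p * r^2 / (2 * m) - \<epsilon>)
      - A / 2 * (\<Sum>T\<in>\<K>. z T * sum load (far T))"
    by blast
  have "(A - C) * (\<Sum>T\<in>\<K>. z T * sum y (far T)) \<ge> (A - C) * (\<Sum>T\<in>\<K>. z T * (\<Sum>v\<in>T. far_weight v * y v))"
    using yout AC by (intro mult_left_mono) auto
  with total qb rest have "r * f \<ge> A * (r * (m - 1) * n / m + real p * r^2 / (2 * m) - \<epsilon>) - r * ((A - C) * r + L)"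
    unfolding lout by linarith
  then show ?thesis by (simp add: f_def L_def power2_eq_square algebra_simps)
qed

end

section \<open>Turan's theorem with uniqueness\<close>

text \<open>
  The summand \<open>j - j div m\<close> is the degree of vertex \<open>j\<close> of the Turan graph to the
  vertices before it.
\<close>

definition turan_number :: "nat \<Rightarrow> nat \<Rightarrow> nat" where
  "turan_number m n = (\<Sum>j<n. j - j div m)"

lemma turan_number_Suc: "turan_number m (Suc n) = turan_number m n + (n - n div m)"
  by (simp add: turan_number_def)

lemma turan_number_add: "turan_number m (N + k) + (\<Sum>i<k. (N + i) div m) = turan_number m N + (\<Sum>i<k. N + i)"
proof (induction k)
  case (Suc k)
  have "(N + k) div m \<le> N + k" by simp
  then show ?case using Suc by (simp only: turan_number_Suc add_Suc_right sum.lessThan_Suc)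
qed simp

lemma sum_div_shifts: assumes "m \<ge> 1" shows "(\<Sum>i<m. (N + i) div m) = (N::nat)"
proof (induction N)
  case 0
  show ?case by (intro sum.neutral) auto
next
  case (Suc N)
  obtain m' where m': "m = Suc m'" using assms by (cases m) auto
  have "(\<Sum>i<m. (Suc N + i) div m) + N div m = (\<Sum>i<Suc m. (N + i) div m)"
    by (subst sum.lessThan_Suc_shift) simp
  also have "\<dots> = N + (N + m) div m" using Suc by simp
  also have "(N + m) div m = Suc (N div m)" using assms by simp
  finally show ?case by simp
qed

lemma sum_shift_choose: "(\<Sum>i<k. N + i) = k * N + (k choose 2)"
proof (induction k)
  case (Suc k)
  have "Suc k choose 2 = (k choose 2) + k" by (simp add: numeral_2_eq_2)
  with Suc show ?case by simp
qed simp

text \<open>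
  The right-hand side minus the left-hand side is \<open>N\<close> minus a sum of \<open>k\<close> of the \<open>m\<close> shifted
  quotients whose total is \<open>N\<close> by \<open>sum_div_shifts\<close>.
\<close>

lemma turan_number_step:
  assumes "1 \<le> k" "k \<le> m"
  shows "turan_number m N + (k choose 2) + N * (k - 1) \<le> turan_number m (N + k)"
    and "k < m \<Longrightarrow> N \<ge> 1 \<Longrightarrow> turan_number m N + (k choose 2) + N * (k - 1) < turan_number m (N + k)"
proof -
  have kN: "k * N = N * (k - 1) + N" using assms(1) by (cases k) auto
  have eq: "turan_number m (N + k) + (\<Sum>i<k. (N + i) div m) = turan_number m N + (k choose 2) + N * (k - 1) + N"
    using turan_number_add[of m N k] unfolding sum_shift_choose kN by simp
  have "(\<Sum>i<k. (N + i) div m) \<le> (\<Sum>i<m. (N + i) div m)"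
    using assms by (intro sum_mono2) auto
  with eq show "turan_number m N + (k choose 2) + N * (k - 1) \<le> turan_number m (N + k)"
    using sum_div_shifts[of m N] assms by simp
  assume km: "k < m" and N: "N \<ge> 1"
  have "m \<le> N + (m - 1)" using N km by simp
  then have "1 \<le> (N + (m - 1)) div m" using km by (simp add: Suc_le_eq div_greater_zero_iff)
  then have "(\<Sum>i<k. (N + i) div m) < (\<Sum>i<m. (N + i) div m)"
    using km by (intro sum_strict_mono2[where b = "m - 1"]) auto
  with eq show "turan_number m N + (k choose 2) + N * (k - 1) < turan_number m (N + k)"
    using sum_div_shifts[of m N] assms by simp
qed

lemma edges_through_set:
  assumes V: "finite V" and E: "E \<subseteq> nsets V 2" and K: "K \<subseteq> V"
  shows "card E \<le> card (E \<inter> nsets (V - K) 2) + (card K choose 2) + (\<Sum>v\<in>V - K. card {x\<in>K. {x, v} \<in> E})"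
proof -
  have fK: "finite K" using V K finite_subset by auto
  have "E \<subseteq> (E \<inter> nsets (V - K) 2) \<union> nsets K 2 \<union> (\<Union>v\<in>V - K. (\<lambda>x. {x, v}) ` {x\<in>K. {x, v} \<in> E})"
  proof
    fix e assume e: "e \<in> E"
    then obtain u v where uv: "e = {u, v}" "u \<in> V" "v \<in> V" "u \<noteq> v"
      using nsets2_E[OF subsetD[OF E e]] by metis
    show "e \<in> (E \<inter> nsets (V - K) 2) \<union> nsets K 2 \<union> (\<Union>v\<in>V - K. (\<lambda>x. {x, v}) ` {x\<in>K. {x, v} \<in> E})"
    proof (cases "u \<in> K"; cases "v \<in> K")
      assume "u \<in> K" "v \<notin> K"
      then show ?thesis using uv e by (intro UnI2) auto
    next
      assume "u \<notin> K" "v \<in> K"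
      then have "e = {v, u}" "u \<in> V - K" "v \<in> K" using uv by auto
      then show ?thesis using e by (intro UnI2) auto
    qed (use uv e in auto)
  qed
  moreover have "finite ((E \<inter> nsets (V - K) 2) \<union> nsets K 2 \<union> (\<Union>v\<in>V - K. (\<lambda>x. {x, v}) ` {x\<in>K. {x, v} \<in> E}))"
    using V fK by (auto simp: finite_imp_finite_nsets)
  ultimately have "card E \<le> card ((E \<inter> nsets (V - K) 2) \<union> nsets K 2 \<union> (\<Union>v\<in>V - K. (\<lambda>x. {x, v}) ` {x\<in>K. {x, v} \<in> E}))"
    by (rule card_mono[rotated])
  also have "\<dots> \<le> card (E \<inter> nsets (V - K) 2) + card (nsets K 2) + card (\<Union>v\<in>V - K. (\<lambda>x. {x, v}) ` {x\<in>K. {x, v} \<in> E})"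
    by (meson add_mono card_Un_le le_trans order_refl)
  also have "card (nsets K 2) = card K choose 2" by (rule card_nsets)
  also have "card (\<Union>v\<in>V - K. (\<lambda>x. {x, v}) ` {x\<in>K. {x, v} \<in> E}) \<le> (\<Sum>v\<in>V - K. card ((\<lambda>x. {x, v}) ` {x\<in>K. {x, v} \<in> E}))"
    using V by (intro card_UN_le) auto
  also have "\<dots> \<le> (\<Sum>v\<in>V - K. card {x\<in>K. {x, v} \<in> E})"
    using fK by (intro sum_mono card_image_le) auto
  finally show ?thesis by simp
qed

lemma contains_K_mono:
  assumes "contains_K q W F" "W \<subseteq> V" "F \<subseteq> E"
  shows "contains_K q V E"
proof -
  obtain S where S: "S \<in> nsets W q" "clique S F" using assms(1) by (auto simp: contains_K_def)
  have "clique S E" unfolding clique_def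
  proof (intro ballI impI)
    fix v w assume "v \<in> S" "w \<in> S" "v \<noteq> w"
    then have "{v, w} \<in> F" using S(2) by (simp add: clique_def)
    then show "{v, w} \<in> E" using assms(3) by (rule subsetD[rotated])
  qed
  moreover have "S \<in> nsets V q" using S(1) nsets_mono[OF assms(2)] by (rule subsetD[rotated])
  ultimately show ?thesis unfolding contains_K_def by (rule bexI)
qed

lemma contains_K_smaller: assumes "contains_K q V E" "q' \<le> q" shows "contains_K q' V E"
proof -
  obtain S where S: "S \<in> nsets V q" "clique S E" using assms(1) by (auto simp: contains_K_def)
  then obtain S' where "S' \<subseteq> S" "card S' = q'" "finite S'"
    using obtain_subset_with_card_n[of q' S] assms(2) by (auto simp: nsets_def)
  then have "S' \<in> nsets V q'" "clique S' E"
    using S smaller_clique[of S E S'] by (auto simp: nsets_def)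
  then show ?thesis by (auto simp: contains_K_def)
qed

lemma clique_insert: "clique (insert v S) E \<longleftrightarrow> clique S E \<and> (\<forall>x\<in>S. x \<noteq> v \<longrightarrow> {x, v} \<in> E)"
  by (auto simp: clique_def insert_commute)

lemma maximal_clique:
  assumes V: "finite V" and E: "E \<subseteq> nsets V 2" and ne: "V \<noteq> {}" and free: "\<not> contains_K (m + 1) V E"
  obtains K where "K \<subseteq> V" "clique K E" "1 \<le> card K" "card K \<le> m"
    "\<And>v. v \<in> V - K \<Longrightarrow> card {x\<in>K. {x, v} \<in> E} \<le> card K - 1"
proof -
  define P where "P q \<longleftrightarrow> contains_K q V E" for q
  obtain a where "a \<in> V" using ne by auto
  then have P1: "P 1" unfolding P_def contains_K_def
    by (intro bexI[of _ "{a}"]) (auto simp: nsets_def clique_def)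
  have bound: "q \<le> m" if "P q" for q
  proof (rule ccontr)
    assume "\<not> q \<le> m"
    then have "P (m + 1)" using contains_K_smaller[of q V E "m + 1"] that by (simp add: P_def)
    then show False using free by (simp add: P_def)
  qed
  define k where "k = (GREATEST q. P q)"
  have Pk: "P k" unfolding k_def by (rule GreatestI_nat[of P 1 m, OF P1 bound])
  have max: "q \<le> k" if "P q" for q unfolding k_def by (rule Greatest_le_nat[of P q m, OF that bound])
  obtain K where K: "K \<subseteq> V" "finite K" "card K = k" "clique K E"
    using Pk by (auto simp: P_def contains_K_def nsets_def)
  have "card {x\<in>K. {x, v} \<in> E} \<le> card K - 1" if v: "v \<in> V - K" for v
  proof (rule ccontr)
    assume "\<not> card {x\<in>K. {x, v} \<in> E} \<le> card K - 1"
    then have "card {x\<in>K. {x, v} \<in> E} \<ge> card K" by simp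
    then have all: "{x\<in>K. {x, v} \<in> E} = K" using K by (intro card_seteq) auto
    have adj: "{x, v} \<in> E" "{v, x} \<in> E" if "x \<in> K" for x
      using all that by (auto simp: insert_commute)
    have "clique (insert v K) E" using K(4) adj by (auto simp: clique_def)
    moreover have "insert v K \<in> nsets V (k + 1)" using K v by (auto simp: nsets_def)
    ultimately have "P (k + 1)" by (auto simp: P_def contains_K_def)
    then show False using max by fastforce
  qed
  with that[OF K(1,4)] K max[OF P1] bound[OF Pk] show ?thesis by simp
qed

text \<open>
  Remove a maximum clique: it has at most \<open>m\<close> vertices, and each other vertex misses at
  least one of them.
\<close>

theorem turan_bound:
  assumes "finite V" "E \<subseteq> nsets V 2" "\<not> contains_K (m + 1) V E"
  shows "card E \<le> turan_number m (card V)"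
  using assms
proof (induction "card V" arbitrary: V E rule: less_induct)
  case less
  show ?case
  proof (cases "V = {}")
    case True
    then have "E = {}" using less.prems by (auto simp: nsets_def)
    then show ?thesis by simp
  next
    case False
    obtain K where K: "K \<subseteq> V" "clique K E" "1 \<le> card K" "card K \<le> m"
      "\<And>v. v \<in> V - K \<Longrightarrow> card {x\<in>K. {x, v} \<in> E} \<le> card K - 1"
      using maximal_clique[OF less.prems(1,2) False less.prems(3)] by blast
    have fK: "finite K" using K less.prems finite_subset by auto
    have cV: "card V = card (V - K) + card K"
      using K fK less.prems(1) by (simp add: card_Diff_subset card_mono)
    have "\<not> contains_K (m + 1) (V - K) (E \<inter> nsets (V - K) 2)"
      using less.prems(3) contains_K_mono[of "m + 1" "V - K" "E \<inter> nsets (V - K) 2" V E] by blast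
    then have IH: "card (E \<inter> nsets (V - K) 2) \<le> turan_number m (card (V - K))"
      using less.prems(1) cV K(3) by (intro less.hyps) auto
    have "(\<Sum>v\<in>V - K. card {x\<in>K. {x, v} \<in> E}) \<le> card (V - K) * (card K - 1)"
      using sum_bounded_above[of "V - K" "\<lambda>v. card {x\<in>K. {x, v} \<in> E}" "card K - 1"] K(5) by simp
    with IH edges_through_set[OF less.prems(1,2) K(1)]
    have "card E \<le> turan_number m (card (V - K)) + (card K choose 2) + card (V - K) * (card K - 1)" by linarith
    also have "\<dots> \<le> turan_number m (card V)" unfolding cV by (rule turan_number_step(1)[OF K(3,4)])
    finally show ?thesis .
  qed
qed

definition multipartite :: "'a set \<Rightarrow> ('a \<Rightarrow> 'b) \<Rightarrow> 'a set set" where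
  "multipartite V \<phi> = {{u, v} | u v. u \<in> V \<and> v \<in> V \<and> \<phi> u \<noteq> \<phi> v}"

lemma multipartite_iff: "{u, v} \<in> multipartite V \<phi> \<longleftrightarrow> u \<in> V \<and> v \<in> V \<and> \<phi> u \<noteq> \<phi> v"
  by (auto simp: multipartite_def doubleton_eq_iff)

lemma multipartite_nsets: "multipartite V \<phi> \<subseteq> nsets V 2"
  by (auto simp: multipartite_def)

lemma clique_multipartite: "clique S (multipartite V \<phi>) \<Longrightarrow> inj_on \<phi> S"
  unfolding inj_on_def clique_def multipartite_iff by blast

lemma multipartite_free:
  assumes "\<phi> ` V \<subseteq> K" "finite K" "card K < q"
  shows "\<not> contains_K q V (multipartite V \<phi>)"
proof
  assume "contains_K q V (multipartite V \<phi>)"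
  then obtain S where S: "S \<subseteq> V" "card S = q" "clique S (multipartite V \<phi>)"
    by (auto simp: contains_K_def nsets_def)
  have "card S = card (\<phi> ` S)" using clique_multipartite[OF S(3)] by (simp add: card_image)
  also have "\<dots> \<le> card K" using assms S by (intro card_mono) auto
  finally show False using S assms by simp
qed

lemma card_multipartite_insert:
  assumes V: "finite V" and w: "w \<notin> V"
  shows "card (multipartite (insert w V) \<phi>) = card (multipartite V \<phi>) + card {u\<in>V. \<phi> u \<noteq> \<phi> w}"
proof -
  have eq: "multipartite (insert w V) \<phi> = multipartite V \<phi> \<union> (\<lambda>u. {u, w}) ` {u\<in>V. \<phi> u \<noteq> \<phi> w}"
  proof
    show "multipartite (insert w V) \<phi> \<subseteq> multipartite V \<phi> \<union> (\<lambda>u. {u, w}) ` {u\<in>V. \<phi> u \<noteq> \<phi> w}"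
    proof
      fix e assume "e \<in> multipartite (insert w V) \<phi>"
      then obtain u v where e: "e = {u, v}" "u \<in> insert w V" "v \<in> insert w V" "\<phi> u \<noteq> \<phi> v"
        unfolding multipartite_def by blast
      consider "u \<in> V" "v \<in> V" | "u = w" "v \<in> V" | "v = w" "u \<in> V" using e by auto
      then show "e \<in> multipartite V \<phi> \<union> (\<lambda>u. {u, w}) ` {u\<in>V. \<phi> u \<noteq> \<phi> w}"
      proof cases
        case 1 then show ?thesis using e by (simp add: multipartite_iff)
      next
        case 2
        then have "e = {v, w}" using e by auto
        then show ?thesis using 2 e by auto
      next
        case 3 then show ?thesis using e by auto
      qed
    qed
    show "multipartite V \<phi> \<union> (\<lambda>u. {u, w}) ` {u\<in>V. \<phi> u \<noteq> \<phi> w} \<subseteq> multipartite (insert w V) \<phi>"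
    proof
      fix e assume "e \<in> multipartite V \<phi> \<union> (\<lambda>u. {u, w}) ` {u\<in>V. \<phi> u \<noteq> \<phi> w}"
      then consider u v where "e = {u, v}" "u \<in> V" "v \<in> V" "\<phi> u \<noteq> \<phi> v"
        | u where "e = {u, w}" "u \<in> V" "\<phi> u \<noteq> \<phi> w"
        unfolding multipartite_def by blast
      then show "e \<in> multipartite (insert w V) \<phi>" by cases (simp_all add: multipartite_iff)
    qed
  qed
  have "finite (multipartite V \<phi>)" using multipartite_nsets V by (meson finite_subset finite_imp_finite_nsets)
  moreover have "multipartite V \<phi> \<inter> (\<lambda>u. {u, w}) ` {u\<in>V. \<phi> u \<noteq> \<phi> w} = {}"
    using w by (auto simp: multipartite_iff)
  moreover have "inj_on (\<lambda>u. {u, w}) {u\<in>V. \<phi> u \<noteq> \<phi> w}"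
    by (auto simp: inj_on_def doubleton_eq_iff)
  ultimately show ?thesis using V by (simp add: eq card_Un_disjoint card_image)
qed

lemma multipartite_bound:
  assumes "finite V" "\<phi> ` V \<subseteq> K" "finite K" "card K \<le> m"
  shows "card (multipartite V \<phi>) \<le> turan_number m (card V)"
  using assms by (intro turan_bound multipartite_nsets multipartite_free[where K = K]) auto

text \<open>
  Equality in the induction step forces the maximum clique to have \<open>m\<close> vertices and every
  vertex to miss exactly one of them. The vertices missing the same one are pairwise
  non-adjacent, since an edge among them would extend the rest of the clique to a \<open>K\<^bsub>m+1\<^esub>\<close>. So the graph is
  contained in a complete \<open>m\<close>-partite graph, and it equals it by counting.
\<close>

lemma extremal_multipartite:
  fixes V :: "'a set"
  assumes V: "finite V" and E: "E \<subseteq> nsets V 2" and free: "\<not> contains_K (m + 1) V E"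
    and ext: "card E = turan_number m (card V)" and big: "card V > m"
  shows "\<exists>(\<phi> :: 'a \<Rightarrow> 'a) K. finite K \<and> card K = m \<and> \<phi> ` V \<subseteq> K \<and> E = multipartite V \<phi>"
proof -
  have ne: "V \<noteq> {}" using big by auto
  obtain K where K: "K \<subseteq> V" "clique K E" "1 \<le> card K" "card K \<le> m"
      "\<And>v. v \<in> V - K \<Longrightarrow> card {x\<in>K. {x, v} \<in> E} \<le> card K - 1"
    using maximal_clique[OF V E ne free] by blast
  have fK: "finite K" using K V finite_subset by auto
  have cV: "card V = card (V - K) + card K"
    using K fK V by (simp add: card_Diff_subset card_mono)
  have N1: "card (V - K) \<ge> 1" using cV big K(4) by linarith
  have "\<not> contains_K (m + 1) (V - K) (E \<inter> nsets (V - K) 2)"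
    using free contains_K_mono[of "m + 1" "V - K" "E \<inter> nsets (V - K) 2" V E] by blast
  then have rest: "card (E \<inter> nsets (V - K) 2) \<le> turan_number m (card (V - K))"
    using V by (intro turan_bound) auto
  define D where "D v = card {x\<in>K. {x, v} \<in> E}" for v
  have D: "D v \<le> card K - 1" if "v \<in> V - K" for v using K(5)[OF that] by (simp add: D_def)
  have sumD: "sum D (V - K) \<le> (\<Sum>v\<in>V - K. card K - 1)" by (rule sum_mono) (rule D)
  have chain: "turan_number m (card V) \<le> turan_number m (card (V - K)) + (card K choose 2) + sum D (V - K)"
    using edges_through_set[OF V E K(1)] rest ext unfolding D_def by linarith
  have Km: "card K = m"
  proof (rule ccontr)
    assume "card K \<noteq> m"
    then have "card K < m" using K by simp
    from turan_number_step(2)[OF K(3,4) this N1] chain sumD cV show False by simp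
  qed
  have Deq: "D v = card K - 1" if v: "v \<in> V - K" for v
  proof (rule ccontr)
    assume "D v \<noteq> card K - 1"
    then have "D v < card K - 1" using D[OF v] by simp
    then have "sum D (V - K) < (\<Sum>v\<in>V - K. card K - 1)"
      using V D v by (intro sum_strict_mono_ex1) auto
    with turan_number_step(1)[OF K(3,4), of "card (V - K)"] chain cV show False by simp
  qed
  define miss where "miss v = {x\<in>K. {x, v} \<notin> E}" for v
  have irr: "{x} \<notin> E" for x using E by (auto simp: nsets_def)
  have "card (miss v) = 1" if v: "v \<in> V" for v
  proof (cases "v \<in> K")
    case True
    then have "miss v = {v}" using K(2) irr by (auto simp: miss_def clique_def)
    then show ?thesis by simp
  next
    case False
    have "miss v = K - {x\<in>K. {x, v} \<in> E}" by (auto simp: miss_def)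
    then have "card (miss v) = card K - D v" using fK by (simp add: D_def card_Diff_subset)
    then show ?thesis using Deq[of v] v False K(3) by simp
  qed
  then have "\<forall>v\<in>V. \<exists>x. miss v = {x}" by (simp add: card_1_singleton_iff)
  then obtain \<phi> where \<phi>: "\<And>v. v \<in> V \<Longrightarrow> miss v = {\<phi> v}" by metis
  have \<phi>K: "\<phi> ` V \<subseteq> K" using \<phi> by (auto simp: miss_def)
  have sub: "E \<subseteq> multipartite V \<phi>"
  proof
    fix e assume e: "e \<in> E"
    then obtain u v where uv: "e = {u, v}" "u \<in> V" "v \<in> V" "u \<noteq> v"
      using nsets2_E[OF subsetD[OF E e]] by metis
    have "\<phi> u \<noteq> \<phi> v"
    proof
      assume same: "\<phi> u = \<phi> v"
      define S where "S = insert u (insert v (K - {\<phi> u}))"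
      have mm: "miss u = {\<phi> u}" "miss v = {\<phi> u}" using \<phi> uv same by auto
      have notin: "w \<notin> K - {\<phi> u}" if "miss w = {\<phi> u}" for w
        using that irr by (auto simp: miss_def)
      have "card S = m + 1"
        using notin[OF mm(1)] notin[OF mm(2)] uv fK \<phi>K Km K(3) by (simp add: S_def image_subset_iff)
      moreover have "S \<subseteq> V" using uv K by (auto simp: S_def)
      moreover have "clique S E"
      proof -
        have adj: "{x, u} \<in> E" "{x, v} \<in> E" if "x \<in> K - {\<phi> u}" for x
        proof -
          have "x \<notin> miss u" "x \<notin> miss v" unfolding mm using that by auto
          then show "{x, u} \<in> E" "{x, v} \<in> E" using that by (simp_all add: miss_def)
        qed
        have "{u, v} \<in> E" "{v, u} \<in> E" using e uv by (auto simp: insert_commute)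
        moreover have "clique (K - {\<phi> u}) E" using K(2) smaller_clique by blast
        ultimately show ?thesis using adj by (simp add: S_def clique_insert)
      qed
      moreover have "finite S" using fK by (simp add: S_def)
      ultimately have "contains_K (m + 1) V E"
        unfolding contains_K_def by (intro bexI[of _ S]) (auto simp: nsets_def)
      then show False using free by simp
    qed
    then show "e \<in> multipartite V \<phi>" using uv by (simp add: multipartite_iff)
  qed
  have "card (multipartite V \<phi>) \<le> card E"
    unfolding ext by (rule multipartite_bound[OF V \<phi>K fK K(4)])
  moreover have "finite (multipartite V \<phi>)" using multipartite_nsets V by (meson finite_subset finite_imp_finite_nsets)
  ultimately have "E = multipartite V \<phi>" using sub by (intro card_seteq) auto
  with fK Km \<phi>K show ?thesis by (intro exI[of _ \<phi>] exI[of _ K]) simp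
qed

text \<open>
  Adding a vertex to a part, or deleting one from it, again gives a complete \<open>m\<close>-partite graph.
  Comparing its number of edges with the Turan number bounds the part from below
  and from above. The new vertex is where an infinite vertex type is used.
\<close>

lemma extremal_part_sizes:
  fixes \<phi> :: "'a \<Rightarrow> 'b"
  assumes V: "finite V" and inf: "infinite (UNIV :: 'a set)"
    and K: "finite K" "card K = m" "m \<ge> 1" "\<phi> ` V \<subseteq> K"
    and ext: "card (multipartite V \<phi>) = turan_number m (card V)" and x: "x \<in> K"
  shows "card V div m \<le> card {v\<in>V. \<phi> v = x}" "card {v\<in>V. \<phi> v = x} \<le> card V div m + 1"
proof -
  let ?n = "card V" and ?c = "card {v\<in>V. \<phi> v = x}"
  have cn: "?c \<le> ?n" using V by (intro card_mono) auto
  have co: "card {u\<in>V. \<phi> u \<noteq> x} = ?n - ?c"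
  proof -
    have "{u\<in>V. \<phi> u \<noteq> x} = V - {v\<in>V. \<phi> v = x}" by auto
    then show ?thesis using V by (simp add: card_Diff_subset)
  qed
  (* Lower bound: put a new vertex w into the part x. *)
  obtain w where w: "w \<notin> V" using inf V ex_new_if_finite by blast
  define \<psi> where "\<psi> = \<phi>(w := x)"
  have "multipartite V \<psi> = multipartite V \<phi>"
  proof -
    have "\<psi> v = \<phi> v" if "v \<in> V" for v using that w by (auto simp: \<psi>_def)
    then show ?thesis unfolding multipartite_def by (metis (no_types, lifting))
  qed
  moreover have "{u\<in>V. \<psi> u \<noteq> \<psi> w} = {u\<in>V. \<phi> u \<noteq> x}" using w by (auto simp: \<psi>_def)
  ultimately have "turan_number m ?n + (?n - ?c) = card (multipartite (insert w V) \<psi>)"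
    using card_multipartite_insert[OF V w, of \<psi>] ext co by simp
  also have "\<dots> \<le> turan_number m (card (insert w V))"
    using V K x by (intro multipartite_bound[where K = K]) (auto simp: \<psi>_def)
  also have "\<dots> = turan_number m ?n + (?n - ?n div m)" using V w by (simp add: turan_number_Suc)
  finally have "?n - ?c \<le> ?n - ?n div m" by simp
  moreover have "?n div m \<le> ?n" by simp
  ultimately show "?n div m \<le> ?c" using cn by linarith
  show "?c \<le> ?n div m + 1"
  proof (cases "?c = 0")
    case False
    then have "{v\<in>V. \<phi> v = x} \<noteq> {}" by (metis card.empty)
    then obtain v0 where v0: "v0 \<in> V" "\<phi> v0 = x" by auto
    (* Upper bound: delete a vertex v0 of the part x. *)
    define V' where "V' = V - {v0}"
    have V': "V = insert v0 V'" "v0 \<notin> V'" "finite V'" using v0 V by (auto simp: V'_def)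
    have n': "?n = Suc (card V')" using V' by simp
    have same: "{u\<in>V'. \<phi> u \<noteq> \<phi> v0} = {u\<in>V. \<phi> u \<noteq> x}" using v0 by (auto simp: V'_def)
    have "card (multipartite V \<phi>) = card (multipartite V' \<phi>) + (?n - ?c)"
      using card_multipartite_insert[OF V'(3,2), of \<phi>] unfolding same co V'(1)[symmetric] .
    moreover have "card (multipartite V' \<phi>) \<le> turan_number m (card V')"
      using V' K by (intro multipartite_bound[where K = K]) auto
    moreover have "turan_number m ?n = turan_number m (card V') + (card V' - card V' div m)"
      unfolding n' by (rule turan_number_Suc)
    ultimately have "card V' - card V' div m \<le> ?n - ?c" using ext by linarith
    moreover have "card V' div m \<le> card V'" by simp
    moreover have "card V' div m \<le> ?n div m" unfolding n' by (rule div_le_mono) simp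
    ultimately show ?thesis using n' cn by linarith
  qed simp
qed

lemma turan_edges_multipartite: "turan_edges m n = multipartite {..<n} (\<lambda>u. u mod m)"
  by (auto simp: turan_edges_def multipartite_def)

lemma card_same_residue_below:
  assumes "m \<ge> 1" shows "card {u. u < n \<and> u mod m = n mod m} = n div m"
proof -
  have "{u. u < n \<and> u mod m = n mod m} = (\<lambda>j. n mod m + j * m) ` {..<n div m}"
  proof
    show "(\<lambda>j. n mod m + j * m) ` {..<n div m} \<subseteq> {u. u < n \<and> u mod m = n mod m}"
    proof (rule image_subsetI)
      fix j assume "j \<in> {..<n div m}"
      then have "Suc j \<le> n div m" by simp
      then have "Suc j * m \<le> n div m * m" by (rule mult_le_mono1)
      moreover have "Suc j * m = m + j * m" by simp
      moreover have "n mod m < m" using assms by simp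
      ultimately have "n mod m + j * m < n" using div_mult_mod_eq[of n m] by linarith
      then show "n mod m + j * m \<in> {u. u < n \<and> u mod m = n mod m}" by simp
    qed
    show "{u. u < n \<and> u mod m = n mod m} \<subseteq> (\<lambda>j. n mod m + j * m) ` {..<n div m}"
    proof (rule subsetI)
      fix u assume "u \<in> {u. u < n \<and> u mod m = n mod m}"
      then have u: "u < n" "u mod m = n mod m" by auto
      have e: "u = n mod m + u div m * m" using u(2) div_mult_mod_eq[of u m] by linarith
      have "u div m * m < n div m * m" using u e div_mult_mod_eq[of n m] by linarith
      then have "u div m < n div m" by simp
      with e show "u \<in> (\<lambda>j. n mod m + j * m) ` {..<n div m}" by blast
    qed
  qed
  moreover have "inj_on (\<lambda>j. n mod m + j * m) {..<n div m}" using assms by (auto simp: inj_on_def)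
  ultimately show ?thesis by (simp add: card_image)
qed

lemma card_turan_edges: assumes "m \<ge> 1" shows "card (turan_edges m n) = turan_number m n"
proof (induction n)
  case 0
  show ?case by (simp add: turan_edges_def turan_number_def)
next
  case (Suc n)
  have "{u\<in>{..<n}. u mod m \<noteq> n mod m} = {..<n} - {u. u < n \<and> u mod m = n mod m}" by auto
  then have "card {u\<in>{..<n}. u mod m \<noteq> n mod m} = n - n div m"
    using card_same_residue_below[OF assms, of n] by (subst (asm) eq_commute) (simp add: card_Diff_subset subset_eq)
  moreover have "card (multipartite (insert n {..<n}) (\<lambda>u. u mod m))
     = card (multipartite {..<n} (\<lambda>u. u mod m)) + card {u\<in>{..<n}. u mod m \<noteq> n mod m}"
    by (rule card_multipartite_insert) auto
  ultimately show ?case using Suc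
    by (simp add: turan_edges_multipartite lessThan_Suc turan_number_Suc)
qed

lemma mod_image: "m \<ge> 1 \<Longrightarrow> (\<lambda>u. u mod m) ` V \<subseteq> {..<m}" for V :: "nat set"
  by auto

theorem ex_K_turan: assumes "p \<ge> 2" shows "ex_K n p = turan_number (p - 1) n"
proof -
  define m where "m = p - 1"
  define S where "S = {card E | E. simple_graph {..<n} E \<and> \<not> contains_K p {..<n} E}"
  have pm: "p = m + 1" "m \<ge> 1" using assms by (auto simp: m_def)
  have le: "k \<le> turan_number m n" if kS: "k \<in> S" for k
  proof -
    obtain E where "k = card E" "simple_graph {..<n} E" "\<not> contains_K p {..<n} E"
      using kS unfolding S_def by blast
    then show ?thesis using turan_bound[of "{..<n}" E m] pm by (simp add: simple_graph_def)
  qed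
  then have fin: "finite S" by (meson finite_nat_set_iff_bounded_le)
  have "simple_graph {..<n} (turan_edges m n)"
    using multipartite_nsets[of "{..<n}"] by (simp add: turan_edges_multipartite simple_graph_def)
  moreover have "\<not> contains_K p {..<n} (turan_edges m n)"
    unfolding turan_edges_multipartite pm(1) by (rule multipartite_free[OF mod_image[OF pm(2)]]) auto
  ultimately have "card (turan_edges m n) \<in> S" unfolding S_def by blast
  then have "turan_number m n \<in> S" by (simp add: card_turan_edges[OF pm(2)])
  then have "Max S = turan_number m n" by (intro Max_eqI fin le)
  then show ?thesis by (simp add: ex_K_def S_def m_def)
qed

lemma count_larger_parts:
  fixes s :: "'b \<Rightarrow> nat"
  assumes K: "finite K" "card K = m" and s: "\<And>x. x \<in> K \<Longrightarrow> q \<le> s x \<and> s x \<le> q + 1"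
  shows "card {x\<in>K. s x = q + 1} = sum s K - m * q"
proof -
  have "sum s K = (\<Sum>x\<in>K. q + of_bool (s x = q + 1))"
    using s by (intro sum.cong refl) (fastforce simp: of_bool_def)
  also have "\<dots> = m * q + card {x\<in>K. s x = q + 1}"
    using K by (simp add: sum.distrib of_bool_def sum.If_cases Int_def)
  finally show ?thesis by simp
qed

text \<open>
  Bijections between corresponding parts combine to a permutation of the vertices.
\<close>

lemma matching_parts:
  fixes \<phi> :: "'a \<Rightarrow> 'b" and \<psi> :: "'a \<Rightarrow> 'c"
  assumes V: "finite V" and \<phi>: "\<phi> ` V \<subseteq> K" and \<psi>: "\<psi> ` V \<subseteq> I" and g: "bij_betw g K I"
    and sizes: "\<And>x. x \<in> K \<Longrightarrow> card {v\<in>V. \<phi> v = x} = card {v\<in>V. \<psi> v = g x}"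
  shows "\<exists>h. bij_betw h V V \<and> (\<forall>u\<in>V. \<psi> (h u) = g (\<phi> u))"
proof -
  have "\<exists>h. bij_betw h {v\<in>V. \<phi> v = x} {v\<in>V. \<psi> v = g x}" if "x \<in> K" for x
    using V sizes[OF that] by (intro finite_same_card_bij) auto
  then obtain H where H: "\<And>x. x \<in> K \<Longrightarrow> bij_betw (H x) {v\<in>V. \<phi> v = x} {v\<in>V. \<psi> v = g x}" by metis
  define h where "h u = H (\<phi> u) u" for u
  have hV: "h u \<in> V \<and> \<psi> (h u) = g (\<phi> u)" if "u \<in> V" for u
    using bij_betwE[OF H[of "\<phi> u"]] that \<phi> by (auto simp: h_def)
  have "inj_on h V"
  proof (rule inj_onI)
    fix u v assume uv: "u \<in> V" "v \<in> V" "h u = h v"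
    then have "g (\<phi> u) = g (\<phi> v)" using hV by metis
    then have s: "\<phi> u = \<phi> v" using g \<phi> uv by (auto simp: bij_betw_def inj_on_def)
    have "inj_on (H (\<phi> u)) {w\<in>V. \<phi> w = \<phi> u}" using H[of "\<phi> u"] \<phi> uv by (auto simp: bij_betw_def)
    then show "u = v" using uv s by (auto simp: h_def inj_on_def)
  qed
  moreover have "h ` V \<subseteq> V" using hV by auto
  ultimately have "bij_betw h V V" using V by (simp add: bij_betw_def endo_inj_surj)
  then show ?thesis using hV by blast
qed

text \<open>
  By \<open>extremal_part_sizes\<close> all parts have \<open>q\<close> or \<open>q + 1\<close> vertices, where \<open>q = n div m\<close>, both in the given
  graph and in the Turan graph. The number of larger parts is then determined by \<open>n\<close>, so the parts can be matched.
\<close>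

theorem turan_unique:
  assumes "simple_graph {..<n} E" "\<not> contains_K (m + 1) {..<n} E" "card E = turan_number m n" "n > m" "m \<ge> 1"
  shows "graph_iso {..<n} E {..<n} (turan_edges m n)"
proof -
  have E: "E \<subseteq> nsets {..<n} 2" using assms by (simp add: simple_graph_def)
  obtain \<phi> :: "nat \<Rightarrow> nat" and K where K: "finite K" "card K = m" "\<phi> ` {..<n} \<subseteq> K" and EM: "E = multipartite {..<n} \<phi>"
    using extremal_multipartite[of "{..<n}" E m] E assms by auto
  let ?s = "\<lambda>x. card {v\<in>{..<n}. \<phi> v = x}" and ?t = "\<lambda>i. card {v\<in>{..<n}. v mod m = i}"
  let ?q = "n div m"
  have s: "?q \<le> ?s x \<and> ?s x \<le> ?q + 1" if "x \<in> K" for x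
    using extremal_part_sizes[of "{..<n}" K m \<phi> x] K assms that EM by simp
  have t: "?q \<le> ?t i \<and> ?t i \<le> ?q + 1" if "i \<in> {..<m}" for i
    using extremal_part_sizes[of "{..<n}" "{..<m}" m "\<lambda>u. u mod m" i] mod_image[OF assms(5), of "{..<n}"]
      assms that card_turan_edges[OF assms(5), of n] by (simp add: turan_edges_multipartite)
  have ss: "sum ?s K = n"
    using sum.group[of "{..<n}" K \<phi> "\<lambda>_. 1::nat"] K by simp
  have tt: "sum ?t {..<m} = n"
    using sum.group[of "{..<n}" "{..<m}" "\<lambda>u. u mod m" "\<lambda>_. 1::nat"] mod_image[OF assms(5)] by simp
  define KB where "KB = {x\<in>K. ?s x = ?q + 1}"
  define IB where "IB = {i\<in>{..<m}. ?t i = ?q + 1}"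
  have B: "card KB = card IB"
    using count_larger_parts[of K m ?q ?s] count_larger_parts[of "{..<m}" m ?q ?t] K s t ss tt
    by (simp add: KB_def IB_def)
  have fin: "finite KB" "finite IB" "KB \<subseteq> K" "IB \<subseteq> {..<m}" using K by (auto simp: KB_def IB_def)
  then have "card (K - KB) = card ({..<m} - IB)" using B K by (simp add: card_Diff_subset)
  then obtain g2 where g2: "bij_betw g2 (K - KB) ({..<m} - IB)"
    using K finite_same_card_bij[of "K - KB" "{..<m} - IB"] by auto
  obtain g1 where g1: "bij_betw g1 KB IB" using fin B finite_same_card_bij by blast
  define g where "g x = (if x \<in> KB then g1 x else g2 x)" for x
  have gB: "bij_betw g KB IB" using g1 by (rule bij_betw_cong[THEN iffD1, rotated]) (simp add: g_def)
  have gS: "bij_betw g (K - KB) ({..<m} - IB)" using g2 by (rule bij_betw_cong[THEN iffD1, rotated]) (simp add: g_def)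
  have "bij_betw g (KB \<union> (K - KB)) (IB \<union> ({..<m} - IB))" using gB gS by (rule bij_betw_combine) auto
  then have g: "bij_betw g K {..<m}" using fin by (simp add: Un_absorb1)
  have sizes: "?s x = ?t (g x)" if x: "x \<in> K" for x
  proof (cases "x \<in> KB")
    case True
    then have "g x \<in> IB" using gB by (auto simp: bij_betw_def)
    then show ?thesis using True by (simp add: KB_def IB_def)
  next
    case False
    then have "g x \<in> {..<m} - IB" using gS x by (auto simp: bij_betw_def)
    then have "?t (g x) = ?q" using t[of "g x"] by (auto simp: IB_def)
    moreover have "?s x = ?q" using False x s[OF x] by (auto simp: KB_def)
    ultimately show ?thesis by simp
  qed
  obtain h where h: "bij_betw h {..<n} {..<n}" "\<And>u. u \<in> {..<n} \<Longrightarrow> h u mod m = g (\<phi> u)"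
    using matching_parts[of "{..<n}" \<phi> K "\<lambda>u. u mod m" "{..<m}" g] K(3) mod_image[OF assms(5)] g sizes by auto
  have ginj: "g (\<phi> u) = g (\<phi> v) \<longleftrightarrow> \<phi> u = \<phi> v" if "u \<in> {..<n}" "v \<in> {..<n}" for u v
    using g K(3) that by (auto simp: bij_betw_def inj_on_def image_subset_iff)
  have "(\<lambda>e. h ` e) ` E = turan_edges m n"
  proof
    show "(\<lambda>e. h ` e) ` E \<subseteq> turan_edges m n"
    proof clarify
      fix e assume "e \<in> E"
      then obtain u v where uv: "e = {u, v}" "u \<in> {..<n}" "v \<in> {..<n}" "\<phi> u \<noteq> \<phi> v"
        unfolding EM multipartite_def by blast
      then show "h ` e \<in> turan_edges m n"
        using h ginj[of u v] bij_betwE[OF h(1)] by (simp add: turan_edges_multipartite multipartite_iff)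
    qed
    show "turan_edges m n \<subseteq> (\<lambda>e. h ` e) ` E"
    proof
      fix e assume "e \<in> turan_edges m n"
      then obtain a b where ab: "e = {a, b}" "a \<in> {..<n}" "b \<in> {..<n}" "a mod m \<noteq> b mod m"
        unfolding turan_edges_multipartite multipartite_def by blast
      obtain u v where uv: "u \<in> {..<n}" "v \<in> {..<n}" "a = h u" "b = h v"
        using h(1) ab by (metis bij_betw_imp_surj_on imageE)
      then have "{u, v} \<in> E" using ab h(2) by (auto simp: EM multipartite_iff)
      moreover have "e = h ` {u, v}" using ab uv by simp
      ultimately show "e \<in> (\<lambda>e. h ` e) ` E" by blast
    qed
  qed
  with h(1) show ?thesis by (auto simp: graph_iso_def)
qed

lemma turan_not_iso:
  assumes "contains_K (m + 1) {..<n} E" "E \<subseteq> nsets {..<n} 2" "m \<ge> 1"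
  shows "\<not> graph_iso {..<n} E {..<n} (turan_edges m n)"
proof
  assume "graph_iso {..<n} E {..<n} (turan_edges m n)"
  then obtain h where h: "bij_betw h {..<n} {..<n}" "(\<lambda>e. h ` e) ` E = turan_edges m n"
    by (auto simp: graph_iso_def)
  obtain S where S: "S \<subseteq> {..<n}" "finite S" "card S = m + 1" "clique S E"
    using assms(1) by (auto simp: contains_K_def nsets_def)
  have inj: "inj_on h S" using h(1) S(1) by (auto simp: bij_betw_def intro: inj_on_subset)
  have "clique (h ` S) (turan_edges m n)"
    unfolding clique_def
  proof clarify
    fix u v assume "u \<in> S" "v \<in> S" "h u \<noteq> h v"
    then have "{u, v} \<in> E" using S(4) by (auto simp: clique_def)
    then have "h ` {u, v} \<in> turan_edges m n" using h(2) by blast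
    then show "{h u, h v} \<in> turan_edges m n" by simp
  qed
  moreover have "h ` S \<in> nsets {..<n} (m + 1)"
    using S h(1) inj by (auto simp: nsets_def card_image bij_betw_def)
  ultimately have "contains_K (m + 1) {..<n} (multipartite {..<n} (\<lambda>u. u mod m))"
    by (auto simp: contains_K_def turan_edges_multipartite)
  moreover have "\<not> contains_K (m + 1) {..<n} (multipartite {..<n} (\<lambda>u. u mod m))"
    by (rule multipartite_free[OF mod_image[OF assms(3)]]) auto
  ultimately show False by simp
qed

section \<open>The extremal graphs\<close>

lemma turan_number_formula:
  assumes m: "m \<ge> 1"
  shows "2 * real m * real (turan_number m n) = (real m - 1) * (real n)^2 - real (n mod m) * (real m - real (n mod m))"
proof (induction n)
  case 0
  show ?case by (simp add: turan_number_def)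
next
  case (Suc n)
  let ?q = "n div m" and ?s = "n mod m"
  have n: "real n = real m * real ?q + real ?s"
    by (metis mult_div_mod_eq of_nat_add of_nat_mult)
  have step: "real (turan_number m (Suc n)) = real (turan_number m n) + (real n - real ?q)"
  proof -
    have "n div m \<le> n" by simp
    then show ?thesis using turan_number_Suc[of m n] by (simp only: of_nat_add of_nat_diff)
  qed
  have IH: "2 * real m * real (turan_number m (Suc n)) = (real m - 1) * (real n)^2 - real ?s * (real m - real ?s) + 2 * real m * (real n - real ?q)"
    using Suc unfolding step by (simp add: algebra_simps)
  show ?case
  proof (cases "Suc ?s = m")
    case True
    then have s': "Suc n mod m = 0" by (simp add: mod_Suc)
    have "real ?s = real m - 1" using True by (metis of_nat_Suc add_diff_cancel_left')
    then show ?thesis unfolding IH s' by (simp only: n of_nat_Suc) (simp add: power2_eq_square algebra_simps)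
  next
    case False
    then have "real (Suc n mod m) = real ?s + 1" by (simp add: mod_Suc)
    then show ?thesis unfolding IH using n by (simp add: power2_eq_square algebra_simps)
  qed
qed

lemma turan_defect:
  fixes s m :: real
  shows "s * (m - s) \<le> m^2 / 4"
  using zero_le_power2[of "m / 2 - s"] by (simp add: power2_eq_square algebra_simps)

text \<open>
  The Turan graph on \<open>{..<N}\<close> whose first \<open>S\<close> vertices are joined to the \<open>c\<close> vertices
  \<open>N, \<dots>, N + c - 1\<close>. Since the parts are residue classes, the first \<open>S\<close> vertices are spread
  evenly over them.
\<close>

definition joined_edges :: "nat \<Rightarrow> nat \<Rightarrow> nat \<Rightarrow> nat \<Rightarrow> nat set set" where
  "joined_edges m N c S = multipartite {..<N} (\<lambda>u. u mod m) \<union> (\<lambda>(a, v). {a, v}) ` ({..<S} \<times> {N..<N + c})"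

lemma joined_iff:
  assumes "S \<le> N"
  shows "{u, v} \<in> joined_edges m N c S \<longleftrightarrow> (u < N \<and> v < N \<and> u mod m \<noteq> v mod m)
    \<or> (u < S \<and> N \<le> v \<and> v < N + c) \<or> (v < S \<and> N \<le> u \<and> u < N + c)"
  unfolding joined_edges_def Un_iff multipartite_iff by (auto simp: doubleton_eq_iff)

lemma joined_simple: assumes "S \<le> N" shows "simple_graph {..<N + c} (joined_edges m N c S)"
  using assms unfolding simple_graph_def joined_edges_def multipartite_def by auto

lemma card_joined:
  assumes "S \<le> N" "m \<ge> 1"
  shows "card (joined_edges m N c S) = turan_number m N + S * c"
proof -
  let ?J = "(\<lambda>(a, v). {a, v}) ` ({..<S} \<times> {N..<N + c})"
  have "inj_on (\<lambda>(a, v). {a, v}) ({..<S} \<times> {N..<N + c})"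
    using assms by (auto simp: inj_on_def doubleton_eq_iff)
  then have cJ: "card ?J = S * c" by (simp add: card_image card_cartesian_product)
  have "multipartite {..<N} (\<lambda>u. u mod m) \<inter> ?J = {}" by (auto simp: multipartite_iff)
  moreover have "finite (multipartite {..<N} (\<lambda>u. u mod m))"
    using multipartite_nsets[of "{..<N}"] by (meson finite_subset finite_imp_finite_nsets finite_lessThan)
  ultimately show ?thesis
    unfolding joined_edges_def using card_turan_edges[OF assms(2), of N] cJ
    by (simp add: card_Un_disjoint turan_edges_multipartite)
qed

lemma joined_clique:
  assumes SN: "S \<le> N" and m: "m \<ge> 1" and Q: "finite Q" "clique Q (joined_edges m N c S)"
  shows "card (Q \<inter> {..<N}) \<le> m" "card (Q - {..<N}) \<le> 1"
proof -
  have inj: "inj_on (\<lambda>u. u mod m) (Q \<inter> {..<N})"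
  proof (rule inj_onI, rule ccontr)
    fix x y assume "x \<in> Q \<inter> {..<N}" "y \<in> Q \<inter> {..<N}" "x mod m = y mod m" "x \<noteq> y"
    moreover from this have "{x, y} \<in> joined_edges m N c S" using Q(2) by (auto simp: clique_def)
    ultimately show False unfolding joined_iff[OF SN] by auto
  qed
  have "card (Q \<inter> {..<N}) = card ((\<lambda>u. u mod m) ` (Q \<inter> {..<N}))" using inj by (simp add: card_image)
  also have "\<dots> \<le> card {..<m}" using m by (intro card_mono) auto
  finally show "card (Q \<inter> {..<N}) \<le> m" by simp
  have "u = v" if "u \<in> Q - {..<N}" "v \<in> Q - {..<N}" for u v
  proof (rule ccontr)
    assume "u \<noteq> v"
    then have "{u, v} \<in> joined_edges m N c S" using that Q(2) by (auto simp: clique_def)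
    then show False using that SN unfolding joined_iff[OF SN] by auto
  qed
  then show "card (Q - {..<N}) \<le> 1" using Q(1) by (simp add: card_le_Suc0_iff_eq)
qed

lemma joined_free:
  assumes SN: "S \<le> N" and m: "m \<ge> 1"
  shows "\<not> contains_K (m + 2) {..<N + c} (joined_edges m N c S)"
proof
  assume "contains_K (m + 2) {..<N + c} (joined_edges m N c S)"
  then obtain Q where Q: "finite Q" "card Q = m + 2" "clique Q (joined_edges m N c S)"
    by (auto simp: contains_K_def nsets_def)
  have "card Q = card (Q \<inter> {..<N}) + card (Q - {..<N})"
    using Q(1) by (metis Int_commute card_Int_Diff)
  with joined_clique[OF SN m Q(1,3)] Q(2) show False by simp
qed

lemma joined_contains:
  assumes SN: "S \<le> N" and m: "m \<ge> 1" "m \<le> S" "c \<ge> 1"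
  shows "contains_K (m + 1) {..<N + c} (joined_edges m N c S)"
proof -
  have "clique (insert N {..<m}) (joined_edges m N c S)"
    unfolding clique_insert using m SN by (auto simp: clique_def joined_iff[OF SN])
  moreover have "insert N {..<m} \<in> nsets {..<N + c} (m + 1)"
    using m SN by (auto simp: nsets_def)
  ultimately show ?thesis unfolding contains_K_def by blast
qed

text \<open>
  Adding a saturating edge \<open>uv\<close> with \<open>u < v\<close> completes a clique; let \<open>R\<close> be the set of its \<open>m\<close> other vertices.
  If \<open>u < N\<close>, then \<open>u\<close> together with \<open>R\<close> has \<open>m + 1\<close> vertices and does not fit into the \<open>m\<close> parts, so \<open>R\<close> contains
  one of the \<open>c\<close> new vertices. Both \<open>u\<close> and \<open>v\<close> are adjacent to it and hence among the first \<open>S\<close> vertices.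
\<close>

lemma joined_saturating:
  assumes SN: "S \<le> N" and m: "m \<ge> 1"
  shows "saturating_edges (m + 2) {..<N + c} (joined_edges m N c S)
    \<subseteq> nsets {N..<N + c} 2 \<union> (nsets {..<S} 2 - multipartite {..<S} (\<lambda>u. u mod m))"
proof
  let ?E = "joined_edges m N c S"
  fix e assume e: "e \<in> saturating_edges (m + 2) {..<N + c} ?E"
  then have e2: "e \<in> nsets {..<N + c} 2" "e \<notin> ?E" "contains_K (m + 2) {..<N + c} (insert e ?E)"
    by (auto simp: saturating_edges_def)
  obtain u v where uv: "e = {u, v}" "u < v" "v < N + c"
  proof -
    obtain a b where "e = {a, b}" "a \<in> {..<N + c}" "b \<in> {..<N + c}" "a \<noteq> b"
      using nsets2_E[OF e2(1)] by metis
    then show ?thesis using that[of a b] that[of b a] by (cases "a < b") (auto simp: insert_commute)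
  qed
  obtain Q where Q: "Q \<subseteq> {..<N + c}" "finite Q" "card Q = m + 2" "clique Q (insert e ?E)"
    using e2(3) by (auto simp: contains_K_def nsets_def)
  have inQ: "u \<in> Q \<and> v \<in> Q"
  proof (rule ccontr)
    assume "\<not> (u \<in> Q \<and> v \<in> Q)"
    then have "clique Q ?E" using Q(4) uv by (auto simp: clique_def doubleton_eq_iff)
    then have "contains_K (m + 2) {..<N + c} ?E" using Q by (auto simp: contains_K_def nsets_def)
    then show False using joined_free[OF SN m] by simp
  qed
  define R where "R = Q - {u, v}"
  have R: "finite R" "card R = m" "R \<subseteq> {..<N + c}" using Q inQ uv by (auto simp: R_def)
  have adjR: "{x, w} \<in> ?E" if "x \<in> R" "w \<in> Q" "x \<noteq> w" for x w
  proof -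
    have "{x, w} \<in> insert e ?E" using that Q(4) by (auto simp: clique_def R_def)
    moreover have "{x, w} \<noteq> e" using that uv by (auto simp: R_def doubleton_eq_iff)
    ultimately show ?thesis by simp
  qed
  have RQ: "R \<subseteq> Q" by (auto simp: R_def)
  have cl: "clique R ?E" using adjR RQ by (auto simp: clique_def)
  have clu: "clique (insert u R) ?E" using cl adjR inQ by (simp add: clique_insert)
  have uR: "u \<notin> R" by (simp add: R_def)
  have notall: False if "insert u R \<subseteq> {..<N}"
  proof -
    have "insert u R \<inter> {..<N} = insert u R" using that by auto
    moreover have "card (insert u R) = m + 1" using R uR by simp
    ultimately show False using joined_clique(1)[OF SN m _ clu] R(1) by simp
  qed
  have nonadj: "\<not> ((u < N \<and> v < N \<and> u mod m \<noteq> v mod m)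
    \<or> (u < S \<and> N \<le> v \<and> v < N + c) \<or> (v < S \<and> N \<le> u \<and> u < N + c))"
    using e2(2) unfolding uv(1) joined_iff[OF SN] .
  show "e \<in> nsets {N..<N + c} 2 \<union> (nsets {..<S} 2 - multipartite {..<S} (\<lambda>u. u mod m))"
  proof (cases "N \<le> u")
    case True
    then show ?thesis using uv by simp
  next
    case uN: False
    have "\<exists>w\<in>R. N \<le> w"
    proof (rule ccontr)
      assume "\<not> (\<exists>w\<in>R. N \<le> w)"
      then have "insert u R \<subseteq> {..<N}" using uN by (auto simp: not_le)
      then show False by (rule notall)
    qed
    then obtain w where w: "w \<in> R" "N \<le> w" by blast
    have "{w, u} \<in> ?E" "{w, v} \<in> ?E" using adjR[OF w(1)] inQ w(1) by (auto simp: R_def)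
    then have "u < S" "v < S" using w(2) SN unfolding joined_iff[OF SN] by auto
    then show ?thesis using nonadj uv SN by (auto simp: multipartite_iff)
  qed
qed

lemma joined_sat_count:
  assumes SN: "S \<le> N" and m: "m \<ge> 1"
  shows "sat_count (m + 2) {..<N + c} (joined_edges m N c S) + turan_number m S \<le> (c choose 2) + (S choose 2)"
proof -
  let ?M = "multipartite {..<S} (\<lambda>u. u mod m)"
  have cM: "card ?M = turan_number m S" using card_turan_edges[OF m, of S] by (simp add: turan_edges_multipartite)
  have fM: "finite ?M"
    using multipartite_nsets[of "{..<S}"] by (meson finite_subset finite_imp_finite_nsets finite_lessThan)
  have sub: "?M \<subseteq> nsets {..<S} 2" by (rule multipartite_nsets)
  have "sat_count (m + 2) {..<N + c} (joined_edges m N c S)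
    \<le> card (nsets {N..<N + c} 2 \<union> (nsets {..<S} 2 - ?M))"
    unfolding sat_count_def by (intro card_mono joined_saturating[OF SN m]) (auto simp: finite_imp_finite_nsets)
  also have "\<dots> \<le> card (nsets {N..<N + c} 2) + card (nsets {..<S} 2 - ?M)" by (rule card_Un_le)
  also have "card (nsets {..<S} 2 - ?M) = (S choose 2) - turan_number m S"
    using fM sub cM by (simp add: card_Diff_subset)
  finally have "sat_count (m + 2) {..<N + c} (joined_edges m N c S) \<le> (c choose 2) + ((S choose 2) - turan_number m S)"
    by simp
  moreover have "turan_number m S \<le> S choose 2"
    using card_mono[OF _ sub] cM by (simp add: finite_imp_finite_nsets)
  ultimately show ?thesis by linarith
qed

text \<open>
  The hypothesis on \<open>t\<close> makes \<open>n - c\<close> congruent to \<open>-n\<close> modulo \<open>m\<close>, so the rounding terms of \<open>turan_number_formula\<close>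
  agree for \<open>n\<close> and \<open>n - c\<close>. This is why the construction attains the Turan number exactly.
\<close>

lemma turan_number_split:
  assumes m: "m \<ge> 1" and t: "2 * n = c + 2 * m * t" and cn: "c \<le> n"
  shows "turan_number m (n - c) + (m - 1) * t * c = turan_number m n"
proof -
  have dv: "m dvd (n - c) + n"
  proof -
    have "(n - c) + n = 2 * (m * t)" using t cn by linarith
    then show ?thesis by simp
  qed
  have res: "real ((n - c) mod m) * (real m - real ((n - c) mod m)) = real (n mod m) * (real m - real (n mod m))"
  proof -
    let ?a = "(n - c) mod m" and ?b = "n mod m"
    have "(?a + ?b) mod m = ((n - c) + n) mod m" by (rule mod_add_eq)
    then have "m dvd ?a + ?b" using dv by (simp add: dvd_eq_mod_eq_0)
    then obtain k where k: "?a + ?b = m * k" by (elim dvdE)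
    moreover have "?a < m" "?b < m" using m by auto
    moreover have "k < 2"
    proof (rule ccontr)
      assume "\<not> k < 2"
      then have "m * 2 \<le> m * k" by (intro mult_le_mono2) simp
      then show False using k \<open>?a < m\<close> \<open>?b < m\<close> by linarith
    qed
    ultimately consider "?a + ?b = 0" | "?a + ?b = m" by (cases k) auto
    then show ?thesis
    proof cases
      case 2
      then have "real ?a = real m - real ?b" by linarith
      then show ?thesis by simp
    qed simp
  qed
  have rc: "real (n - c) = real n - real c" using cn by (simp add: of_nat_diff)
  have rt: "2 * real n = real c + 2 * real m * real t" using arg_cong[OF t, of real] by simp
  have rm: "real (m - 1) = real m - 1" using m by (simp add: of_nat_diff)
  have "2 * real m * (real (turan_number m n) - real (turan_number m (n - c)))
     = (real m - 1) * ((real n)^2 - (real n - real c)^2)"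
    using turan_number_formula[OF m, of n] turan_number_formula[OF m, of "n - c"] res
    unfolding rc by (simp add: algebra_simps)
  also have "\<dots> = (real m - 1) * (real c * (2 * real n - real c))"
    by (simp add: power2_eq_square algebra_simps)
  also have "\<dots> = 2 * real m * (real (m - 1) * real t * real c)"
    unfolding rt rm by simp
  finally have "real (turan_number m n) - real (turan_number m (n - c)) = real (m - 1) * real t * real c"
    using m by simp
  then have "real (turan_number m (n - c) + (m - 1) * t * c) = real (turan_number m n)" by simp
  then show ?thesis by (simp only: of_nat_eq_iff)
qed

section \<open>Optimising the bound\<close>

text \<open>
  The value claimed for the minimum, in terms of \<open>m = p - 1\<close>.
\<close>

definition target :: "real \<Rightarrow> real \<Rightarrow> real" where
  "target m n = 2 * (m - 1)^2 / ((m + 1) * (4 * m^2 - 3 * m + 1)) * n^2 - (m - 1) * (2 * m - 1) / (4 * m^2 - 3 * m + 1) * n"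

lemma concave_quadratic_ge:
  fixes h :: "real \<Rightarrow> real"
  assumes h: "\<And>r. h r = a + b * r - g * r^2" and g: "g \<ge> 0" and r: "x \<le> r" "r \<le> y"
    and L: "h x \<ge> L" "h y \<ge> L"
  shows "h r \<ge> L"
proof (cases "x = y")
  case True
  then show ?thesis using r L by simp
next
  case False
  then have xy: "y - x > 0" using r by simp
  have "(y - x) * (h r - L) = (y - r) * (h x - L) + (r - x) * (h y - L) + g * ((y - x) * ((r - x) * (y - r)))"
    unfolding h by (simp add: power2_eq_square algebra_simps)
  also have "\<dots> \<ge> 0" using assms xy by (intro add_nonneg_nonneg mult_nonneg_nonneg) auto
  finally show ?thesis using xy by (simp add: zero_le_mult_iff)
qed

lemma den_bounds:
  fixes m :: real
  assumes "m \<ge> 2"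
  shows "4 * m^2 - 3 * m + 1 > 0" "4 * m^2 - 3 * m + 1 \<le> 4 * (m + 1)^2" "(m + 1) * m < 8 * (4 * m^2 - 3 * m + 1)"
proof -
  have sq: "m^2 \<ge> 2 * m" using assms by (simp add: power2_eq_square mult_right_mono)
  have e: "(m + 1)^2 = m^2 + 2 * m + 1" "(m + 1) * m = m^2 + m" by (simp_all add: power2_eq_square algebra_simps)
  show "4 * m^2 - 3 * m + 1 > 0" using sq assms by linarith
  show "4 * m^2 - 3 * m + 1 \<le> 4 * (m + 1)^2" using sq assms e by linarith
  show "(m + 1) * m < 8 * (4 * m^2 - 3 * m + 1)"   proof -
    have "31 * m^2 \<ge> 62 * m" using sq by simp
    then have "m^2 + m < 32 * m^2 - 24 * m + 8" using assms by linarith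
    then show ?thesis unfolding e(2) by simp
  qed
qed

text \<open>
  Divided by \<open>r\<close> and without the rounding term, as a function of \<open>A\<close> with \<open>C = (m - 1) A / (2m)\<close> chosen to cancel the term linear in \<open>r\<close>, the
  bound is a concave quadratic whose maximum \<open>V\<close> differs from \<open>target m n\<close> by less than 1. If \<open>r \<le> A - 1\<close>
  for the maximising \<open>A\<close>, taking \<open>r - 1/2\<close> for the second parameter instead gains
  \<open>(r - C - 1/2)\<^sup>2 / 2\<close>. The gain is of order \<open>C\<^sup>2\<close> when \<open>r\<close> is small compared with \<open>C\<close>, and pays for the
  rounding term \<open>A \<epsilon> / r\<close>, which is bounded for larger \<open>r\<close>. If \<open>r > A - 1\<close>, both parameters are set to \<open>r + 1\<close>; the resulting
  function \<open>h\<close> of \<open>r\<close> is concave, so it need only be compared with \<open>V\<close> at \<open>r = A - 1\<close> and at the largest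
  possible value \<open>n / (m + 1)\<close>. It exceeds \<open>V\<close> there by terms of order \<open>n\<^sup>2\<close>, and \<open>n\<close> is large enough for these to
  dominate the linear terms.
\<close>

lemma saturation_optimum:
  fixes m n r f \<epsilon> :: real
  assumes m: "m \<ge> 2" and n: "n \<ge> 8 * (m + 1)^5" and \<epsilon>: "0 \<le> \<epsilon>" "\<epsilon> \<le> m / 8"
    and r: "1 \<le> r" "(m + 1) * r \<le> n"
    and bound: "\<And>A C. C \<le> A \<Longrightarrow> r + 1 \<le> A \<Longrightarrow>
      r * f \<ge> A * (r * (m - 1) * n / m + (m + 1) * r^2 / (2 * m) - \<epsilon>)
        - (A - C) * r^2 - r * (m * (A + 1/2)^2 + (C + 1/2)^2) / 2"
  shows "f \<ge> target m n - (1 + m^2 / 2 + m^4 / 8)" and "\<epsilon> = 0 \<Longrightarrow> f > target m n - 1"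
proof -
  define M where "M = 4 * m^2 - 3 * m + 1"
  (* A and C are the slopes that are optimal for eps = 0, and V is the bound they give. *)
  define A where "A = (4 * m * (m - 1) * n - m * (2 * m - 1) * (m + 1)) / ((m + 1) * M)"
  define C where "C = A * (m - 1) / (2 * m)"
  define V where "V = A * ((m - 1) * n / m) - m * (A + 1/2)^2 / 2 - (C + 1/2)^2 / 2"
  have M: "M > 0" "M \<le> 4 * (m + 1)^2" "(m + 1) * m < 8 * M" using den_bounds[OF m] by (auto simp: M_def)
  have m0: "m > 0" "m \<noteq> 0" "m + 1 > 0" using m by auto
  have AM: "A * ((m + 1) * M) = 4 * m * (m - 1) * n - m * (2 * m - 1) * (m + 1)"
    using M m0 by (simp add: A_def)
  have V_quadratic: "V = A * ((4 * (m - 1) * n - (2 * m - 1) * (m + 1)) / (4 * m)) - ((m + 1) * M) / (8 * m^2) * A^2 - (m + 1) / 8"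
    using m0 unfolding V_def C_def M_def by (simp add: field_simps power2_eq_square)
  have V_eq: "V = target m n - (m + 1) * m / (8 * M)"
  proof -
    define B where "B = 4 * (m - 1) * n - (2 * m - 1) * (m + 1)"
    define D where "D = (m + 1) * M"
    have D: "D > 0" using m0 M by (simp add: D_def)
    have AB: "A = m * B / D" unfolding A_def B_def D_def by (simp add: algebra_simps)
    have "V = B^2 / (8 * D) - (m + 1) / 8"
      unfolding V_quadratic B_def[symmetric] D_def[symmetric] AB using m0 D
      by (simp add: field_simps power2_eq_square)
    also have "\<dots> = target m n - (m + 1) * m / (8 * M)"
    proof -
      have B2: "B^2 = 16 * ((m - 1)^2 * n^2) - 8 * ((m - 1) * (2 * m - 1)) * (m + 1) * n + (m + 1)^2 * (M - m)"
        unfolding B_def M_def by (simp add: power2_eq_square algebra_simps)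
      have "(16 * X - 8 * Y * q * n + q^2 * (M - m)) / (8 * (q * M)) = 2 * X / (q * M) - Y / M * n + q / 8 - q * m / (8 * M)"
        if "q > 0" for X Y q
        using M that by (simp add: field_simps power2_eq_square)
      from this[of "m + 1" "(m - 1)^2 * n^2" "(m - 1) * (2 * m - 1)"]
      have "B^2 / (8 * ((m + 1) * M))
        = 2 * ((m - 1)^2 * n^2) / ((m + 1) * M) - (m - 1) * (2 * m - 1) / M * n + (m + 1) / 8 - (m + 1) * m / (8 * M)"
        unfolding B2 using m0(3) by blast
      then show ?thesis unfolding target_def M_def[symmetric] D_def by (simp add: mult.assoc)
    qed
    finally show ?thesis .
  qed
  have p5: "(m + 1)^5 \<ge> (m + 1)^4" "(m + 1)^5 \<ge> (m + 1)^3" "(m+1)^5 \<ge> (m+1)^2" "(m + 1)^2 \<ge> 9" "(m + 1)^3 \<ge> 27"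
    using m by (auto intro!: power_increasing) (use power_mono[of 3 "m + 1" 2] power_mono[of 3 "m + 1" 3] in auto)
  have p53: "(m + 1)^5 \<ge> 9 * (m + 1)^3"
  proof -
    have "9 * (m + 1)^3 \<le> (m + 1)^2 * (m + 1)^3" using p5 m by (intro mult_right_mono) auto
    then show ?thesis by (simp flip: power_add)
  qed
  have n0: "n > 0" using n p5 by linarith
  have A_large: "(m + 1) * A \<ge> 8 * m^2"
  proof -
    have "8 * m * M \<le> 8 * (m + 1) * (4 * (m + 1)^2)" using M m0 by (intro mult_mono) auto
    also have "\<dots> = 32 * (m + 1)^3" by (simp add: power3_eq_cube power2_eq_square algebra_simps)
    finally have 1: "8 * m * M \<le> 32 * (m + 1)^3" .
    have "(2 * m - 1) * (m + 1) \<le> 2 * (m + 1) * (m + 1)" using m0 by (intro mult_right_mono) auto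
    then have 2: "(2 * m - 1) * (m + 1) \<le> 2 * (m + 1)^2" by (simp only: power2_eq_square mult.assoc)
    have "4 * 1 * n \<le> 4 * (m - 1) * n" using m n0 by (intro mult_right_mono mult_left_mono) auto
    then have "8 * m * M \<le> 4 * (m - 1) * n - (2 * m - 1) * (m + 1)" using 1 2 n p5 p53 by linarith
    then have "m * (8 * m * M) \<le> m * (4 * (m - 1) * n - (2 * m - 1) * (m + 1))" using m0 by (intro mult_left_mono) auto
    then have "8 * m^2 * M \<le> ((m + 1) * A) * M"
      using AM by (simp add: power2_eq_square algebra_simps)
    then show ?thesis using M by simp
  qed
  have A0: "A > 0"
  proof -
    have "(m + 1) * A > 0" using A_large m0 by (smt (verit) zero_less_power)
    then show ?thesis using m0 by (simp add: zero_less_mult_iff)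
  qed
  have C0: "C > 0" using A0 m m0 by (simp add: C_def)
  have A_C: "A = C * (2 * m / (m - 1))" using m by (simp add: C_def)
  have "f \<ge> V - (m^2 / 2 + m^4 / 8) \<and> (\<epsilon> = 0 \<longrightarrow> f \<ge> V)"
  proof (cases "r \<le> A - 1")
    case True
    have Cr: "r - 1/2 \<le> A" using True by simp
    have "r * f \<ge> A * (r * (m - 1) * n / m + (m + 1) * r^2 / (2 * m) - \<epsilon>)
        - (A - (r - 1/2)) * r^2 - r * (m * (A + 1/2)^2 + (r - 1/2 + 1/2)^2) / 2"
      by (rule bound[OF Cr]) (use True in simp)
    also have "A * (r * (m - 1) * n / m + (m + 1) * r^2 / (2 * m) - \<epsilon>)
        - (A - (r - 1/2)) * r^2 - r * (m * (A + 1/2)^2 + (r - 1/2 + 1/2)^2) / 2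
      = r * (V + (r - C - 1/2)^2 / 2 - A * \<epsilon> / r)"
      using m0 r(1) unfolding V_def C_def by (simp add: field_simps power2_eq_square)
    finally have f1: "f \<ge> V + (r - C - 1/2)^2 / 2 - A * \<epsilon> / r" using r(1) by simp
    have Ce4: "A * \<epsilon> \<le> C * (m^2 / 4)"
    proof -
      have "2 * m / (m - 1) \<le> 2 * m / 1" using m by (intro divide_left_mono) auto
      then have "2 * m / (m - 1) * \<epsilon> \<le> (2 * m) * (m / 8)" using \<epsilon> m by (intro mult_mono) auto
      then have "2 * m / (m - 1) * \<epsilon> \<le> m^2 / 4" by (simp add: power2_eq_square)
      then have "C * (2 * m / (m - 1) * \<epsilon>) \<le> C * (m^2 / 4)" using C0 by (intro mult_left_mono) auto
      then show ?thesis unfolding A_C by (simp add: mult.assoc)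
    qed
    have m4: "m^4 / 8 \<ge> 0" "m^2 / 2 \<ge> 0" by auto
    have "(r - C - 1/2)^2 / 2 - A * \<epsilon> / r \<ge> - (m^2 / 2 + m^4 / 8)"
    proof (cases "r \<ge> C / 2")
      case True
      have "A * \<epsilon> / r \<le> C * (m^2 / 4) / r" using Ce4 r(1) by (intro divide_right_mono) auto
      also have "\<dots> \<le> (2 * r) * (m^2 / 4) / r" using True r(1) by (intro divide_right_mono mult_right_mono) auto
      also have "\<dots> = m^2 / 2" using r(1) by simp
      finally show ?thesis using m4 zero_le_power2[of "r - C - 1/2"] by linarith
    next
      case False
      have "A * \<epsilon> / r \<le> A * \<epsilon> / 1" using A0 \<epsilon> r(1) by (intro divide_left_mono) auto
      then have a: "A * \<epsilon> / r \<le> C * (m^2 / 4)" using Ce4 by linarith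
      have "(C / 2)^2 \<le> (C + 1/2 - r)^2" using False C0 by (intro power_mono) auto
      also have "\<dots> = (r - C - 1/2)^2" by (simp add: power2_eq_square algebra_simps)
      finally have b: "(r - C - 1/2)^2 \<ge> C^2 / 4" by (simp add: power_divide)
      have "m^2 * m^2 = m^4" by (simp flip: power_add)
      then have "0 \<le> C^2 - 2 * C * m^2 + m^4" using zero_le_power2[of "C - m^2"]
        by (simp add: power2_diff power_mult[symmetric])
      then have "C^2 / 8 - C * (m^2 / 4) \<ge> - (m^4 / 8)" by simp
      then show ?thesis using a b m4 by linarith
    qed
    then have low: "f \<ge> V - (m^2 / 2 + m^4 / 8)" using f1 by linarith
    show ?thesis
    proof (intro conjI impI low)
      assume "\<epsilon> = 0"
      then have "f \<ge> V + (r - C - 1/2)^2 / 2" using f1 by simp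
      moreover have "0 \<le> (r - C - 1/2)^2" by simp
      ultimately show "f \<ge> V" by linarith
    qed
  next
    case False
    (* h is the bound with both slopes equal to r + 1, without the rounding term. *)
    define h where "h x = (x + 1) * ((m - 1) * n / m + (m + 1) * x / (2 * m)) - (m + 1) * (x + 3/2)^2 / 2" for x
    have "r * f \<ge> (r + 1) * (r * (m - 1) * n / m + (m + 1) * r^2 / (2 * m) - \<epsilon>)
        - (r + 1 - (r + 1)) * r^2 - r * (m * (r + 1 + 1/2)^2 + (r + 1 + 1/2)^2) / 2"
      by (rule bound) auto
    also have "(r + 1) * (r * (m - 1) * n / m + (m + 1) * r^2 / (2 * m) - \<epsilon>)
        - (r + 1 - (r + 1)) * r^2 - r * (m * (r + 1 + 1/2)^2 + (r + 1 + 1/2)^2) / 2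
      = r * (h r - (r + 1) * \<epsilon> / r)"
      using m0 r(1) unfolding h_def by (simp add: field_simps power2_eq_square)
    finally have f1: "f \<ge> h r - (r + 1) * \<epsilon> / r" using r(1) by simp
    have "(r + 1) * \<epsilon> / r \<le> (2 * r) * \<epsilon> / r" using r(1) \<epsilon> by (intro divide_right_mono mult_right_mono) auto
    moreover have "(2 * r) * \<epsilon> / r = 2 * \<epsilon>" using r(1) by simp
    ultimately have e: "(r + 1) * \<epsilon> / r \<le> m / 4" using \<epsilon> by linarith
    have "h r \<ge> V + m / 4"
    proof (rule concave_quadratic_ge[where h = h and x = "A - 1" and y = "n / (m + 1)"])
      show "h x = ((m - 1) * n / m - 9 * (m + 1) / 8) + ((m - 1) * n / m + (m + 1) / (2 * m) - 3 * (m + 1) / 2) * x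
          - (m + 1) * (m - 1) / (2 * m) * x^2" for x
        unfolding h_def using m0 by (simp add: field_simps power2_eq_square)
      show "0 \<le> (m + 1) * (m - 1) / (2 * m)" using m by simp
      show "A - 1 \<le> r" using False by simp
      show "r \<le> n / (m + 1)" using r(2) m0 by (simp add: field_simps)
      show "V + m / 4 \<le> h (A - 1)"
      proof -
        have "h (A - 1) = V + (m + 1) * A / (8 * m^2) * ((m + 1) * A - 6 * m)"
          unfolding h_def V_def C_def using m0 by (simp add: field_simps power2_eq_square)
        moreover have "m / 4 \<le> (m + 1) * A / (8 * m^2) * ((m + 1) * A - 6 * m)"
        proof -
          have mm: "m * m \<ge> 2 * m" using m by (intro mult_right_mono) auto
          have "m / 4 \<le> 1 * (8 * m^2 - 6 * m)" using mm m by (simp add: power2_eq_square)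
          also have "\<dots> \<le> (m + 1) * A / (8 * m^2) * ((m + 1) * A - 6 * m)"
            using A_large m0 m mm A0 by (intro mult_mono) (auto simp: le_divide_eq power2_eq_square)
          finally show ?thesis .
        qed
        ultimately show ?thesis by simp
      qed
      show "V + m / 4 \<le> h (n / (m + 1))"
      proof -
        have hn: "h (n / (m + 1)) = (m - 1) * n^2 / (2 * m * (m + 1)) - (m + 1) * n / (2 * m) - 9 * (m + 1) / 8"
        proof -
          define x where "x = n / (m + 1)"
          have nx: "n = (m + 1) * x" using m0 by (simp add: x_def)
          have "h x = (m - 1) * (m + 1) * x^2 / (2 * m) - (m + 1) * ((m + 1) * x) / (2 * m) - 9 * (m + 1) / 8"
            unfolding h_def nx using m0(1,2) by (simp add: field_simps power2_eq_square)
          moreover have "(m - 1) * n^2 / (2 * m * (m + 1)) = (m - 1) * (m + 1) * x^2 / (2 * m)"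
            unfolding nx using m0 by (simp add: power2_eq_square)
          ultimately show ?thesis unfolding x_def[symmetric] nx[symmetric] by simp
        qed
        have "V \<le> target m n" using V_eq M m0 by simp
        also have "\<dots> \<le> 2 * (m - 1)^2 / ((m + 1) * M) * n^2"
          unfolding target_def M_def[symmetric] using m n0 M by simp
        finally have V1: "V \<le> 2 * (m - 1)^2 / ((m + 1) * M) * n^2" .
        have diff: "(m - 1) * n^2 / (2 * m * (m + 1)) - 2 * (m - 1)^2 / ((m + 1) * M) * n^2 = (m - 1) * n^2 / (2 * m * M)"
        proof -
          have "(m - 1) * M - 4 * m * (m - 1)^2 = (m - 1) * (m + 1)"
            by (simp add: M_def power2_eq_square algebra_simps)
          then have "((m - 1) * M - 4 * m * (m - 1)^2) * n^2 / (2 * m * (m + 1) * M) = (m - 1) * (m + 1) * n^2 / (2 * m * (m + 1) * M)"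
            by simp
          moreover have "((m - 1) * M - 4 * m * (m - 1)^2) * n^2 / (2 * m * (m + 1) * M)
             = (m - 1) * n^2 / (2 * m * (m + 1)) - 2 * (m - 1)^2 / ((m + 1) * M) * n^2"
          proof -
            have "(a * M - 4 * m * a^2) * N / (2 * m * q * M) = a * N / (2 * m * q) - 2 * a^2 / (q * M) * N"
              if "q > 0" for a N q
              using that m0(1) M(1) by (simp add: field_simps power2_eq_square)
            then show ?thesis using m0(3) .
          qed
          ultimately show ?thesis using m0 M by simp
        qed
        have "(m - 1) * n^2 / (2 * m * M) \<ge> (m + 1) * n / (2 * m) + 9 * (m + 1) / 8 + m / 4"
        proof -
          have a: "(m + 1) * n * M \<le> (m + 1) * n * (4 * (m + 1)^2)" using M m0 n0 by (intro mult_left_mono) auto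
          have a': "(m + 1) * n * (4 * (m + 1)^2) = 4 * (m + 1)^3 * n" by (simp add: power3_eq_cube power2_eq_square)
          have "2 * m * M * (9 * (m + 1) / 8 + m / 4) \<le> 2 * (m + 1) * (4 * (m + 1)^2) * (2 * (m + 1))"
          proof (intro mult_mono)
            show "9 * (m + 1) / 8 + m / 4 \<le> 2 * (m + 1)" using m0(1) by (simp add: field_simps)
          qed (use M m0 in auto)
          also have "\<dots> = 16 * (m + 1)^4"
          proof -
            have "2 * q * (4 * q^2) * (2 * q) = 16 * q^4" for q :: real
              by (simp add: power4_eq_xxxx power2_eq_square)
            then show ?thesis .
          qed
          finally have b: "2 * m * M * (9 * (m + 1) / 8 + m / 4) \<le> 16 * (m + 1)^4" .
          have "3 * (m + 1)^4 \<le> (m + 1) * (m + 1)^4" using m by (intro mult_right_mono) auto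
          moreover have "(m + 1) * (m + 1)^4 = (m + 1)^5" by (simp flip: power_Suc)
          moreover have "0 \<le> (m + 1)^4" by simp
          ultimately have q4: "16 * (m + 1)^4 \<le> n" using n by linarith
          define W where "W = (m + 1)^5 * n"
          have "1 * n \<le> W" unfolding W_def using n0 p5 m by (intro mult_right_mono) auto
          moreover have "(m + 1)^3 * n \<le> W" unfolding W_def using n0 p5 by (intro mult_right_mono) auto
          moreover have "8 * (m + 1)^5 * n \<le> n * n" using n n0 by (intro mult_right_mono) auto
          then have "8 * W \<le> n^2" by (simp add: W_def power2_eq_square mult.assoc)
          moreover have "1 * n^2 \<le> (m - 1) * n^2" using m by (intro mult_right_mono) auto
          moreover have "(m + 1) * n * M \<le> 4 * ((m + 1)^3 * n)" using a unfolding a' by (simp add: mult.assoc)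
          ultimately have "(m + 1) * n * M + 2 * m * M * (9 * (m + 1) / 8 + m / 4) \<le> (m - 1) * n^2"
            using b q4 n0 by linarith
          moreover have "(q * n / (2 * m) + x) * (2 * m * M) = q * n * M + 2 * m * M * x" for q x
            using m0(1) by (simp add: field_simps)
          ultimately have "((m + 1) * n / (2 * m) + (9 * (m + 1) / 8 + m / 4)) * (2 * m * M) \<le> (m - 1) * n^2"
            by simp
          moreover have "2 * m * M > 0" using m0 M by simp
          ultimately have "(m + 1) * n / (2 * m) + (9 * (m + 1) / 8 + m / 4) \<le> (m - 1) * n^2 / (2 * m * M)"
            by (simp only: pos_le_divide_eq)
          then show ?thesis by linarith
        qed
        then show ?thesis using hn V1 diff by linarith
      qed
    qed
    moreover have "m^4 / 8 \<ge> 0" "m^2 / 2 \<ge> 0" by auto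
    ultimately show ?thesis using f1 e by linarith
  qed
  moreover have "(m + 1) * m / (8 * M) < 1" using M by simp
  ultimately show "f \<ge> target m n - (1 + m^2 / 2 + m^4 / 8)" "\<epsilon> = 0 \<Longrightarrow> f > target m n - 1"
    unfolding V_eq by auto
qed

text \<open>
  The number of saturating edges of the construction, up to rounding. The part of degree 2
  in \<open>n\<close> and \<open>c\<close> is minimal at \<open>d = 0\<close>, so \<open>d\<close> enters only through terms free of \<open>n\<close>.
\<close>

lemma construction_value:
  fixes m n c d :: real
  assumes m: "m \<ge> 2" and c: "c = 2 * (m - 1)^2 / ((m + 1) * (4 * m^2 - 3 * m + 1)) * n + d"
    and S: "S = (m - 1) * (2 * n - c) / (2 * m)"
  shows "c * (c - 1) / 2 + S * (S - 1) / 2 - (m - 1) * S^2 / (2 * m)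
    = target m n + (m + 1) * (4 * m^2 - 3 * m + 1) / (8 * m^3) * d^2 - (m + 1) / (4 * m) * d"
proof -
  define P where "P = (m + 1) * (4 * m^2 - 3 * m + 1)"
  have m0: "m > 0" using m by simp
  have P0: "P > 0" using den_bounds(1)[OF m] m0 by (simp add: P_def)
  have P: "P = 4 * m^3 + (m - 1)^2" by (simp add: P_def power2_eq_square power3_eq_cube algebra_simps)
  define k where "k = 2 * (m - 1)^2 / P"
  have k: "k * P = 2 * (m - 1)^2" using P0 by (simp add: k_def)
  have ck: "c = k * n + d" using c by (simp add: k_def P_def)
  have quad: "8 * m^3 * (c^2 / 2 + S^2 / (2 * m)) = P * d^2 + 16 * m^3 * (m - 1)^2 * n^2 / P"
  proof -
    have "8 * m^3 * (c^2 / 2 + S^2 / (2 * m)) = 4 * m^3 * c^2 + (m - 1)^2 * (2 * n - c)^2"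
      unfolding S using m0 by (simp add: field_simps power2_eq_square power3_eq_cube)
    also have "\<dots> = P * c^2 - 2 * (2 * (m - 1)^2) * n * c + 4 * (m - 1)^2 * n^2"
      unfolding P by (simp add: power2_eq_square algebra_simps)
    also have "\<dots> = P * d^2 - P * k * k * n^2 + 4 * (m - 1)^2 * n^2"
      unfolding k[symmetric] ck by (simp add: power2_eq_square algebra_simps)
    also have "P * k * k = 4 * (m - 1)^4 / P"
      unfolding k_def using P0 by (simp add: field_simps power2_eq_square power4_eq_xxxx)
    also have "P * d^2 - 4 * (m - 1)^4 / P * n^2 + 4 * (m - 1)^2 * n^2
        = P * d^2 + 4 * (m - 1)^2 * n^2 * (P - (m - 1)^2) / P"
      using P0 by (simp add: field_simps power2_eq_square power4_eq_xxxx)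
    also have "P - (m - 1)^2 = 4 * m^3" by (simp add: P)
    finally show ?thesis by (simp add: mult_ac)
  qed
  have "c^2 / 2 + S^2 / (2 * m) = (P * d^2 + 16 * m^3 * (m - 1)^2 * n^2 / P) / (8 * m^3)"
    unfolding quad[symmetric] using m0 by simp
  also have "\<dots> = P / (8 * m^3) * d^2 + 2 * (m - 1)^2 / P * n^2"
    using m0 P0 by (simp add: field_simps)
  finally have q: "c^2 / 2 + S^2 / (2 * m) = P / (8 * m^3) * d^2 + 2 * (m - 1)^2 / P * n^2" .
  have M0: "4 * m^2 - 3 * m + 1 > 0" by (rule den_bounds(1)[OF m])
  have lin: "(c + S) / 2 = (m - 1) * (2 * m - 1) / (4 * m^2 - 3 * m + 1) * n + (m + 1) / (4 * m) * d"
  proof -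
    define M where "M = 4 * m^2 - 3 * m + 1"
    have "(c + S) / 2 = c * (m + 1) / (4 * m) + (m - 1) * n / (2 * m)"
      unfolding S using m0 by (simp add: field_simps)
    also have "c * (m + 1) / (4 * m) = (m - 1)^2 * n / (2 * m * M) + (m + 1) / (4 * m) * d"
      proof -
      have "(2 * X / (q * M) * n + d) * q / (4 * m) = X * n / (2 * m * M) + q / (4 * m) * d" if "q > 0" for X q
        using that M0 m0 unfolding M_def[symmetric] by (simp add: field_simps)
      from this[of "m + 1" "(m - 1)^2"] show ?thesis
        unfolding c M_def[symmetric] using m0 by simp
    qed
    also have "(m - 1)^2 * n / (2 * m * M) + (m + 1) / (4 * m) * d + (m - 1) * n / (2 * m)
       = (m - 1) * n * ((m - 1) + M) / (2 * m * M) + (m + 1) / (4 * m) * d"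
      using m0 M0 unfolding M_def[symmetric] by (simp add: field_simps power2_eq_square)
    also have "(m - 1) + M = 2 * m * (2 * m - 1)" by (simp add: M_def power2_eq_square algebra_simps)
    also have "(m - 1) * n * (2 * m * (2 * m - 1)) / (2 * m * M) = (m - 1) * (2 * m - 1) / M * n"
    proof -
      have "(m - 1) * n * (2 * m * k) / (2 * m * M) = (m - 1) * k / M * n" for k using m0 by simp
      then show ?thesis .
    qed
    finally show ?thesis unfolding M_def .
  qed
  have "c * (c - 1) / 2 + S * (S - 1) / 2 - (m - 1) * S^2 / (2 * m) = (c^2 / 2 + S^2 / (2 * m)) - (c + S) / 2"
    using m0 by (simp add: field_simps power2_eq_square)
  also have "\<dots> = target m n + P / (8 * m^3) * d^2 - (m + 1) / (4 * m) * d"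
    unfolding q lin target_def P_def by simp
  finally show ?thesis unfolding P_def .
qed

section \<open>The minimum number of saturating edges\<close>

lemma turan_number_real:
  fixes m n :: nat
  defines "\<epsilon> \<equiv> (real m - 1) * (real n)^2 / (2 * real m) - real (turan_number m n)"
  assumes m: "m \<ge> 1"
  shows "0 \<le> \<epsilon>" "\<epsilon> \<le> real m / 8" "m dvd n \<Longrightarrow> \<epsilon> = 0"
proof -
  have eq: "2 * real m * \<epsilon> = real (n mod m) * (real m - real (n mod m))"
  proof -
    have "2 * real m * \<epsilon> = (real m - 1) * (real n)^2 - 2 * real m * real (turan_number m n)"
      using m by (simp add: \<epsilon>_def right_diff_distrib)
    then show ?thesis using turan_number_formula[OF m, of n] by linarith
  qed
  have "n mod m < m" using m by simp
  then have "0 \<le> 2 * real m * \<epsilon>" unfolding eq by simp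
  then show "0 \<le> \<epsilon>" using m by (simp add: zero_le_mult_iff)
  have "2 * real m * \<epsilon> \<le> 2 * real m * (real m / 8)"
    unfolding eq using turan_defect[of "real (n mod m)" "real m"] by (simp add: power2_eq_square)
  then show "\<epsilon> \<le> real m / 8" using m by (simp only: mult_le_cancel_left_pos[of "2 * real m"])
  show "\<epsilon> = 0" if "m dvd n"
    using eq that m by simp
qed

text \<open>
  Not being the Turan graph, the graph contains a \<open>K\<^bsub>p\<^esub>\<close>, so the packing has weight at least 1 and
  \<open>saturation_bound\<close> applies with all admissible \<open>A\<close> and \<open>C\<close>.
\<close>

lemma non_turan_lower:
  fixes p n :: nat
  defines "m \<equiv> real p - 1"
  assumes p: "p \<ge> 3" and n: "n \<ge> 8 * p^5" and E: "E \<in> non_turan_family p n"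
  shows "real (sat_count (p + 1) {..<n} E) \<ge> target m (real n) - (1 + m^2 / 2 + m^4 / 8)"
    and "(p - 1) dvd n \<Longrightarrow> real (sat_count (p + 1) {..<n} E) > target m (real n) - 1"
proof -
  define k where "k = p - 1"
  have k: "p = k + 1" "k \<ge> 1" "real k = m" using p by (auto simp: k_def m_def)
  have fam: "simple_graph {..<n} E" "\<not> contains_K (p + 1) {..<n} E" "card E = ex_K n p"
    "\<not> graph_iso {..<n} E {..<n} (turan_edges (p - 1) n)"
    using E by (auto simp: non_turan_family_def extremal_family_def)
  have cardE: "card E = turan_number k n" using fam(3) ex_K_turan[of p n] p by (simp add: k_def)
  have "p^1 \<le> p^5" using p by (intro power_increasing) auto
  then have nk: "n > k" using n k p by simp
  have "contains_K p {..<n} E"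
  proof (rule ccontr)
    assume "\<not> contains_K p {..<n} E"
    then have "graph_iso {..<n} E {..<n} (turan_edges k n)"
      using turan_unique[OF fam(1) _ cardE nk k(2)] k(1) by simp
    then show False using fam(4) by (simp add: k_def)
  qed
  then have Kne: "{T \<in> nsets {..<n} p. clique T E} \<noteq> {}" by (auto simp: contains_K_def)
  have m2: "m \<ge> 2" using p by (simp add: m_def)
  have m1: "m + 1 = real p" by (simp add: m_def)
  have nr: "real n \<ge> 8 * (m + 1)^5"
    unfolding m1 using n by (metis of_nat_le_iff of_nat_mult of_nat_numeral of_nat_power)
  define \<K> where "\<K> = {T \<in> nsets {..<n} p. clique T E}"
  have \<K>: "finite \<K>" "\<Union>\<K> \<subseteq> {..<n}" "{} \<notin> \<K>"
    using p by (auto simp: \<K>_def nsets_def finite_imp_finite_nsets)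
  obtain y z where yz: "(\<forall>v\<in>{..<n}. y v \<ge> (0::real)) \<and> (\<forall>T\<in>\<K>. z T \<ge> (0::real)) \<and>
     (\<forall>T\<in>\<K>. sum y T \<ge> 1) \<and> (\<forall>v\<in>{..<n}. (\<Sum>T\<in>{T\<in>\<K>. v \<in> T}. z T) \<le> 1) \<and>
     (\<forall>T\<in>\<K>. z T > 0 \<longrightarrow> sum y T = 1) \<and>
     (\<forall>v\<in>{..<n}. y v > 0 \<longrightarrow> (\<Sum>T\<in>{T\<in>\<K>. v \<in> T}. z T) = 1)"
    using fractional_packing_duality[OF finite_lessThan \<K>] by (elim exE) rule
  interpret clique_packing "{..<n}" E p y z \<K>
    by unfold_locales (use yz fam(1,2) p in \<open>simp_all add: \<K>_def\<close>)
  define f where "f = real (sat_count (p + 1) {..<n} E)"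
  define \<epsilon> where "\<epsilon> = (m - 1) * (real n)^2 / (2 * m) - real (card E)"
  have \<epsilon>: "0 \<le> \<epsilon>" "\<epsilon> \<le> m / 8" "k dvd n \<Longrightarrow> \<epsilon> = 0"
    using turan_number_real[OF k(2), of n] unfolding \<epsilon>_def cardE k(3) by auto
  have r1: "1 \<le> r" by (rule r_ge1[OF Kne[folded \<K>_def]])
  have rn: "(m + 1) * r \<le> real n" using r_le by (simp add: m1)
  have bound: "r * f \<ge> A * (r * (m - 1) * real n / m + (m + 1) * r^2 / (2 * m) - \<epsilon>)
        - (A - C) * r^2 - r * (m * (A + 1/2)^2 + (C + 1/2)^2) / 2" if "C \<le> A" "r + 1 \<le> A" for A C
    using saturation_bound[OF that] unfolding m_def[symmetric] card_lessThan m1 \<epsilon>_def f_def .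
  show "real (sat_count (p + 1) {..<n} E) \<ge> target m (real n) - (1 + m^2 / 2 + m^4 / 8)"
    unfolding f_def[symmetric] by (rule saturation_optimum(1)[OF m2 nr \<epsilon>(1,2) r1 rn bound])
  show "real (sat_count (p + 1) {..<n} E) > target m (real n) - 1" if "(p - 1) dvd n"
    unfolding f_def[symmetric]
    by (rule saturation_optimum(2)[OF m2 nr \<epsilon>(1,2) r1 rn bound]) (use \<epsilon>(3) that in \<open>simp_all add: k_def\<close>)
qed

lemma joined_in_family:
  assumes k: "k \<ge> 1" and t: "2 * n = c + 2 * k * t" and cn: "c \<le> n" "1 \<le> c"
    and S: "k \<le> (k - 1) * t" "(k - 1) * t \<le> n - c"
  shows "joined_edges k (n - c) c ((k - 1) * t) \<in> non_turan_family (k + 1) n"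
proof -
  let ?E = "joined_edges k (n - c) c ((k - 1) * t)"
  have n: "n - c + c = n" using cn by simp
  have simple: "simple_graph {..<n} ?E" using joined_simple[OF S(2), of c k] unfolding n .
  have free: "\<not> contains_K (k + 1 + 1) {..<n} ?E" using joined_free[OF S(2) k, of c] unfolding n by simp
  have has: "contains_K (k + 1) {..<n} ?E" using joined_contains[OF S(2) k S(1) cn(2)] unfolding n .
  have "card ?E = turan_number k n"
    using card_joined[OF S(2) k, of c] turan_number_split[OF k t cn(1)] by simp
  then have "card ?E = ex_K n (k + 1)" using ex_K_turan[of "k + 1" n] k by simp
  moreover have "\<not> graph_iso {..<n} ?E {..<n} (turan_edges k n)"
    using turan_not_iso[OF has _ k] simple by (simp add: simple_graph_def)
  ultimately show ?thesis using simple free by (simp add: non_turan_family_def extremal_family_def)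
qed

lemma real_choose_two: "real (c choose 2) = real c * (real c - 1) / 2"
proof (cases c)
  case (Suc c')
  have "even (c * (c - 1))" by (cases "even c") auto
  then have "real (c * (c - 1) div 2) = real (c * (c - 1)) / 2" by (simp add: real_of_nat_div del: of_nat_mult)
  then show ?thesis using Suc by (simp add: choose_two algebra_simps)
qed simp

text \<open>
  The number \<open>c\<close> of additional vertices must satisfy \<open>2n = c + 2 m t\<close> for an integer \<open>t\<close>; rounding \<open>t\<close> up leaves
  \<open>c\<close> within \<open>2m\<close> of its optimal value \<open>\<kappa> n\<close>. Under the divisibility hypothesis no rounding occurs, and the
  parts of the \<open>S\<close> joined vertices have equal sizes.
\<close>

lemma non_turan_upper:
  fixes p n :: nat
  defines "m \<equiv> real p - 1"
  assumes p: "p \<ge> 3" and n: "n \<ge> 8 * p^5"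
  shows "\<exists>E\<in>non_turan_family p n.
      real (sat_count (p + 1) {..<n} E) \<le> target m (real n) + ((m + 1) * (4 * m^2 - 3 * m + 1) / (2 * m) + (m + 1) / 2 + m / 8) \<and>
      (real n = (m + 1) * m * (4 * m^2 - 3 * m + 1) * real j \<longrightarrow> real (sat_count (p + 1) {..<n} E) \<le> target m (real n))"
proof -
  define k where "k = p - 1"
  have k: "p = k + 1" "k \<ge> 1" "real k = m" using p by (auto simp: k_def m_def)
  define M where "M = 4 * m^2 - 3 * m + 1"
  define \<kappa> where "\<kappa> = 2 * (m - 1)^2 / ((m + 1) * M)"
  define q where "q = (2 - \<kappa>) * real n / (2 * m)"
  define t where "t = nat \<lceil>q\<rceil>"
  define d where "d = (2 - \<kappa>) * real n - 2 * m * real t"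
  have m2: "m \<ge> 2" using p by (simp add: m_def)
  have m0: "m > 0" using m2 by simp
  have M: "M > 0" "M \<le> 4 * (m + 1)^2" using den_bounds[OF m2] by (auto simp: M_def)
  have m1: "m + 1 = real p" by (simp add: m_def)
  have nr: "real n \<ge> 8 * (m + 1)^5"
    unfolding m1 using n by (metis of_nat_le_iff of_nat_mult of_nat_numeral of_nat_power)
  have pw: "(m + 1)^5 \<ge> m + 1" using power_increasing[of 1 5 "m + 1"] m2 by simp
  have \<kappa>0: "\<kappa> \<ge> 0" unfolding \<kappa>_def using M m0 by simp
  have \<kappa>2: "(m + 1) * \<kappa> \<le> 2"
  proof -
    have "(m + 1) * \<kappa> = 2 * (m - 1)^2 / M" unfolding \<kappa>_def using m0 by simp
    moreover have "(m - 1)^2 \<le> M"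
    proof -
      have "M - (m - 1)^2 = m * (3 * m - 1)" by (simp add: M_def power2_eq_square algebra_simps)
      also have "\<dots> \<ge> 0" using m2 by simp
      finally show ?thesis by simp
    qed
    ultimately show ?thesis using M by (simp add: divide_le_eq)
  qed
  have \<kappa>1: "\<kappa> \<le> 1"
  proof -
    have "3 * \<kappa> \<le> (m + 1) * \<kappa>" using m2 \<kappa>0 by (intro mult_right_mono) auto
    then show ?thesis using \<kappa>2 by linarith
  qed
  have \<kappa>n: "\<kappa> * real n \<ge> 2 * m"
  proof -
    have "(m + 1) * M * m \<le> (m + 1) * (4 * (m + 1)^2) * (m + 1)^2"
      using M m0 m2 by (intro mult_mono) (auto simp: power2_eq_square algebra_simps)
    also have "\<dots> = 4 * (m + 1)^5" by (simp add: eval_nat_numeral algebra_simps)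
    also have "\<dots> \<le> 1 * real n" using nr pw m0 by linarith
    also have "\<dots> \<le> (m - 1)^2 * real n" using m2 power_mono[of 1 "m - 1" 2] by (intro mult_right_mono) auto
    finally have "m * ((m + 1) * M) \<le> (m - 1)^2 * real n" by (simp add: mult_ac)
    then have "m \<le> (m - 1)^2 * real n / ((m + 1) * M)" using M m0 by (simp add: pos_le_divide_eq)
    then show ?thesis by (simp add: \<kappa>_def)
  qed
  have q0: "q \<ge> 0" unfolding q_def using \<kappa>1 m0 by simp
  have tq: "q \<le> real t" "real t < q + 1" unfolding t_def using q0 by linarith+
  have mq: "2 * m * q = (2 - \<kappa>) * real n" unfolding q_def using m0 by simp
  have d: "d \<le> 0" "- (2 * m) < d"
  proof -
    have "2 * m * q \<le> 2 * m * real t" using tq m0 by (intro mult_left_mono) auto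
    then show "d \<le> 0" by (simp add: d_def mq)
    have "2 * m * real t < 2 * m * (q + 1)" using tq m0 by (intro mult_strict_left_mono) auto
    then show "- (2 * m) < d" unfolding d_def mq[symmetric] by (simp add: algebra_simps)
  qed
  have rt: "2 * m * real t = 2 * real n - (\<kappa> * real n + d)" by (simp add: d_def algebra_simps)
  have t_le: "2 * k * t < 2 * n"
  proof -
    have "real (2 * k * t) < real (2 * n)" using rt d \<kappa>n by (simp add: k(3))
    then show ?thesis by (simp only: of_nat_less_iff)
  qed
  define c where "c = 2 * n - 2 * k * t"
  have c: "2 * n = c + 2 * k * t" "1 \<le> c" using t_le by (auto simp: c_def)
  have rc: "real c = \<kappa> * real n + d"
    using arg_cong[OF c(1), of real] rt by (simp add: k(3))
  have cn: "c \<le> n"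
  proof -
    have "\<kappa> * real n \<le> 1 * real n" using \<kappa>1 by (intro mult_right_mono) auto
    then have "real c \<le> real n" using rc d by simp
    then show ?thesis by simp
  qed
  have tn: "n \<le> (k + 1) * t"
  proof -
    have "2 * m * real n \<le> (2 * (m + 1) - (m + 1) * \<kappa>) * real n"
      using \<kappa>2 by (intro mult_right_mono) auto
    also have "\<dots> = (m + 1) * (2 * m * q)" unfolding mq by (simp add: algebra_simps)
    also have "\<dots> \<le> (m + 1) * (2 * m * real t)" using tq m0 by (intro mult_left_mono) auto
    finally have "2 * m * real n \<le> 2 * m * ((m + 1) * real t)" by (simp add: mult_ac)
    then have "real n \<le> (m + 1) * real t" using m0 by simp
    then have "real n \<le> real ((k + 1) * t)" by (simp add: k(3)[symmetric] algebra_simps)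
    then show ?thesis by (simp only: of_nat_le_iff)
  qed
  have k2: "k \<ge> 2" using p k by simp
  have t2: "2 \<le> t"
  proof (rule ccontr)
    assume "\<not> 2 \<le> t"
    then have "(k + 1) * t \<le> (k + 1) * 1" by (intro mult_le_mono2) simp
    then have "real n \<le> m + 1" using tn k(3) by (simp add: k(3)[symmetric])
    then show False using nr pw m0 by linarith
  qed
  (* The S = (k - 1) t joined vertices meet every part and are available among the n - c. *)
  have kS: "k \<le> (k - 1) * t"
  proof -
    have "k \<le> (k - 1) * 2" using k2 by simp
    also have "\<dots> \<le> (k - 1) * t" using t2 by (intro mult_le_mono2)
    finally show ?thesis .
  qed
  have SN: "(k - 1) * t \<le> n - c"
  proof -
    have "2 * k * t = (k - 1) * t + (k + 1) * t" using k(2) by (cases k) auto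
    then show ?thesis using c(1) cn tn by linarith
  qed
  define S where "S = (k - 1) * t"
  let ?E = "joined_edges k (n - c) c S"
  have fam: "?E \<in> non_turan_family p n"
    unfolding S_def k(1) by (rule joined_in_family[OF k(2) c(1) cn c(2) kS SN])
  have rS: "real S = (m - 1) * (2 * real n - real c) / (2 * m)"
  proof -
    have "real S = (m - 1) * real t" using k by (simp add: S_def of_nat_diff)
    moreover have "2 * real n - real c = 2 * m * real t" unfolding rc using rt by simp
    ultimately show ?thesis using m0 by simp
  qed
  define \<delta> where "\<delta> = (m - 1) * (real S)^2 / (2 * m) - real (turan_number k S)"
  have \<delta>: "\<delta> \<le> m / 8" "k dvd S \<Longrightarrow> \<delta> = 0"
    using turan_number_real[OF k(2), of S] by (auto simp: \<delta>_def k(3))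
  have "sat_count (k + 2) {..<n - c + c} ?E + turan_number k S \<le> (c choose 2) + (S choose 2)"
    unfolding S_def by (rule joined_sat_count[OF SN k(2)])
  moreover have "n - c + c = n" "k + 2 = p + 1" using cn k by auto
  ultimately have "sat_count (p + 1) {..<n} ?E + turan_number k S \<le> (c choose 2) + (S choose 2)" by simp
  then have "real (sat_count (p + 1) {..<n} ?E + turan_number k S) \<le> real ((c choose 2) + (S choose 2))"
    by (simp only: of_nat_le_iff)
  then have "real (sat_count (p + 1) {..<n} ?E) \<le> real c * (real c - 1) / 2 + real S * (real S - 1) / 2 - (m - 1) * (real S)^2 / (2 * m) + \<delta>"
    by (simp add: real_choose_two \<delta>_def)
  also have "real c * (real c - 1) / 2 + real S * (real S - 1) / 2 - (m - 1) * (real S)^2 / (2 * m)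
    = target m (real n) + (m + 1) * M / (8 * m^3) * d^2 - (m + 1) / (4 * m) * d"
    unfolding M_def by (rule construction_value[OF m2 _ rS]) (simp add: rc \<kappa>_def M_def)
  finally have val: "real (sat_count (p + 1) {..<n} ?E) \<le> target m (real n) + (m + 1) * M / (8 * m^3) * d^2 - (m + 1) / (4 * m) * d + \<delta>" .
  have "(m + 1) * M / (8 * m^3) * d^2 - (m + 1) / (4 * m) * d + \<delta> \<le> (m + 1) * M / (2 * m) + (m + 1) / 2 + m / 8"
  proof -
    have "d^2 \<le> (2 * m)^2" using power_mono[of "- d" "2 * m" 2] d by simp
    then have "(m + 1) * M / (8 * m^3) * d^2 \<le> (m + 1) * M / (8 * m^3) * (2 * m)^2"
      using M m0 by (intro mult_left_mono) auto
    also have "\<dots> = (m + 1) * M / (2 * m)" using m0 by (simp add: field_simps power2_eq_square power3_eq_cube)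
    finally have 1: "(m + 1) * M / (8 * m^3) * d^2 \<le> (m + 1) * M / (2 * m)" .
    have "(m + 1) / (4 * m) * (- d) \<le> (m + 1) / (4 * m) * (2 * m)" using d m0 by (intro mult_left_mono) auto
    also have "\<dots> = (m + 1) / 2" using m0 by simp
    finally have "- ((m + 1) / (4 * m) * d) \<le> (m + 1) / 2" by (simp only: mult_minus_right)
    then show ?thesis using 1 \<delta>(1) by linarith
  qed
  then have "real (sat_count (p + 1) {..<n} ?E) \<le> target m (real n) + ((m + 1) * M / (2 * m) + (m + 1) / 2 + m / 8)"
    using val by linarith
  moreover have "real (sat_count (p + 1) {..<n} ?E) \<le> target m (real n)" if j: "real n = (m + 1) * m * M * real j"
  proof -
    have "\<kappa> * real n = 2 * (m - 1)^2 * (m * real j)"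
      unfolding \<kappa>_def j using m0 M by simp
    then have "2 * m * q = 2 * m * (((m + 1) * M - (m - 1)^2) * real j)"
      unfolding mq by (simp add: j algebra_simps)
    then have "q = ((m + 1) * M - (m - 1)^2) * real j" using m0 by simp
    also have "(m + 1) * M - (m - 1)^2 = 4 * m^3"
      by (simp add: M_def power2_eq_square power3_eq_cube algebra_simps)
    also have "4 * m^3 * real j = real (4 * k^3 * j)" by (simp add: k(3))
    finally have qt: "q = real (4 * k^3 * j)" .
    then have t: "t = 4 * k^3 * j" unfolding t_def by (simp only: ceiling_of_nat nat_int)
    have "d = 0" unfolding d_def mq[symmetric] t qt by simp
    moreover have "k dvd S" unfolding S_def t by (simp add: power3_eq_cube)
    ultimately show ?thesis using val \<delta>(2) by simp
  qed
  ultimately show ?thesis using fam unfolding M_def by blast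
qed

lemma target_real_p:
  fixes p :: nat
  defines "m \<equiv> real p - 1"
  shows "2 * (real p - 2)^2 / (real p * (4 * (real p)^2 - 11 * real p + 8)) * (real n)^2
     - (real p - 2) * (2 * real p - 3) / (4 * (real p)^2 - 11 * real p + 8) * real n = target m (real n)"
proof -
  have "4 * (real p)^2 - 11 * real p + 8 = 4 * m^2 - 3 * m + 1" "real p - 2 = m - 1" "2 * real p - 3 = 2 * m - 1" "real p = m + 1"
    by (simp_all add: m_def power2_eq_square algebra_simps)
  then show ?thesis by (simp only: target_def)
qed

lemma min_sat_bounds:
  assumes n: "finite (non_turan_family p n)" and E: "E \<in> non_turan_family p n"
  shows "min_sat p n \<le> sat_count (p + 1) {..<n} E"
    and "\<exists>E'\<in>non_turan_family p n. min_sat p n = sat_count (p + 1) {..<n} E'"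
proof -
  show "min_sat p n \<le> sat_count (p + 1) {..<n} E"
    unfolding min_sat_def using assms by (intro Min_le) auto
  have "min_sat p n \<in> sat_count (p + 1) {..<n} ` non_turan_family p n"
    unfolding min_sat_def using assms by (intro Min_in) auto
  then show "\<exists>E'\<in>non_turan_family p n. min_sat p n = sat_count (p + 1) {..<n} E'" by auto
qed

lemma finite_family: "finite (non_turan_family p n)"
proof -
  have "non_turan_family p n \<subseteq> Pow (nsets {..<n} 2)"
    by (auto simp: non_turan_family_def extremal_family_def simple_graph_def)
  then show ?thesis by (rule finite_subset) (simp add: finite_imp_finite_nsets)
qed

text \<open>
  In the divisible case the target is an integer, and the minimum is at most the target but
  larger than the target minus 1.
\<close>

theorem theorem1p3:
  fixes p :: nat
  assumes "p \<ge> 3"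
  shows "(\<exists>C::real. \<forall>n::nat. n \<ge> 8 * p ^ 5 \<longrightarrow>
            non_turan_family p n \<noteq> {} \<and>
            \<bar>real (min_sat p n) -
              (2 * (real p - 2)^2 / (real p * (4 * (real p)^2 - 11 * real p + 8)) * (real n)^2
               - (real p - 2) * (2 * real p - 3) / (4 * (real p)^2 - 11 * real p + 8) * real n)\<bar>
            \<le> C) \<and>
         (\<forall>n::nat. n \<ge> 8 * p ^ 5 \<longrightarrow>
            int p * (int p - 1) * (4 * (int p)^2 - 11 * int p + 8) dvd int n \<longrightarrow>
            non_turan_family p n \<noteq> {} \<and>
            real (min_sat p n) =
              2 * (real p - 2)^2 / (real p * (4 * (real p)^2 - 11 * real p + 8)) * (real n)^2
              - (real p - 2) * (2 * real p - 3) / (4 * (real p)^2 - 11 * real p + 8) * real n)"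
  unfolding target_real_p
proof (intro conjI)
  define m where "m = real p - 1"
  have m2: "m \<ge> 2" using assms by (simp add: m_def)
  define low where "low = 1 + m^2 / 2 + m^4 / 8"
  define up where "up = (m + 1) * (4 * m^2 - 3 * m + 1) / (2 * m) + (m + 1) / 2 + m / 8"
  have pos: "low \<ge> 0" "up \<ge> 0"
    using m2 den_bounds(1)[OF m2] by (auto simp: low_def up_def)
  show "\<exists>C. \<forall>n\<ge>8 * p^5. non_turan_family p n \<noteq> {} \<and> \<bar>real (min_sat p n) - target (real p - 1) (real n)\<bar> \<le> C"
  proof (intro exI allI impI)
    fix n assume n: "8 * p^5 \<le> n"
    obtain E where E: "E \<in> non_turan_family p n" "real (sat_count (p + 1) {..<n} E) \<le> target m (real n) + up"
      using non_turan_upper[OF assms n, of 0] unfolding m_def[symmetric] up_def by blast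
    obtain E' where E': "E' \<in> non_turan_family p n" "min_sat p n = sat_count (p + 1) {..<n} E'"
      using min_sat_bounds(2)[OF finite_family E(1)] by blast
    have "real (min_sat p n) \<ge> target m (real n) - low"
      using non_turan_lower(1)[OF assms n E'(1)] unfolding m_def[symmetric] low_def[symmetric] E'(2) .
    moreover have "real (min_sat p n) \<le> target m (real n) + up"
      using min_sat_bounds(1)[OF finite_family E(1)] E(2) by linarith
    ultimately show "non_turan_family p n \<noteq> {} \<and> \<bar>real (min_sat p n) - target (real p - 1) (real n)\<bar> \<le> low + up"
      using E(1) pos unfolding m_def[symmetric] by auto
  qed
  show "\<forall>n\<ge>8 * p^5. int p * (int p - 1) * (4 * (int p)^2 - 11 * int p + 8) dvd int n \<longrightarrow>
     non_turan_family p n \<noteq> {} \<and> real (min_sat p n) = target (real p - 1) (real n)"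
  proof (intro allI impI)
    fix n assume n: "8 * p^5 \<le> n" and dv: "int p * (int p - 1) * (4 * (int p)^2 - 11 * int p + 8) dvd int n"
    define D where "D = int p * (int p - 1) * (4 * (int p)^2 - 11 * int p + 8)"
    define M where "M = 4 * m^2 - 3 * m + 1"
    have M0: "M > 0" using den_bounds(1)[OF m2] by (simp add: M_def)
    obtain i where i: "int n = D * i" using dv unfolding D_def by (elim dvdE)
    have rD: "real_of_int D = (m + 1) * m * M"
      by (simp add: D_def m_def M_def power2_eq_square algebra_simps)
    have rn: "real n = (m + 1) * m * M * real_of_int i"
      using arg_cong[OF i, of real_of_int] rD by simp
    have "i \<ge> 0"
    proof (rule ccontr)
      assume "\<not> i \<ge> 0"
      moreover have "(m + 1) * m * M > 0" using m2 M0 by simp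
      ultimately have "real n < 0" unfolding rn by (simp add: mult_pos_neg)
      then show False by simp
    qed
    then obtain j where j: "i = int j" using nonneg_int_cases by blast
    have rnj: "real n = (m + 1) * m * M * real j" using rn by (simp add: j)
    obtain E where E: "E \<in> non_turan_family p n" "real (sat_count (p + 1) {..<n} E) \<le> target m (real n)"
      using non_turan_upper[OF assms n, of j] rnj unfolding m_def[symmetric] M_def by blast
    obtain E' where E': "E' \<in> non_turan_family p n" "min_sat p n = sat_count (p + 1) {..<n} E'"
      using min_sat_bounds(2)[OF finite_family E(1)] by blast
    have dvd': "(p - 1) dvd n"
    proof -
      have "int (p - 1) dvd int n" unfolding i D_def using assms by (simp add: of_nat_diff)
      then show ?thesis by simp
    qed
    have gt: "real (min_sat p n) > target m (real n) - 1"
      using non_turan_lower(2)[OF assms n E'(1) dvd'] unfolding m_def[symmetric] E'(2) .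
    have le: "real (min_sat p n) \<le> target m (real n)"
      using min_sat_bounds(1)[OF finite_family E(1)] E(2) by linarith
    define I where "I = 2 * (int p - 2)^2 * int p * (int p - 1)^2 * (4 * (int p)^2 - 11 * int p + 8) * int j^2
       - (int p - 2) * (2 * int p - 3) * int p * (int p - 1) * int j"
    have "target m (real n) = 2 * (m - 1)^2 * (m + 1) * m^2 * M * real j^2 - (m - 1) * (2 * m - 1) * (m + 1) * m * real j"
      unfolding target_def M_def[symmetric] rnj using M0 m2 by (simp add: power2_eq_square)
    also have "\<dots> = real_of_int I"
      by (simp add: I_def m_def M_def power2_eq_square algebra_simps)
    finally have I: "target m (real n) = real_of_int I" .
    have "real_of_int I - 1 < real_of_int (int (min_sat p n))" "real_of_int (int (min_sat p n)) \<le> real_of_int I"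
      using gt le I by auto
    then have "int (min_sat p n) = I" by linarith
    then have "real (min_sat p n) = target m (real n)" unfolding I by (metis of_int_of_nat_eq)
    then show "non_turan_family p n \<noteq> {} \<and> real (min_sat p n) = target (real p - 1) (real n)"
      using E(1) unfolding m_def by auto
  qed
qed

end
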